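(* Let $N$ be a Calabi–Yau manifold of complex dimension $4$ with Cayley calibration $\Omega=\frac12\omega\wedge\omega+\mathrm{Re}(\rho)$ and let $M$ be a $4$-dimensional immersed submanifold of $N$ calibrated by $\Omega$ (a Cayley submanifold), with normal bundle $NM$. Then the bilinear map $$\Omega^{\triangle}:\textstyle\bigwedge^2T_pM\times\bigwedge^2NM_p\to\mathbb R,\qquad \Omega^\triangle(X\wedge Y,U\wedge V)=\Omega(X,Y,U,V),$$ defines a natural orientation-reversing isometric bundle isomorphism between $\bigwedge^2_+TM$ and $\bigwedge^2_+NM$.
   Context: $\omega(X,Y)=g(JX,Y)$ is the Kähler form of $(N,J,g)$, and $\rho$ is one of the $S^1$-family of parallel holomorphic volume forms of $N$. Locally on $N$ there are frames $e_1,\dots,e_8$, isometric at each point to the standard basis of $\mathbb R^8$, in which $$\Omega=dx_{1234}+dx_{5678}+(dx_{12}+dx_{34})\wedge(dx_{56}+dx_{78})+(dx_{13}-dx_{24})\wedge(dx_{57}-dx_{68})-(dx_{14}+dx_{23})\wedge(dx_{58}+dx_{67}),$$ and at a point of $M$ the frame can be chosen so that $e_1,\dots,e_4$ and $e_5,\dots,e_8$ are direct orthonormal bases of $T_pM$ and $NM_p$ respectively. $\bigwedge^2_+$ denotes self-dual bivectors with respect to the induced metrics and these orientations. For a direct orthonormal basis $e_1,\dots,e_4$, the elements $e_1\wedge e_2+e_3\wedge e_4$, $e_1\wedge e_3-e_2\wedge e_4$, $e_1\wedge e_4+e_2\wedge e_3$ form a direct orthogonal basis (each of norm $\sqrt2$)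 of the self-dual bivectors. The restriction of $\Omega^\triangle$ to $\bigwedge^2_+T_pM\times\bigwedge^2_+NM_p$ is identified, in the canonical way via the musical isomorphisms of the induced metrics, with a linear map $\bigwedge^2_+T_pM\to\bigwedge^2_+NM_p$, namely $\langle\Omega^\triangle(X\wedge Y),U\wedge V\rangle=\Omega(X,Y,U,V)$; this is the bundle map referred to in the claim.
   Formalization: With the metric giving e12+e34 norm √2, the map with ⟨Ω^△(X∧Y),U∧V⟩=Ω(X,Y,U,V) is twice an isometry (e12+e34 goes to 2(e56+e78)); the identification is therefore made with twice that metric, i.e. the map is halved, and isometry is proved for the √2 metric. *)

theory Defs
  imports "HOL-Analysis.Analysis"
begin

section \<open>Smooth functions\<close>

text \<open>Only used on open sets, so derivatives are taken with respect to the full filter \<open>at x\<close>.\<close>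

primrec C_k_on :: "nat \<Rightarrow> 'a::euclidean_space set \<Rightarrow> ('a \<Rightarrow> 'b::real_normed_vector) \<Rightarrow> bool" where
  "C_k_on 0 S F \<longleftrightarrow> continuous_on S F"
| "C_k_on (Suc k) S F \<longleftrightarrow> (\<forall>x\<in>S. F differentiable (at x)) \<and>
     (\<forall>b\<in>Basis. C_k_on k S (\<lambda>x. frechet_derivative F (at x) b))"

definition smooth_on :: "'a::euclidean_space set \<Rightarrow> ('a \<Rightarrow> 'b::real_normed_vector) \<Rightarrow> bool" where
  "smooth_on S F \<longleftrightarrow> (\<forall>k. C_k_on k S F)"

definition dir_deriv :: "('a::euclidean_space \<Rightarrow> 'b::real_normed_vector) \<Rightarrow> 'a \<Rightarrow> 'a \<Rightarrow> 'b" where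
  "dir_deriv F x u = frechet_derivative F (at x) u"

section \<open>Smooth manifolds and tangent spaces\<close>

text \<open>A manifold is a whole (Hausdorff, second countable) type with an atlas; a chart is a pair of
  its domain and its coordinate map.\<close>

type_synonym ('m, 'a) chart = "'m set \<times> ('m \<Rightarrow> 'a)"

definition chart_inv :: "('m, 'a) chart \<Rightarrow> 'a \<Rightarrow> 'm" where
  "chart_inv c = inv_into (fst c) (snd c)"

definition transition :: "('m, 'a) chart \<Rightarrow> ('m, 'a) chart \<Rightarrow> 'a \<Rightarrow> 'a" where
  "transition c d = snd d \<circ> chart_inv c"

definition smooth_atlas ::
    "('m::{t2_space, second_countable_topology}, 'a::euclidean_space) chart set \<Rightarrow> bool" where
  "smooth_atlas \<A> \<longleftrightarrow>
     (\<Union>c\<in>\<A>. fst c) = UNIV \<and>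
     (\<forall>c\<in>\<A>. open (fst c) \<and> open (snd c ` fst c) \<and>
        homeomorphism (fst c) (snd c ` fst c) (snd c) (chart_inv c)) \<and>
     (\<forall>c\<in>\<A>. \<forall>d\<in>\<A>. smooth_on (snd c ` (fst c \<inter> fst d)) (transition c d))"

text \<open>The tangent space at \<open>p\<close> is the model space, identified through a preferred chart
  \<open>chart_at \<A> p\<close> around \<open>p\<close>. The maps \<open>from_chart\<close> and \<open>to_chart\<close> convert between the components
  of a tangent vector in an arbitrary chart and the tangent vector itself.\<close>

definition chart_at :: "('m, 'a) chart set \<Rightarrow> 'm \<Rightarrow> ('m, 'a) chart" where
  "chart_at \<A> p = (SOME c. c \<in> \<A> \<and> p \<in> fst c)"

definition from_chart ::
    "('m, 'a::euclidean_space) chart set \<Rightarrow> ('m, 'a) chart \<Rightarrow> 'm \<Rightarrow> 'a \<Rightarrow> 'a" where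
  "from_chart \<A> c p v = dir_deriv (transition c (chart_at \<A> p)) (snd c p) v"

definition to_chart ::
    "('m, 'a::euclidean_space) chart set \<Rightarrow> ('m, 'a) chart \<Rightarrow> 'm \<Rightarrow> 'a \<Rightarrow> 'a" where
  "to_chart \<A> c p v = dir_deriv (transition (chart_at \<A> p) c) (snd (chart_at \<A> p) p) v"

definition comp2 ::
    "('m, 'a::euclidean_space) chart set \<Rightarrow> ('m \<Rightarrow> 'a \<Rightarrow> 'a \<Rightarrow> 'b) \<Rightarrow> ('m, 'a) chart \<Rightarrow>
     'a \<Rightarrow> 'a \<Rightarrow> 'a \<Rightarrow> 'b" where
  "comp2 \<A> h c x u v =
     (let p = chart_inv c x; D = from_chart \<A> c p in h p (D u) (D v))"

definition comp4 ::
    "('m, 'a::euclidean_space) chart set \<Rightarrow> ('m \<Rightarrow> 'a \<Rightarrow> 'a \<Rightarrow> 'a \<Rightarrow> 'a \<Rightarrow> 'b) \<Rightarrow> ('m, 'a) chart \<Rightarrow>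
     'a \<Rightarrow> 'a \<Rightarrow> 'a \<Rightarrow> 'a \<Rightarrow> 'a \<Rightarrow> 'b" where
  "comp4 \<A> h c x v1 v2 v3 v4 =
     (let p = chart_inv c x; D = from_chart \<A> c p in h p (D v1) (D v2) (D v3) (D v4))"

section \<open>Riemannian metrics\<close>

definition inner_product_form :: "('a::real_vector \<Rightarrow> 'a \<Rightarrow> real) \<Rightarrow> bool" where
  "inner_product_form h \<longleftrightarrow>
     bilinear h \<and> (\<forall>u v. h u v = h v u) \<and> (\<forall>u. u \<noteq> 0 \<longrightarrow> h u u > 0)"

definition orthonormal :: "('a \<Rightarrow> 'a \<Rightarrow> real) \<Rightarrow> 'a list \<Rightarrow> bool" where
  "orthonormal h xs \<longleftrightarrow>
     (\<forall>i<length xs. \<forall>j<length xs. h (xs ! i) (xs ! j) = (if i = j then 1 else 0))"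

definition riemannian_metric ::
    "('m, 'a::euclidean_space) chart set \<Rightarrow> ('m \<Rightarrow> 'a \<Rightarrow> 'a \<Rightarrow> real) \<Rightarrow> bool" where
  "riemannian_metric \<A> g \<longleftrightarrow>
     (\<forall>p. inner_product_form (g p)) \<and>
     (\<forall>c\<in>\<A>. \<forall>u v. smooth_on (snd c ` fst c) (\<lambda>x. comp2 \<A> g c x u v))"

text \<open>The Levi-Civita connection in the chart \<open>c\<close>: the covariant derivative \<open>\<nabla>\<^sub>u v\<close> of the constant
  coordinate fields \<open>u\<close> and \<open>v\<close>, given by the Koszul formula.\<close>

definition christoffel ::
    "('m, 'a::euclidean_space) chart set \<Rightarrow> ('m \<Rightarrow> 'a \<Rightarrow> 'a \<Rightarrow> real) \<Rightarrow> ('m, 'a) chart \<Rightarrow>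
     'a \<Rightarrow> 'a \<Rightarrow> 'a \<Rightarrow> 'a" where
  "christoffel \<A> g c x u v = (THE w. \<forall>z. 2 * comp2 \<A> g c x w z =
     dir_deriv (\<lambda>y. comp2 \<A> g c y v z) x u + dir_deriv (\<lambda>y. comp2 \<A> g c y u z) x v
     - dir_deriv (\<lambda>y. comp2 \<A> g c y u v) x z)"

definition parallel4 ::
    "('m, 'a::euclidean_space) chart set \<Rightarrow> ('m \<Rightarrow> 'a \<Rightarrow> 'a \<Rightarrow> real) \<Rightarrow>
     ('m \<Rightarrow> 'a \<Rightarrow> 'a \<Rightarrow> 'a \<Rightarrow> 'a \<Rightarrow> 'b::real_normed_vector) \<Rightarrow> bool" where
  "parallel4 \<A> g \<Phi> \<longleftrightarrow>
     (\<forall>c\<in>\<A>. \<forall>x\<in>snd c ` fst c. \<forall>u v1 v2 v3 v4.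
        let \<Gamma> = christoffel \<A> g c x u; \<Psi> = comp4 \<A> \<Phi> c x in
        dir_deriv (\<lambda>y. comp4 \<A> \<Phi> c y v1 v2 v3 v4) x u =
          \<Psi> (\<Gamma> v1) v2 v3 v4 + \<Psi> v1 (\<Gamma> v2) v3 v4 + \<Psi> v1 v2 (\<Gamma> v3) v4 + \<Psi> v1 v2 v3 (\<Gamma> v4))"

section \<open>Calabi--Yau manifolds of complex dimension 4\<close>

text \<open>\<open>\<complex>\<^sup>4\<close> is modelled as \<open>\<real>\<^sup>8\<close> with coordinates \<open>(x\<^sub>1, y\<^sub>1, \<dots>, x\<^sub>4, y\<^sub>4)\<close>, \<open>z\<^sub>k = x\<^sub>k + \<i> y\<^sub>k\<close>, so that
  the complex orientation is the standard orientation of \<open>\<real>\<^sup>8\<close>; \<open>cJ\<close> is multiplication by \<open>\<i>\<close>. In \<open>vector [\<dots>]\<close> the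
  entries have the indices \<open>1, 2, \<dots>\<close>; in the index type \<open>8\<close> the numeral \<open>8\<close> is \<open>0\<close>.
  Transition maps of a complex atlas are holomorphic, hence \<open>cJ\<close> is also the complex structure of
  every tangent space.\<close>

definition cJ :: "real^8 \<Rightarrow> real^8" where
  "cJ v = vector [- v$2, v$1, - v$4, v$3, - v$6, v$5, - v$8, v$7]"

definition complex_atlas ::
    "('m::{t2_space, second_countable_topology}, real^8) chart set \<Rightarrow> bool" where
  "complex_atlas \<A> \<longleftrightarrow> smooth_atlas \<A> \<and>
     (\<forall>c\<in>\<A>. \<forall>d\<in>\<A>. \<forall>x\<in>snd c ` (fst c \<inter> fst d). \<forall>u.
        dir_deriv (transition c d) x (cJ u) = cJ (dir_deriv (transition c d) x u))"

definition kaehler_form :: "('m \<Rightarrow> real^8 \<Rightarrow> real^8 \<Rightarrow> real) \<Rightarrow> 'm \<Rightarrow> real^8 \<Rightarrow> real^8 \<Rightarrow> real" where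
  "kaehler_form g p u v = g p (cJ u) v"

definition closed2 ::
    "('m, 'a::euclidean_space) chart set \<Rightarrow> ('m \<Rightarrow> 'a \<Rightarrow> 'a \<Rightarrow> real) \<Rightarrow> bool" where
  "closed2 \<A> \<omega> \<longleftrightarrow> (\<forall>c\<in>\<A>. \<forall>x\<in>snd c ` fst c. \<forall>u v w.
     dir_deriv (\<lambda>y. comp2 \<A> \<omega> c y v w) x u + dir_deriv (\<lambda>y. comp2 \<A> \<omega> c y w u) x v
     + dir_deriv (\<lambda>y. comp2 \<A> \<omega> c y u v) x w = 0)"

definition kaehler_metric ::
    "('m, real^8) chart set \<Rightarrow> ('m \<Rightarrow> real^8 \<Rightarrow> real^8 \<Rightarrow> real) \<Rightarrow> bool" where
  "kaehler_metric \<A> g \<longleftrightarrow> riemannian_metric \<A> g \<and>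
     (\<forall>p u v. g p (cJ u) (cJ v) = g p u v) \<and> closed2 \<A> (kaehler_form g)"

definition alternating4 ::
    "('a::real_vector \<Rightarrow> 'a \<Rightarrow> 'a \<Rightarrow> 'a \<Rightarrow> 'b::real_vector) \<Rightarrow> bool" where
  "alternating4 \<Phi> \<longleftrightarrow>
     (\<forall>a b c. linear (\<lambda>x. \<Phi> x a b c) \<and> linear (\<lambda>x. \<Phi> a x b c) \<and>
              linear (\<lambda>x. \<Phi> a b x c) \<and> linear (\<lambda>x. \<Phi> a b c x)) \<and>
     (\<forall>a b c. \<Phi> a a b c = 0 \<and> \<Phi> b a a c = 0 \<and> \<Phi> b c a a = 0)"

text \<open>A nowhere vanishing form of type \<open>(4,0)\<close> whose coefficient in every complex chart is a
  holomorphic function (Cauchy--Riemann equations).\<close>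

definition holomorphic_volume_form ::
    "('m, real^8) chart set \<Rightarrow>
     ('m \<Rightarrow> real^8 \<Rightarrow> real^8 \<Rightarrow> real^8 \<Rightarrow> real^8 \<Rightarrow> complex) \<Rightarrow> bool" where
  "holomorphic_volume_form \<A> \<rho> \<longleftrightarrow>
     (\<forall>p. alternating4 (\<rho> p) \<and> (\<forall>a b c d. \<rho> p (cJ a) b c d = \<i> * \<rho> p a b c d) \<and>
          (\<exists>a b c d. \<rho> p a b c d \<noteq> 0)) \<and>
     (\<forall>c\<in>\<A>. \<forall>v1 v2 v3 v4.
        smooth_on (snd c ` fst c) (\<lambda>x. comp4 \<A> \<rho> c x v1 v2 v3 v4) \<and>
        (\<forall>x\<in>snd c ` fst c. \<forall>u.
           dir_deriv (\<lambda>y. comp4 \<A> \<rho> c y v1 v2 v3 v4) x (cJ u) =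
           \<i> * dir_deriv (\<lambda>y. comp4 \<A> \<rho> c y v1 v2 v3 v4) x u))"

text \<open>The normalisation \<open>\<bar>\<rho>(u\<^sub>1,\<dots>,u\<^sub>4)\<bar> = 1\<close> on unitary bases, that is
  \<open>\<omega>\<^sup>4 / 4! = \<rho> \<and> \<rho>\<^sup>* / 16\<close> with \<open>\<rho>\<^sup>*\<close> the conjugate of \<open>\<rho>\<close>, singles out the
  \<open>S\<^sup>1\<close>-family among all parallel holomorphic volume forms.\<close>

definition calabi_yau4 ::
    "('m::{t2_space, second_countable_topology}, real^8) chart set \<Rightarrow>
     ('m \<Rightarrow> real^8 \<Rightarrow> real^8 \<Rightarrow> real) \<Rightarrow>
     ('m \<Rightarrow> real^8 \<Rightarrow> real^8 \<Rightarrow> real^8 \<Rightarrow> real^8 \<Rightarrow> complex) \<Rightarrow> bool" where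
  "calabi_yau4 \<A> g \<rho> \<longleftrightarrow>
     complex_atlas \<A> \<and> kaehler_metric \<A> g \<and>
     holomorphic_volume_form \<A> \<rho> \<and> parallel4 \<A> g \<rho> \<and>
     (\<forall>p u1 u2 u3 u4. orthonormal (g p) [u1, cJ u1, u2, cJ u2, u3, cJ u3, u4, cJ u4] \<longrightarrow>
        cmod (\<rho> p u1 u2 u3 u4) = 1)"

definition wedge22 ::
    "('a \<Rightarrow> 'a \<Rightarrow> real) \<Rightarrow> ('a \<Rightarrow> 'a \<Rightarrow> real) \<Rightarrow> 'a \<Rightarrow> 'a \<Rightarrow> 'a \<Rightarrow> 'a \<Rightarrow> real" where
  "wedge22 \<alpha> \<beta> x y u v =
     \<alpha> x y * \<beta> u v - \<alpha> x u * \<beta> y v + \<alpha> x v * \<beta> y u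
     + \<alpha> y u * \<beta> x v - \<alpha> y v * \<beta> x u + \<alpha> u v * \<beta> x y"

definition cayley_form ::
    "('m \<Rightarrow> real^8 \<Rightarrow> real^8 \<Rightarrow> real) \<Rightarrow>
     ('m \<Rightarrow> real^8 \<Rightarrow> real^8 \<Rightarrow> real^8 \<Rightarrow> real^8 \<Rightarrow> complex) \<Rightarrow>
     'm \<Rightarrow> real^8 \<Rightarrow> real^8 \<Rightarrow> real^8 \<Rightarrow> real^8 \<Rightarrow> real" where
  "cayley_form g \<rho> p x y u v =
     (1/2) * wedge22 (kaehler_form g p) (kaehler_form g p) x y u v + Re (\<rho> p x y u v)"

section \<open>Immersed Cayley submanifolds\<close>

definition oriented_atlas4 ::
    "('m::{t2_space, second_countable_topology}, real^4) chart set \<Rightarrow> bool" where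
  "oriented_atlas4 \<A> \<longleftrightarrow> smooth_atlas \<A> \<and>
     (\<forall>c\<in>\<A>. \<forall>d\<in>\<A>. \<forall>x\<in>snd c ` (fst c \<inter> fst d).
        det (matrix (dir_deriv (transition c d) x)) > 0)"

definition differential ::
    "('m, 'a::euclidean_space) chart set \<Rightarrow> ('n, 'b::euclidean_space) chart set \<Rightarrow>
     ('m \<Rightarrow> 'n) \<Rightarrow> 'm \<Rightarrow> 'a \<Rightarrow> 'b" where
  "differential \<A> \<B> f p v =
     dir_deriv (snd (chart_at \<B> (f p)) \<circ> f \<circ> chart_inv (chart_at \<A> p)) (snd (chart_at \<A> p) p) v"

definition immersion ::
    "('m::topological_space, 'a::euclidean_space) chart set \<Rightarrow>
     ('n::topological_space, 'b::euclidean_space) chart set \<Rightarrow> ('m \<Rightarrow> 'n) \<Rightarrow> bool" where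
  "immersion \<A> \<B> f \<longleftrightarrow>
     continuous_on UNIV f \<and>
     (\<forall>c\<in>\<A>. \<forall>d\<in>\<B>.
        smooth_on (snd c ` (fst c \<inter> f -` fst d)) (snd d \<circ> f \<circ> chart_inv c)) \<and>
     (\<forall>p. inj (differential \<A> \<B> f p))"

text \<open>As usual for an immersion, \<open>T\<^sub>pM\<close> is identified with its image in \<open>T\<^bsub>f p\<^esub>N\<close>.\<close>

definition tangent_space ::
    "('m, real^4) chart set \<Rightarrow> ('n, real^8) chart set \<Rightarrow> ('m \<Rightarrow> 'n) \<Rightarrow> 'm \<Rightarrow> (real^8) set" where
  "tangent_space \<A> \<B> f p = range (differential \<A> \<B> f p)"

definition normal_fibre ::
    "('m, real^4) chart set \<Rightarrow> ('n, real^8) chart set \<Rightarrow> ('n \<Rightarrow> real^8 \<Rightarrow> real^8 \<Rightarrow> real) \<Rightarrow>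
     ('m \<Rightarrow> 'n) \<Rightarrow> 'm \<Rightarrow> (real^8) set" where
  "normal_fibre \<A> \<B> g f p = {n. \<forall>v\<in>tangent_space \<A> \<B> f p. g (f p) n v = 0}"

text \<open>Direct orthonormal bases of \<open>T\<^sub>pM\<close> and \<open>NM\<^sub>p\<close>. The normal bundle is oriented so that
  \<open>T\<^sub>pM \<oplus> NM\<^sub>p\<close> carries the complex orientation of \<open>N\<close>.\<close>

definition tangent_dob ::
    "('m, real^4) chart set \<Rightarrow> ('n, real^8) chart set \<Rightarrow> ('n \<Rightarrow> real^8 \<Rightarrow> real^8 \<Rightarrow> real) \<Rightarrow>
     ('m \<Rightarrow> 'n) \<Rightarrow> 'm \<Rightarrow> ((real^8) \<times> (real^8) \<times> (real^8) \<times> (real^8)) set" where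
  "tangent_dob \<A> \<B> g f p =
     {(e1, e2, e3, e4). orthonormal (g (f p)) [e1, e2, e3, e4] \<and>
        (\<exists>b1 b2 b3 b4. det (vector [b1, b2, b3, b4] :: real^4^4) > 0 \<and>
           [e1, e2, e3, e4] = map (differential \<A> \<B> f p) [b1, b2, b3, b4])}"

definition normal_dob ::
    "('m, real^4) chart set \<Rightarrow> ('n, real^8) chart set \<Rightarrow> ('n \<Rightarrow> real^8 \<Rightarrow> real^8 \<Rightarrow> real) \<Rightarrow>
     ('m \<Rightarrow> 'n) \<Rightarrow> 'm \<Rightarrow> ((real^8) \<times> (real^8) \<times> (real^8) \<times> (real^8)) set" where
  "normal_dob \<A> \<B> g f p =
     {(n1, n2, n3, n4). orthonormal (g (f p)) [n1, n2, n3, n4] \<and>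
        {n1, n2, n3, n4} \<subseteq> normal_fibre \<A> \<B> g f p \<and>
        (\<exists>(e1, e2, e3, e4) \<in> tangent_dob \<A> \<B> g f p.
           det (vector [e1, e2, e3, e4, n1, n2, n3, n4] :: real^8^8) > 0)}"

text \<open>Calibrated: \<open>\<Omega>\<close> restricts to the Riemannian volume form of the oriented manifold \<open>M\<close>.\<close>

definition cayley_immersion ::
    "('m::{t2_space, second_countable_topology}, real^4) chart set \<Rightarrow>
     ('n::topological_space, real^8) chart set \<Rightarrow>
     ('n \<Rightarrow> real^8 \<Rightarrow> real^8 \<Rightarrow> real) \<Rightarrow>
     ('n \<Rightarrow> real^8 \<Rightarrow> real^8 \<Rightarrow> real^8 \<Rightarrow> real^8 \<Rightarrow> complex) \<Rightarrow> ('m \<Rightarrow> 'n) \<Rightarrow> bool" where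
  "cayley_immersion \<A> \<B> g \<rho> f \<longleftrightarrow>
     oriented_atlas4 \<A> \<and> immersion \<A> \<B> f \<and>
     (\<forall>p. \<forall>(e1, e2, e3, e4) \<in> tangent_dob \<A> \<B> g f p. cayley_form g \<rho> (f p) e1 e2 e3 e4 = 1)"

section \<open>Bivectors\<close>

text \<open>Bivectors are skew-symmetric contravariant 2-tensors, with
  \<open>x \<and> y = x \<otimes> y - y \<otimes> x\<close>.\<close>

definition wedge :: "real^'n \<Rightarrow> real^'n \<Rightarrow> real^'n^'n" where
  "wedge x y = (\<chi> i j. x$i * y$j - x$j * y$i)"

definition bivectors :: "(real^'n) set \<Rightarrow> (real^'n^'n) set" where
  "bivectors V = span {wedge x y | x y. x \<in> V \<and> y \<in> V}"

text \<open>The metric on 2-tensors: both indices are lowered and the tensors fully contracted. It is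
  twice the determinant metric \<open>bivec_inner\<close>, for which \<open>x \<and> y\<close> has norm 1 if \<open>x\<close>, \<open>y\<close> are
  orthonormal (see the two lemmas below).\<close>

definition tensor_inner ::
    "(real^'n \<Rightarrow> real^'n \<Rightarrow> real) \<Rightarrow> real^'n^'n \<Rightarrow> real^'n^'n \<Rightarrow> real" where
  "tensor_inner h A B = (\<Sum>i\<in>UNIV. \<Sum>j\<in>UNIV. \<Sum>k\<in>UNIV. \<Sum>l\<in>UNIV.
     A$i$j * B$k$l * h (axis i 1) (axis k 1) * h (axis j 1) (axis l 1))"

definition bivec_inner ::
    "(real^'n \<Rightarrow> real^'n \<Rightarrow> real) \<Rightarrow> real^'n^'n \<Rightarrow> real^'n^'n \<Rightarrow> real" where
  "bivec_inner h A B = tensor_inner h A B / 2"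

text \<open>The extension of a 4-form \<open>\<Phi>\<close> to a bilinear map on bivectors with
  \<open>(x \<and> y, u \<and> v) \<mapsto> \<Phi> x y u v\<close>.\<close>

definition form4_bivec ::
    "(real^'n \<Rightarrow> real^'n \<Rightarrow> real^'n \<Rightarrow> real^'n \<Rightarrow> real) \<Rightarrow> real^'n^'n \<Rightarrow> real^'n^'n \<Rightarrow> real" where
  "form4_bivec \<Phi> A B = (1/4) * (\<Sum>i\<in>UNIV. \<Sum>j\<in>UNIV. \<Sum>k\<in>UNIV. \<Sum>l\<in>UNIV.
     A$i$j * B$k$l * \<Phi> (axis i 1) (axis j 1) (axis k 1) (axis l 1))"

text \<open>In the following, a subspace \<open>V\<close> of dimension 4 is oriented by its set \<open>D\<close> of direct
  orthonormal bases. The Hodge star is the isometry with \<open>\<star>(e\<^sub>1 \<and> e\<^sub>2) = e\<^sub>3 \<and> e\<^sub>4\<close> for all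
  \<open>(e\<^sub>1, e\<^sub>2, e\<^sub>3, e\<^sub>4) \<in> D\<close>.\<close>

definition hodge_star ::
    "(real^'n \<Rightarrow> real^'n \<Rightarrow> real) \<Rightarrow> (real^'n) set \<Rightarrow>
     ((real^'n) \<times> (real^'n) \<times> (real^'n) \<times> (real^'n)) set \<Rightarrow> real^'n^'n \<Rightarrow> real^'n^'n" where
  "hodge_star h V D A = (THE B. B \<in> bivectors V \<and>
     (\<forall>(e1, e2, e3, e4)\<in>D. bivec_inner h B (wedge e3 e4) = bivec_inner h A (wedge e1 e2)))"

definition self_dual_bivectors ::
    "(real^'n \<Rightarrow> real^'n \<Rightarrow> real) \<Rightarrow> (real^'n) set \<Rightarrow>
     ((real^'n) \<times> (real^'n) \<times> (real^'n) \<times> (real^'n)) set \<Rightarrow> (real^'n^'n) set" where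
  "self_dual_bivectors h V D = {A \<in> bivectors V. hodge_star h V D A = A}"

definition sd_frame ::
    "(real^'n) \<times> (real^'n) \<times> (real^'n) \<times> (real^'n) \<Rightarrow> real^'n^'n^3" where
  "sd_frame = (\<lambda>(e1, e2, e3, e4). vector
     [wedge e1 e2 + wedge e3 e4, wedge e1 e3 - wedge e2 e4, wedge e1 e4 + wedge e2 e3])"

definition sd_direct_basis ::
    "((real^'n) \<times> (real^'n) \<times> (real^'n) \<times> (real^'n)) set \<Rightarrow> real^'n^'n^3 \<Rightarrow> bool" where
  "sd_direct_basis D A \<longleftrightarrow> (\<exists>e\<in>D. \<exists>C::real^3^3. det C > 0 \<and>
     (\<forall>i. A$i = (\<Sum>j\<in>UNIV. C$i$j *\<^sub>R sd_frame e $ j)))"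

definition sd_opposite_basis ::
    "((real^'n) \<times> (real^'n) \<times> (real^'n) \<times> (real^'n)) set \<Rightarrow> real^'n^'n^3 \<Rightarrow> bool" where
  "sd_opposite_basis D A \<longleftrightarrow> (\<exists>e\<in>D. \<exists>C::real^3^3. det C < 0 \<and>
     (\<forall>i. A$i = (\<Sum>j\<in>UNIV. C$i$j *\<^sub>R sd_frame e $ j)))"

lemma form4_bivec_wedge:
  fixes \<Phi> :: "real^'n \<Rightarrow> real^'n \<Rightarrow> real^'n \<Rightarrow> real^'n \<Rightarrow> real"
  assumes "alternating4 \<Phi>"
  shows "form4_bivec \<Phi> (wedge x y) (wedge u v) = \<Phi> x y u v"
proof -
  have lin: "linear (\<lambda>x. \<Phi> x a b c)" "linear (\<lambda>x. \<Phi> a x b c)"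
    "linear (\<lambda>x. \<Phi> a b x c)" "linear (\<lambda>x. \<Phi> a b c x)" for a b c
    using assms by (auto simp: alternating4_def)
  have vanish: "\<Phi> a a b c = 0" "\<Phi> b c a a = 0" for a b c
    using assms by (auto simp: alternating4_def)
  have swap1: "\<Phi> b a c d = - \<Phi> a b c d" for a b c d
  proof -
    have "\<Phi> (a + b) (a + b) c d = 0" by (rule vanish)
    then have "\<Phi> a a c d + \<Phi> b a c d + (\<Phi> a b c d + \<Phi> b b c d) = 0"
      unfolding linear_add[OF lin(1)] linear_add[OF lin(2)] by (simp add: algebra_simps)
    then show ?thesis
      by (simp add: vanish)
  qed
  have swap2: "\<Phi> a b d c = - \<Phi> a b c d" for a b c d
  proof -
    have "\<Phi> a b (c + d) (c + d) = 0" by (rule vanish)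
    then have "\<Phi> a b c c + \<Phi> a b d c + (\<Phi> a b c d + \<Phi> a b d d) = 0"
      unfolding linear_add[OF lin(3)] linear_add[OF lin(4)] by (simp add: algebra_simps)
    then show ?thesis
      by (simp add: vanish)
  qed
  have expand: "\<Phi> p q r s = (\<Sum>i\<in>UNIV. \<Sum>j\<in>UNIV. \<Sum>k\<in>UNIV. \<Sum>l\<in>UNIV.
      p$i * q$j * r$k * s$l * \<Phi> (axis i 1) (axis j 1) (axis k 1) (axis l 1))" for p q r s
  proof -
    have e: "F p = (\<Sum>i\<in>UNIV. p$i * F (axis i 1))" if "linear F" for F :: "real^'n \<Rightarrow> real" and p
    proof -
      have "F p = F (\<Sum>i\<in>UNIV. p$i *\<^sub>R axis i 1)"
        using basis_expansion[of p] by (simp add: scalar_mult_eq_scaleR)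
      then show ?thesis
        by (simp add: linear_sum[OF that] linear_scale[OF that])
    qed
    show ?thesis
      by (subst e[OF lin(1)], subst e[OF lin(2)], subst e[OF lin(3)], subst e[OF lin(4)])
        (simp add: sum_distrib_left mult.assoc)
  qed
  have "form4_bivec \<Phi> (wedge x y) (wedge u v)
      = (1/4) * (\<Phi> x y u v - \<Phi> y x u v - \<Phi> x y v u + \<Phi> y x v u)"
    unfolding expand[of x y u v] expand[of y x u v] expand[of x y v u] expand[of y x v u]
    by (simp add: form4_bivec_def wedge_def algebra_simps flip: sum.distrib sum_subtractf)
  then show ?thesis
    by (simp add: swap1[of x y] swap2[of _ _ u v])
qed

lemma bivec_inner_wedge:
  fixes h :: "real^'n \<Rightarrow> real^'n \<Rightarrow> real"
  assumes "bilinear h"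
  shows "bivec_inner h (wedge x y) (wedge u v) = h x u * h y v - h x v * h y u"
proof -
  have lin: "linear (\<lambda>x. h x a)" "linear (h a)" for a
    using assms by (auto simp: bilinear_def)
  have expand: "h p r * h q s = (\<Sum>i\<in>UNIV. \<Sum>j\<in>UNIV. \<Sum>k\<in>UNIV. \<Sum>l\<in>UNIV.
      p$i * q$j * r$k * s$l * (h (axis i 1) (axis k 1) * h (axis j 1) (axis l 1)))" for p q r s
  proof -
    have e: "F p = (\<Sum>i\<in>UNIV. p$i * F (axis i 1))" if "linear F" for F :: "real^'n \<Rightarrow> real" and p
    proof -
      have "F p = F (\<Sum>i\<in>UNIV. p$i *\<^sub>R axis i 1)"
        using basis_expansion[of p] by (simp add: scalar_mult_eq_scaleR)
      then show ?thesis
        by (simp add: linear_sum[OF that] linear_scale[OF that])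
    qed
    have h: "h p r = (\<Sum>i\<in>UNIV. \<Sum>k\<in>UNIV. p$i * r$k * h (axis i 1) (axis k 1))" for p r
      by (subst e[OF lin(1)], subst e[OF lin(2)]) (simp add: sum_distrib_left mult.assoc)
    show ?thesis
      unfolding h[of p r] h[of q s] by (simp add: sum_product mult_ac)
  qed
  have "tensor_inner h (wedge x y) (wedge u v)
      = h x u * h y v - h y u * h x v - h x v * h y u + h y v * h x u"
    unfolding expand[of x u y v] expand[of y u x v] expand[of x v y u] expand[of y v x u]
    by (simp add: tensor_inner_def wedge_def algebra_simps flip: sum.distrib sum_subtractf)
  then show ?thesis
    by (simp add: bivec_inner_def algebra_simps)
qed

section \<open>The bundles of self-dual bivectors and the bundle map\<close>

definition sd_tangent ::
    "('m, real^4) chart set \<Rightarrow> ('n, real^8) chart set \<Rightarrow> ('n \<Rightarrow> real^8 \<Rightarrow> real^8 \<Rightarrow> real) \<Rightarrow>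
     ('m \<Rightarrow> 'n) \<Rightarrow> 'm \<Rightarrow> (real^8^8) set" where
  "sd_tangent \<A> \<B> g f p =
     self_dual_bivectors (g (f p)) (tangent_space \<A> \<B> f p) (tangent_dob \<A> \<B> g f p)"

definition sd_normal ::
    "('m, real^4) chart set \<Rightarrow> ('n, real^8) chart set \<Rightarrow> ('n \<Rightarrow> real^8 \<Rightarrow> real^8 \<Rightarrow> real) \<Rightarrow>
     ('m \<Rightarrow> 'n) \<Rightarrow> 'm \<Rightarrow> (real^8^8) set" where
  "sd_normal \<A> \<B> g f p =
     self_dual_bivectors (g (f p)) (normal_fibre \<A> \<B> g f p) (normal_dob \<A> \<B> g f p)"

text \<open>The linear map given by \<open>\<Omega>\<^sup>\<triangle>\<close> through the musical isomorphism of 2-tensors, that is,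
  \<open>tensor_inner (L A) B = \<Omega>\<^sup>\<triangle> A B\<close>. With \<open>bivec_inner\<close> in place of \<open>tensor_inner\<close> one would obtain
  \<open>2 L\<close>: for the standard Cayley form, \<open>\<Omega>\<^sup>\<triangle> (e\<^sub>1\<^sub>2 + e\<^sub>3\<^sub>4) (e\<^sub>5\<^sub>6 + e\<^sub>7\<^sub>8) = 4\<close>, so
  \<open>L (e\<^sub>1\<^sub>2 + e\<^sub>3\<^sub>4) = e\<^sub>5\<^sub>6 + e\<^sub>7\<^sub>8\<close>.\<close>

definition cayley_bivec_map ::
    "('m, real^4) chart set \<Rightarrow> ('n, real^8) chart set \<Rightarrow> ('n \<Rightarrow> real^8 \<Rightarrow> real^8 \<Rightarrow> real) \<Rightarrow>
     ('n \<Rightarrow> real^8 \<Rightarrow> real^8 \<Rightarrow> real^8 \<Rightarrow> real^8 \<Rightarrow> complex) \<Rightarrow>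
     ('m \<Rightarrow> 'n) \<Rightarrow> 'm \<Rightarrow> real^8^8 \<Rightarrow> real^8^8" where
  "cayley_bivec_map \<A> \<B> g \<rho> f p A = (THE B. B \<in> sd_normal \<A> \<B> g f p \<and>
     (\<forall>B'\<in>sd_normal \<A> \<B> g f p.
        tensor_inner (g (f p)) B B' = form4_bivec (cayley_form g \<rho> (f p)) A B'))"

text \<open>Both bundles are subbundles of the pull-back of the bundle of 2-tensors of \<open>N\<close> along \<open>f\<close>, so
  a section is smooth iff its components in the charts of \<open>N\<close> depend smoothly on \<open>p\<close>.\<close>

definition smooth_bivec_section ::
    "('m::topological_space, real^4) chart set \<Rightarrow> ('n::topological_space, real^8) chart set \<Rightarrow>
     ('m \<Rightarrow> 'n) \<Rightarrow> 'm set \<Rightarrow> ('m \<Rightarrow> real^8^8) \<Rightarrow> bool" where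
  "smooth_bivec_section \<A> \<B> f W \<sigma> \<longleftrightarrow>
     (\<forall>c\<in>\<A>. \<forall>d\<in>\<B>. smooth_on (snd c ` (W \<inter> fst c \<inter> f -` fst d))
        (\<lambda>x. let p = chart_inv c x; T = matrix (to_chart \<B> d (f p)) in
             T ** \<sigma> p ** transpose T))"

text \<open>Fibrewise linear isomorphism, smooth together with its inverse: it maps the smooth local sections
  of \<open>E\<close> exactly to the smooth local sections of \<open>F\<close>.\<close>

definition bivec_bundle_isomorphism ::
    "('m::topological_space, real^4) chart set \<Rightarrow> ('n::topological_space, real^8) chart set \<Rightarrow>
     ('m \<Rightarrow> 'n) \<Rightarrow> ('m \<Rightarrow> (real^8^8) set) \<Rightarrow> ('m \<Rightarrow> (real^8^8) set) \<Rightarrow>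
     ('m \<Rightarrow> real^8^8 \<Rightarrow> real^8^8) \<Rightarrow> bool" where
  "bivec_bundle_isomorphism \<A> \<B> f E F L \<longleftrightarrow>
     (\<forall>p. bij_betw (L p) (E p) (F p) \<and>
        (\<forall>A\<in>E p. \<forall>B\<in>E p. \<forall>a b. L p (a *\<^sub>R A + b *\<^sub>R B) = a *\<^sub>R L p A + b *\<^sub>R L p B)) \<and>
     (\<forall>W \<sigma>. open W \<longrightarrow> (\<forall>p\<in>W. \<sigma> p \<in> E p) \<longrightarrow>
        (smooth_bivec_section \<A> \<B> f W \<sigma> \<longleftrightarrow>
         smooth_bivec_section \<A> \<B> f W (\<lambda>p. L p (\<sigma> p))))"

end

theory Submission
  imports Defs
begin

text \<open>
  Fix a point of \<open>M\<close> and a direct orthonormal basis \<open>e\<^sub>1, \<dots>, e\<^sub>4\<close> of the tangent space. A unitary basis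
  adapted to \<open>e\<^sub>1, e\<^sub>2, e\<^sub>3\<close> expresses these vectors by five real parameters on a product of two spheres;
  since \<open>\<Omega>(e\<^sub>1, e\<^sub>2, e\<^sub>3, e\<^sub>4) = 1\<close>, equality holds in the Cauchy--Schwarz inequality and \<open>e\<^sub>4\<close> is the triple product
  of \<open>e\<^sub>1, e\<^sub>2, e\<^sub>3\<close>. The normal vectors \<open>n\<^sub>1 = i u\<^sub>4\<close>, \<open>n\<^sub>k = \<plusminus> e\<^sub>1 \<times> e\<^sub>k \<times> n\<^sub>1\<close> complete a frame in which \<open>\<Omega>\<close> takes its
  standard form, so the bundle map sends the self-dual basis of \<open>e\<close> to that of \<open>n\<close> with the signs \<open>+, +, -\<close>.

  Smoothness needs no local frames. If \<open>A\<^sup>\<sharp>\<close> is the 2-tensor dual to \<open>\<Omega>\<^sup>\<triangle>(A, \<cdot>)\<close>, the standard form gives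
  \<open>A\<^sup>\<sharp> = A / 2 + L A\<close> for \<open>A\<close> self-dual tangential and \<open>B\<^sup>\<sharp> = B / 2 + L\<^sup>-\<^sup>1 B\<close> for \<open>B\<close> self-dual normal. Hence \<open>L\<close> and its inverse
  are restrictions of the same operator, which is smooth in charts by Cramer's rule.
\<close>

section \<open>Calculus of smooth functions\<close>

text \<open>The main obstacle is the orientation of the normal bundle: it is fixed by an 8 by 8
  determinant, while the rest of the argument speaks of \<Omega>. Alternating 4-forms on a
  4-dimensional space are proportional, so it is enough to know the sign of the determinant on one
  frame in which \<Omega> is standard. Connectedness of the parameter space moves this question to a
  complex basis; there a complex linear map is joined to the identity outside finitely many singular
  parameters. The parameters also replace any appeal to transitivity of Spin(7) on Cayley planes:
  each value of \<Omega> on the frame is a polynomial identity modulo the two sphere equations. The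
  term A / 2 is the tangential part of \<Omega>(A, .): this part is the Hodge star of A with respect
  to \<open>bivec_inner\<close>, and \<open>tensor_inner\<close> is twice as large. Tangent vectors
  are identified through \<open>chart_at\<close>, a choice that need not be continuous in the point.
  An operator that commutes with changes of basis can nevertheless be moved to a fixed chart, where
  its smoothness is visible.\<close>

lemma frechet_derivative_eq:
  "(F has_derivative F') (at x) \<Longrightarrow> frechet_derivative F (at x) = F'"
  by (rule frechet_derivative_at[symmetric])

text \<open>Equality on an open set is equality near each of its points, so the derivatives agree
  there too; this drives the induction on the order.\<close>

lemma C_k_on_cong:
  assumes "open S" "\<And>x. x \<in> S \<Longrightarrow> F x = G x" "C_k_on k S F"
  shows "C_k_on k S G"
  using assms(2,3)
proof (induction k arbitrary: F G)
  case 0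
  then show ?case
    by (metis C_k_on.simps(1) continuous_on_cong)
next
  case (Suc k)
  have G: "(G has_derivative frechet_derivative F (at x)) (at x)" if "x \<in> S" for x
  proof (rule has_derivative_transform_within_open[OF _ assms(1) that])
    show "(F has_derivative frechet_derivative F (at x)) (at x)"
      using Suc.prems(2) that by (simp add: frechet_derivative_works)
  qed (use Suc.prems in auto)
  have "C_k_on k S (\<lambda>x. frechet_derivative G (at x) b)" if "b \<in> Basis" for b
    by (rule Suc.IH[where F = "\<lambda>x. frechet_derivative F (at x) b"])
      (use Suc.prems(2) that in \<open>simp_all add: frechet_derivative_eq[OF G]\<close>)
  moreover have "\<forall>x\<in>S. G differentiable (at x)"
    using G differentiable_def by blast
  ultimately show ?case
    by simp
qed

lemma C_k_on_SucD:
  assumes "C_k_on (Suc k) S F"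
  shows "C_k_on k S F"
  using assms
proof (induction k arbitrary: F)
  case 0
  then have "F differentiable_on S"
    by (simp add: differentiable_at_imp_differentiable_on)
  then show ?case
    by (simp add: differentiable_imp_continuous_on)
next
  case (Suc k)
  have "\<forall>x\<in>S. F differentiable (at x)"
    and "\<And>b. b \<in> Basis \<Longrightarrow> C_k_on (Suc k) S (\<lambda>x. frechet_derivative F (at x) b)"
    using Suc.prems C_k_on.simps(2)[of "Suc k"] by blast+
  then show ?case
    using Suc.IH by simp
qed

text \<open>Lets the derivative be supplied as an explicit formula \<open>F'\<close>, so that the
  rules below need not evaluate \<open>frechet_derivative\<close> of a compound function.\<close>

lemma C_k_on_SucI:
  assumes "open S" "\<And>x. x \<in> S \<Longrightarrow> (F has_derivative F' x) (at x)"
    and "\<And>b. b \<in> Basis \<Longrightarrow> C_k_on k S (\<lambda>x. F' x b)"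
  shows "C_k_on (Suc k) S F"
proof -
  have "C_k_on k S (\<lambda>x. frechet_derivative F (at x) b)" if "b \<in> Basis" for b
    by (rule C_k_on_cong[OF assms(1) _ assms(3)[OF that]])
      (simp add: frechet_derivative_eq[OF assms(2)])
  moreover have "\<forall>x\<in>S. F differentiable (at x)"
    using assms(2) differentiable_def by blast
  ultimately show ?thesis
    by simp
qed

lemma C_k_on_SucE:
  assumes "C_k_on (Suc k) S F"
  obtains "\<And>x. x \<in> S \<Longrightarrow> (F has_derivative frechet_derivative F (at x)) (at x)"
    and "\<And>b. b \<in> Basis \<Longrightarrow> C_k_on k S (\<lambda>x. frechet_derivative F (at x) b)"
  using assms by (auto simp: frechet_derivative_works)

lemma C_k_on_const: "open S \<Longrightarrow> C_k_on k S (\<lambda>x. c)"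
proof (induction k arbitrary: c)
  case (Suc k)
  then show ?case
    by (intro C_k_on_SucI[where F' = "\<lambda>x b. 0"]) auto
qed simp

lemma C_k_on_linear:
  assumes "open S" "bounded_linear l" "C_k_on k S F"
  shows "C_k_on k S (\<lambda>x. l (F x))"
  using assms(3)
proof (induction k arbitrary: F)
  case 0
  then show ?case
    using bounded_linear.continuous_on[OF assms(2)] by auto
next
  case (Suc k)
  from Suc.prems show ?case
    by (elim C_k_on_SucE, intro C_k_on_SucI[where F' = "\<lambda>x b. l (frechet_derivative F (at x) b)"])
      (auto intro: assms(1) bounded_linear.has_derivative[OF assms(2)] Suc.IH)
qed

lemma C_k_on_add:
  assumes "open S" "C_k_on k S F" "C_k_on k S G"
  shows "C_k_on k S (\<lambda>x. F x + G x)"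
  using assms(2,3)
proof (induction k arbitrary: F G)
  case 0
  then show ?case
    by (auto intro: continuous_on_add)
next
  case (Suc k)
  from Suc.prems show ?case
    by (elim C_k_on_SucE, intro C_k_on_SucI[where F' = "\<lambda>x b. frechet_derivative F (at x) b
        + frechet_derivative G (at x) b"])
      (auto intro: assms(1) has_derivative_add Suc.IH)
qed

text \<open>The product rule puts \<open>F\<close> and \<open>G\<close> themselves next to
  derivatives, so the induction also needs both functions at the lower order, which
  \<open>C_k_on_SucD\<close> provides.\<close>

lemma C_k_on_bilinear:
  assumes "open S" "bounded_bilinear m" "C_k_on k S F" "C_k_on k S G"
  shows "C_k_on k S (\<lambda>x. m (F x) (G x))"
  using assms(3,4)
proof (induction k arbitrary: F G)
  case 0
  then show ?case
    using bounded_bilinear.continuous_on[OF assms(2)] by auto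
next
  case (Suc k)
  have FG: "C_k_on k S F" "C_k_on k S G"
    using Suc.prems C_k_on_SucD by blast+
  from Suc.prems FG show ?case
    by (elim C_k_on_SucE, intro C_k_on_SucI[where F' = "\<lambda>x b.
        m (F x) (frechet_derivative G (at x) b) + m (frechet_derivative F (at x) b) (G x)"])
      (auto intro!: assms(1) bounded_bilinear.FDERIV[OF assms(2)] C_k_on_add Suc.IH)
qed

lemma C_k_on_sum:
  assumes "open S" "\<And>i. i \<in> I \<Longrightarrow> C_k_on k S (F i)"
  shows "C_k_on k S (\<lambda>x. \<Sum>i\<in>I. F i x)"
  using assms(2)
  by (induction I rule: infinite_finite_induct)
    (auto intro!: C_k_on_add assms(1) C_k_on_const)

lemma C_k_on_prod:
  fixes F :: "'i \<Rightarrow> 'a::euclidean_space \<Rightarrow> real"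
  assumes "open S" "\<And>i. i \<in> I \<Longrightarrow> C_k_on k S (F i)"
  shows "C_k_on k S (\<lambda>x. \<Prod>i\<in>I. F i x)"
  using assms(2)
  by (induction I rule: infinite_finite_induct)
    (auto intro!: C_k_on_bilinear[OF _ bounded_bilinear_mult] assms(1) C_k_on_const)

text \<open>The derivative of the reciprocal is built from the reciprocal and the derivative of
  \<open>F\<close>, so the induction hypothesis at the lower order closes the step.\<close>

lemma C_k_on_inverse:
  fixes F :: "'a::euclidean_space \<Rightarrow> real"
  assumes "open S" "\<And>x. x \<in> S \<Longrightarrow> F x \<noteq> 0" "C_k_on k S F"
  shows "C_k_on k S (\<lambda>x. inverse (F x))"
  using assms(3)
proof (induction k)
  case 0
  then show ?case
    using assms(2) by (auto intro!: continuous_on_inverse)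
next
  case (Suc k)
  have F: "C_k_on k S (\<lambda>x. inverse (F x))"
    using Suc C_k_on_SucD by blast
  have "C_k_on k S (\<lambda>x. - (inverse (F x) * d x * inverse (F x)))" if "C_k_on k S d" for d
    by (intro C_k_on_linear[where l = uminus] C_k_on_bilinear[OF _ bounded_bilinear_mult] assms(1) F
        that bounded_linear_minus bounded_linear_ident)
  note d = this
  show ?case
  proof (rule C_k_on_SucI[OF assms(1)])
    show "((\<lambda>x. inverse (F x)) has_derivative
        (\<lambda>b. - (inverse (F x) * frechet_derivative F (at x) b * inverse (F x)))) (at x)"
      if "x \<in> S" for x
      by (rule Deriv.has_derivative_inverse[where f = F, OF assms(2)[OF that]])
        (use Suc.prems that in \<open>simp add: frechet_derivative_works\<close>)
  qed (use Suc.prems d in \<open>auto elim: C_k_on_SucE\<close>)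
qed

lemma C_k_on_compose:
  fixes F :: "'a::euclidean_space \<Rightarrow> 'b::euclidean_space" and G :: "'b \<Rightarrow> 'c::real_normed_vector"
  assumes "open S" "open T" "F ` S \<subseteq> T" "C_k_on k S F" "C_k_on k T G"
  shows "C_k_on k S (\<lambda>x. G (F x))"
  using assms(4,5)
proof (induction k arbitrary: G)
  case 0
  then show ?case
    using assms(3) by (auto intro: continuous_on_compose2)
next
  case (Suc k)
  have F: "C_k_on k S F"
    using Suc.prems C_k_on_SucD by blast
  let ?F = "\<lambda>x. frechet_derivative F (at x)" and ?G = "\<lambda>x. frechet_derivative G (at x)"
  have dF: "(F has_derivative ?F x) (at x)" and dG: "(G has_derivative ?G (F x)) (at (F x))"
    if "x \<in> S" for x
    using Suc.prems that assms(3) by (simp_all add: frechet_derivative_works image_subset_iff)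
  have "C_k_on k S (\<lambda>x. ?G (F x) (?F x b))" if "b \<in> Basis" for b
  proof (rule C_k_on_cong[OF assms(1)])
    \<comment> \<open>\<open>C_k_on\<close> controls derivatives along basis vectors only. The chain
      rule is therefore written as a sum over \<open>Basis\<close>, with the components of the inner
      derivative as coefficients.\<close>
    show "C_k_on k S (\<lambda>x. \<Sum>j\<in>Basis. (?F x b \<bullet> j) *\<^sub>R ?G (F x) j)"
      using Suc.prems that
      by (elim C_k_on_SucE) (intro C_k_on_sum C_k_on_bilinear[OF _ bounded_bilinear_scaleR]
          C_k_on_linear[where l = "\<lambda>v. v \<bullet> _"] assms(1) bounded_linear_inner_left Suc.IH F, auto)
    show "(\<Sum>j\<in>Basis. (?F x b \<bullet> j) *\<^sub>R ?G (F x) j) = ?G (F x) (?F x b)" if "x \<in> S" for x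
    proof -
      have lin: "linear (?G (F x))"
        using dG[OF that] has_derivative_linear by blast
      have "?G (F x) (?F x b) = ?G (F x) (\<Sum>j\<in>Basis. (?F x b \<bullet> j) *\<^sub>R j)"
        by (simp add: euclidean_representation)
      then show ?thesis
        by (simp add: linear_sum[OF lin] linear_scale[OF lin])
    qed
  qed
  then show ?case
    by (intro C_k_on_SucI[where F' = "\<lambda>x b. ?G (F x) (?F x b)"])
      (auto intro: assms(1) has_derivative_compose[OF dF dG])
qed

lemma C_k_on_subset:
  assumes "C_k_on k T F" "S \<subseteq> T"
  shows "C_k_on k S F"
  using assms(1) by (induction k arbitrary: F) (use assms(2) in \<open>auto intro: continuous_on_subset\<close>)

section \<open>Closure properties of smooth functions\<close>

lemma smooth_on_cong:
  "open S \<Longrightarrow> (\<And>x. x \<in> S \<Longrightarrow> F x = G x) \<Longrightarrow> smooth_on S F \<Longrightarrow> smooth_on S G"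
  unfolding smooth_on_def using C_k_on_cong by blast

lemma smooth_on_const: "open S \<Longrightarrow> smooth_on S (\<lambda>x. c)"
  by (simp add: smooth_on_def C_k_on_const)

lemma smooth_on_linear:
  "open S \<Longrightarrow> bounded_linear l \<Longrightarrow> smooth_on S F \<Longrightarrow> smooth_on S (\<lambda>x. l (F x))"
  by (simp add: smooth_on_def C_k_on_linear)

lemma smooth_on_add:
  "open S \<Longrightarrow> smooth_on S F \<Longrightarrow> smooth_on S G \<Longrightarrow> smooth_on S (\<lambda>x. F x + G x)"
  by (simp add: smooth_on_def C_k_on_add)

lemma smooth_on_minus:
  "open S \<Longrightarrow> smooth_on S F \<Longrightarrow> smooth_on S (\<lambda>x. - F x)"
  by (rule smooth_on_linear) (simp_all add: bounded_linear_minus)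

lemma smooth_on_diff:
  "open S \<Longrightarrow> smooth_on S F \<Longrightarrow> smooth_on S G \<Longrightarrow> smooth_on S (\<lambda>x. F x - G x)"
  using smooth_on_add[of S F "\<lambda>x. - G x"] by (simp add: smooth_on_minus)

lemma smooth_on_mult:
  fixes F G :: "'a::euclidean_space \<Rightarrow> real"
  shows "open S \<Longrightarrow> smooth_on S F \<Longrightarrow> smooth_on S G \<Longrightarrow> smooth_on S (\<lambda>x. F x * G x)"
  by (simp add: smooth_on_def C_k_on_bilinear[OF _ bounded_bilinear_mult])

lemma smooth_on_sum:
  "open S \<Longrightarrow> (\<And>i. i \<in> I \<Longrightarrow> smooth_on S (F i)) \<Longrightarrow> smooth_on S (\<lambda>x. \<Sum>i\<in>I. F i x)"
  unfolding smooth_on_def by (intro allI C_k_on_sum) auto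

lemma smooth_on_prod:
  fixes F :: "'i \<Rightarrow> 'a::euclidean_space \<Rightarrow> real"
  shows "open S \<Longrightarrow> (\<And>i. i \<in> I \<Longrightarrow> smooth_on S (F i)) \<Longrightarrow> smooth_on S (\<lambda>x. \<Prod>i\<in>I. F i x)"
  unfolding smooth_on_def by (intro allI C_k_on_prod) auto

lemma smooth_on_divide:
  fixes F G :: "'a::euclidean_space \<Rightarrow> real"
  assumes "open S" "\<And>x. x \<in> S \<Longrightarrow> G x \<noteq> 0" "smooth_on S F" "smooth_on S G"
  shows "smooth_on S (\<lambda>x. F x / G x)"
  using assms unfolding divide_inverse
  by (intro smooth_on_mult) (auto simp: smooth_on_def C_k_on_inverse)

lemma smooth_on_compose:
  fixes F :: "'a::euclidean_space \<Rightarrow> 'b::euclidean_space" and G :: "'b \<Rightarrow> 'c::real_normed_vector"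
  assumes "open S" "open T" "F ` S \<subseteq> T" "smooth_on S F" "smooth_on T G"
  shows "smooth_on S (\<lambda>x. G (F x))"
  using assms C_k_on_compose[OF assms(1-3)] unfolding smooth_on_def by blast

lemma smooth_on_subset: "smooth_on T F \<Longrightarrow> S \<subseteq> T \<Longrightarrow> smooth_on S F"
  unfolding smooth_on_def using C_k_on_subset by blast

lemma smooth_on_differentiable:
  "smooth_on S F \<Longrightarrow> x \<in> S \<Longrightarrow> F differentiable (at x)"
  unfolding smooth_on_def by (metis C_k_on.simps(2))

section \<open>Smoothness of matrices, determinants and inverses\<close>

lemma smooth_on_matrix_iff:
  fixes F :: "'a::euclidean_space \<Rightarrow> real^'n^'m"
  assumes "open S"
  shows "smooth_on S F \<longleftrightarrow> (\<forall>i j. smooth_on S (\<lambda>x. F x $ i $ j))"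
proof
  assume F: "smooth_on S F"
  have lin: "bounded_linear (\<lambda>M::real^'n^'m. M $ i $ j)" for i j
    by (rule bounded_linear_compose[OF bounded_linear_vec_nth bounded_linear_vec_nth])
  show "\<forall>i j. smooth_on S (\<lambda>x. F x $ i $ j)"
    by (intro allI smooth_on_linear[OF assms lin F])
next
  assume F: "\<forall>i j. smooth_on S (\<lambda>x. F x $ i $ j)"
  have "smooth_on S (\<lambda>x. (F x \<bullet> b) *\<^sub>R b)" if basis: "b \<in> Basis" for b
  proof -
    obtain i v where "v \<in> (Basis :: (real^'n) set)" and b: "b = axis i v"
      using basis unfolding Basis_vec_def[where 'a = "real^'n" and 'b = 'm] by blast
    then obtain j where "b = axis i (axis j 1)"
      unfolding Basis_vec_def[where 'a = real and 'b = 'n] by auto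
    then have "F x \<bullet> b = F x $ i $ j" for x
      by (simp add: inner_axis)
    with F have "smooth_on S (\<lambda>x. F x \<bullet> b)"
      by presburger
    then show ?thesis
      by (rule smooth_on_linear[OF assms bounded_linear_scaleR_left])
  qed
  then have "smooth_on S (\<lambda>x. \<Sum>b\<in>Basis. (F x \<bullet> b) *\<^sub>R b)"
    by (rule smooth_on_sum[OF assms])
  then show "smooth_on S F"
    by (simp add: euclidean_representation)
qed

lemma smooth_on_det:
  fixes F :: "'a::euclidean_space \<Rightarrow> real^'n^'n"
  assumes "open S" "\<And>i j. smooth_on S (\<lambda>x. F x $ i $ j)"
  shows "smooth_on S (\<lambda>x. det (F x))"
  unfolding det_def
  by (intro smooth_on_sum smooth_on_mult smooth_on_prod smooth_on_const assms)

lemma matrix_inv_cancel: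
  fixes M :: "real^'n^'n"
  assumes "det M \<noteq> 0"
  shows "M ** matrix_inv M = mat 1" "matrix_inv M ** M = mat 1"
  unfolding matrix_inv_def
  using someI_ex[OF iffD2[OF invertible_det_nz[of M, unfolded invertible_def] assms]] by blast+

text \<open>Column \<open>l\<close> of the inverse solves \<open>M *v x = axis l 1\<close>, and
  Cramer's rule gives this solution. Entries of the inverse are thus quotients of polynomials in the
  entries of \<open>M\<close>, hence smooth.\<close>

lemma matrix_inv_cramer:
  fixes M :: "real^'n^'n"
  assumes "det M \<noteq> 0"
  shows "matrix_inv M $ k $ l
    = det (\<chi> i j. if j = k then axis l 1 $ i else M$i$j) / det M"
proof -
  have "M *v (matrix_inv M *v axis l 1) = axis l 1"
    by (simp add: matrix_vector_mul_assoc matrix_inv_cancel[OF assms])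
  then have "matrix_inv M *v axis l 1
      = (\<chi> k. det (\<chi> i j. if j = k then axis l 1 $ i else M$i$j) / det M)"
    using cramer[OF assms] by blast
  then show ?thesis
    by (metis (no_types, lifting) column_def matrix_vector_mul_component matrix_vector_mult_basis
        vec_lambda_beta)
qed

lemma smooth_on_matrix_inv:
  fixes F :: "'a::euclidean_space \<Rightarrow> real^'n^'n"
  assumes "open S" "\<And>i j. smooth_on S (\<lambda>x. F x $ i $ j)" "\<And>x. x \<in> S \<Longrightarrow> det (F x) \<noteq> 0"
  shows "smooth_on S (\<lambda>x. matrix_inv (F x) $ k $ l)"
proof (rule smooth_on_cong[OF assms(1)])
  show "smooth_on S (\<lambda>x. det (\<chi> i j. if j = k then axis l 1 $ i else F x $ i $ j) / det (F x))"
  proof (intro smooth_on_divide smooth_on_det assms)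
    show "smooth_on S (\<lambda>x. (\<chi> i j. if j = k then axis l 1 $ i else F x $ i $ j) $ i $ j)" for i j
      by (cases "j = k") (simp_all add: assms smooth_on_const)
  qed
qed (use assms(3) in \<open>simp add: matrix_inv_cramer\<close>)

section \<open>Bilinear forms on 2-tensors\<close>

definition outer :: "real^'n \<Rightarrow> real^'n \<Rightarrow> real^'n^'n" where
  "outer x y = (\<chi> i j. x$i * y$j)"

definition gram_matrix :: "(real^'n \<Rightarrow> real^'n \<Rightarrow> real) \<Rightarrow> real^'n^'n" where
  "gram_matrix h = (\<chi> i j. h (axis i 1) (axis j 1))"

text \<open>The 2-tensor dual to \<open>form4_bivec \<Phi> A\<close> with respect to \<open>tensor_inner h\<close>.\<close>

definition form4_sharp ::
    "(real^'n \<Rightarrow> real^'n \<Rightarrow> real) \<Rightarrow> (real^'n \<Rightarrow> real^'n \<Rightarrow> real^'n \<Rightarrow> real^'n \<Rightarrow> real) \<Rightarrow>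
     real^'n^'n \<Rightarrow> real^'n^'n" where
  "form4_sharp h \<Phi> A = matrix_inv (gram_matrix h)
     ** (\<chi> k l. form4_bivec \<Phi> A (outer (axis k 1) (axis l 1))) ** matrix_inv (gram_matrix h)"

text \<open>The tensors \<open>outer (axis i 1) (axis j 1)\<close> are the matrix units, so linear
  maps on tensors need to be compared on decomposable tensors only.\<close>

lemma linear_eq_outer:
  fixes F G :: "real^'n^'n \<Rightarrow> 'b::real_vector"
  assumes "linear F" "linear G" "\<And>i j. F (outer (axis i 1) (axis j 1)) = G (outer (axis i 1) (axis j 1))"
  shows "F = G"
proof (rule linear_eq_stdbasis[OF assms(1,2)])
  fix b :: "real^'n^'n"
  assume basis: "b \<in> Basis"
  then obtain i v where "v \<in> (Basis :: (real^'n) set)" and b: "b = axis i v"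
    unfolding Basis_vec_def[where 'a = "real^'n" and 'b = 'n] by blast
  then obtain j where "b = axis i (axis j 1)"
    unfolding Basis_vec_def[where 'a = real and 'b = 'n] by auto
  also have "\<dots> = outer (axis i 1) (axis j 1)"
    by (simp add: vec_eq_iff outer_def axis_def)
  finally show "F b = G b"
    using assms(3) by simp
qed

lemma linear_tensor_inner:
  "linear (tensor_inner h A)" "linear (\<lambda>A. tensor_inner h A B)"
  by (rule linearI; simp add: tensor_inner_def algebra_simps sum.distrib sum_distrib_left)+

lemma linear_bivec_inner:
  "linear (bivec_inner h A)" "linear (\<lambda>A. bivec_inner h A B)"
  using linear_tensor_inner[of h]
  by (simp_all add: bivec_inner_def linear_iff add_divide_distrib)

lemma linear_form4_bivec:
  "linear (form4_bivec \<Phi> A)" "linear (\<lambda>A. form4_bivec \<Phi> A B)"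
  by (rule linearI; simp add: form4_bivec_def algebra_simps sum.distrib sum_distrib_left)+

lemma linear_expand_axis:
  fixes F :: "real^'n \<Rightarrow> 'b::real_vector"
  assumes "linear F"
  shows "F x = (\<Sum>i\<in>UNIV. x$i *\<^sub>R F (axis i 1))"
proof -
  have "F x = F (\<Sum>i\<in>UNIV. x$i *\<^sub>R axis i 1)"
    using basis_expansion[of x] by (simp add: scalar_mult_eq_scaleR)
  then show ?thesis
    by (simp add: linear_sum[OF assms] linear_scale[OF assms])
qed

lemma tensor_inner_outer:
  assumes "bilinear h"
  shows "tensor_inner h (outer x y) (outer u v) = h x u * h y v"
proof -
  have h: "h x u = (\<Sum>i\<in>UNIV. \<Sum>k\<in>UNIV. x$i * (u$k * h (axis i 1) (axis k 1)))" for x u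
    using assms unfolding bilinear_def
    by (subst linear_expand_axis[of "\<lambda>x. h x u"], simp, subst linear_expand_axis[of "h _"])
      (simp_all add: sum_distrib_left)
  show ?thesis
    unfolding h[of x u] h[of y v] tensor_inner_def outer_def
    by (simp add: sum_product mult_ac)
qed

lemma form4_bivec_outer:
  assumes "alternating4 \<Phi>"
  shows "form4_bivec \<Phi> (outer x y) (outer u v) = \<Phi> x y u v / 4"
proof -
  have lin: "linear (\<lambda>x. \<Phi> x a b c)" "linear (\<lambda>x. \<Phi> a x b c)"
    "linear (\<lambda>x. \<Phi> a b x c)" "linear (\<lambda>x. \<Phi> a b c x)" for a b c
    using assms by (auto simp: alternating4_def)
  have "\<Phi> x y u v = (\<Sum>i\<in>UNIV. \<Sum>j\<in>UNIV. \<Sum>k\<in>UNIV. \<Sum>l\<in>UNIV.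
      x$i * y$j * (u$k * v$l) * \<Phi> (axis i 1) (axis j 1) (axis k 1) (axis l 1))"
    by (subst linear_expand_axis[OF lin(1)], subst linear_expand_axis[OF lin(2)],
        subst linear_expand_axis[OF lin(3)], subst linear_expand_axis[OF lin(4)])
      (simp add: sum_distrib_left mult.assoc)
  then show ?thesis
    by (simp add: form4_bivec_def outer_def)
qed

lemma wedge_eq_outer: "wedge x y = outer x y - outer y x"
  by (simp add: vec_eq_iff wedge_def outer_def)

lemma linear_congruence:
  fixes T :: "real^'n^'n"
  shows "linear (\<lambda>A. T ** A ** transpose T)"
  by (rule linearI) (simp_all add: vec_eq_iff matrix_matrix_mult_def algebra_simps sum.distrib
      sum_distrib_left sum_distrib_right)

text \<open>Identifies the congruence by \<open>T\<close> as the action of \<open>T\<close> on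
  contravariant 2-tensors.\<close>

lemma congruence_outer:
  fixes T :: "real^'n^'n"
  shows "T ** outer x y ** transpose T = outer (T *v x) (T *v y)"
  by (simp add: vec_eq_iff outer_def matrix_matrix_mult_def matrix_vector_mult_def transpose_def
      sum_product sum_distrib_left sum_distrib_right mult_ac)

lemma tensor_inner_congruence:
  fixes T :: "real^'n^'n"
  assumes "bilinear h" "bilinear h'" "\<And>u v. h' (T *v u) (T *v v) = h u v"
  shows "tensor_inner h' (T ** A ** transpose T) (T ** B ** transpose T) = tensor_inner h A B"
proof -
  have "(\<lambda>B. tensor_inner h' (outer (T *v x) (T *v y)) (T ** B ** transpose T))
      = tensor_inner h (outer x y)" for x y
    by (rule linear_eq_outer)
      (simp_all add: linear_tensor_inner congruence_outer tensor_inner_outer assms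
        linear_compose[OF linear_congruence[of T] linear_tensor_inner(1), unfolded o_def])
  then have "(\<lambda>A. tensor_inner h' (T ** A ** transpose T) (T ** B ** transpose T))
      = (\<lambda>A. tensor_inner h A B)"
    by (intro linear_eq_outer)
      (simp_all add: linear_tensor_inner congruence_outer fun_eq_iff
        linear_compose[OF linear_congruence[of T] linear_tensor_inner(2), unfolded o_def])
  then show ?thesis
    by (rule fun_cong)
qed

lemma form4_bivec_congruence:
  fixes T :: "real^'n^'n"
  assumes "alternating4 \<Phi>" "alternating4 \<Phi>'"
    and "\<And>a b c d. \<Phi>' (T *v a) (T *v b) (T *v c) (T *v d) = \<Phi> a b c d"
  shows "form4_bivec \<Phi>' (T ** A ** transpose T) (T ** B ** transpose T) = form4_bivec \<Phi> A B"
proof -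
  have "(\<lambda>B. form4_bivec \<Phi>' (outer (T *v x) (T *v y)) (T ** B ** transpose T))
      = form4_bivec \<Phi> (outer x y)" for x y
    by (rule linear_eq_outer)
      (simp_all add: linear_form4_bivec congruence_outer form4_bivec_outer assms
        linear_compose[OF linear_congruence[of T] linear_form4_bivec(1), unfolded o_def])
  then have "(\<lambda>A. form4_bivec \<Phi>' (T ** A ** transpose T) (T ** B ** transpose T))
      = (\<lambda>A. form4_bivec \<Phi> A B)"
    by (intro linear_eq_outer)
      (simp_all add: linear_form4_bivec congruence_outer fun_eq_iff
        linear_compose[OF linear_congruence[of T] linear_form4_bivec(2), unfolded o_def])
  then show ?thesis
    by (rule fun_cong)
qed

lemma gram_matrix_mult:
  assumes "bilinear h"
  shows "x \<bullet> (gram_matrix h *v y) = h x y"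
  using assms unfolding bilinear_def
  by (subst linear_expand_axis[of "\<lambda>x. h x y"], simp, subst linear_expand_axis[of "h _"])
    (simp_all add: gram_matrix_def inner_vec_def matrix_vector_mult_def mult_ac)

text \<open>A kernel vector \<open>x\<close> would satisfy
  \<open>h x x = x \<bullet> (gram_matrix h *v x) = 0\<close>, against positivity.\<close>

lemma det_gram_matrix:
  assumes "inner_product_form h"
  shows "det (gram_matrix h) \<noteq> 0"
proof -
  have bil: "bilinear h" and pos: "h u u > 0" if "u \<noteq> 0" for u
    using assms that by (auto simp: inner_product_form_def)
  have "x = 0" if "gram_matrix h *v x = 0" for x
  proof (rule ccontr)
    assume "x \<noteq> 0"
    then show False
      using pos[of x] gram_matrix_mult[OF bil, of x x x] that by auto
  qed
  then show ?thesis
    using matrix_left_invertible_ker invertible_left_inverse invertible_det_nz by blast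
qed

text \<open>Pairing with the matrix units lowers both indices of \<open>A\<close> by the Gram
  matrix. As this matrix is invertible, the pairings determine \<open>A\<close>.\<close>

lemma tensor_inner_axes:
  assumes "\<And>u v. h u v = h v u"
  shows "tensor_inner h A (outer (axis k 1) (axis l 1)) = (gram_matrix h ** A ** gram_matrix h) $ k $ l"
proof -
  have "tensor_inner h A (outer (axis k 1) (axis l 1))
      = (\<Sum>i\<in>UNIV. \<Sum>j\<in>UNIV. A$i$j * h (axis i 1) (axis k 1) * h (axis j 1) (axis l 1))"
  proof -
    have "(\<Sum>m\<in>UNIV. A$i$j * outer (axis k 1) (axis l 1) $ n $ m * h (axis i 1) (axis n 1)
          * h (axis j 1) (axis m 1))
        = (if n = k then A$i$j * h (axis i 1) (axis k 1) * h (axis j 1) (axis l 1) else 0)" for i j n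
    proof (cases "n = k")
      case True
      then have "A$i$j * outer (axis k 1) (axis l 1) $ n $ m * h (axis i 1) (axis n 1)
            * h (axis j 1) (axis m 1)
          = (if m = l then A$i$j * h (axis i 1) (axis k 1) * h (axis j 1) (axis l 1) else 0)" for m
        by (simp add: outer_def axis_def)
      then show ?thesis
        using True by simp
    qed (simp add: outer_def axis_def)
    then show ?thesis
      by (simp add: tensor_inner_def)
  qed
  also have "\<dots> = (\<Sum>j\<in>UNIV. \<Sum>i\<in>UNIV. h (axis k 1) (axis i 1) * A$i$j * h (axis j 1) (axis l 1))"
    by (subst sum.swap) (simp add: assms[of _ "axis k 1"] mult_ac)
  finally show ?thesis
    by (simp add: matrix_matrix_mult_def gram_matrix_def sum_distrib_right)
qed

lemma tensor_inner_eqD: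
  assumes "inner_product_form h" "\<And>B. tensor_inner h X B = tensor_inner h Y B"
  shows "X = Y"
proof -
  let ?H = "gram_matrix h"
  have "?H ** X ** ?H = ?H ** Y ** ?H"
    using assms by (simp add: vec_eq_iff inner_product_form_def flip: tensor_inner_axes)
  then have "matrix_inv ?H ** (?H ** X ** ?H) ** matrix_inv ?H
      = matrix_inv ?H ** (?H ** Y ** ?H) ** matrix_inv ?H"
    by simp
  then have "(matrix_inv ?H ** ?H) ** X ** (?H ** matrix_inv ?H)
      = (matrix_inv ?H ** ?H) ** Y ** (?H ** matrix_inv ?H)"
    by (simp only: matrix_mul_assoc)
  then show ?thesis
    by (simp add: matrix_inv_cancel det_gram_matrix[OF assms(1)])
qed

lemma tensor_inner_sharp:
  assumes "inner_product_form h"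
  shows "tensor_inner h (form4_sharp h \<Phi> A) B = form4_bivec \<Phi> A B"
proof -
  let ?H = "gram_matrix h" and ?Q = "\<chi> k l. form4_bivec \<Phi> A (outer (axis k 1) (axis l 1))"
  have "?H ** form4_sharp h \<Phi> A ** ?H = (?H ** matrix_inv ?H) ** ?Q ** (matrix_inv ?H ** ?H)"
    by (simp only: form4_sharp_def matrix_mul_assoc)
  then have "?H ** form4_sharp h \<Phi> A ** ?H = ?Q"
    by (simp add: matrix_inv_cancel det_gram_matrix[OF assms(1)])
  then have "tensor_inner h (form4_sharp h \<Phi> A) = form4_bivec \<Phi> A"
    using assms
    by (intro linear_eq_outer linear_tensor_inner linear_form4_bivec)
      (simp add: tensor_inner_axes inner_product_form_def)
  then show ?thesis
    by simp
qed

lemma form4_sharp_eqI: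
  assumes "inner_product_form h" "\<And>B. tensor_inner h X B = form4_bivec \<Phi> A B"
  shows "form4_sharp h \<Phi> A = X"
  by (rule tensor_inner_eqD[OF assms(1)]) (simp add: tensor_inner_sharp assms)

text \<open>Naturality of the dual tensor under an isometry \<open>T\<close> that carries \<Phi> to
  \<Phi>'. The pairing has to be tested against every \<open>B\<close>; the right inverse
  \<open>R\<close> writes each \<open>B\<close> as the image of a tensor under \<open>T\<close>, so
  the two invariance lemmas apply.\<close>

lemma form4_sharp_congruence:
  fixes T :: "real^'n^'n"
  assumes "inner_product_form h" "inner_product_form h'" "alternating4 \<Phi>" "alternating4 \<Phi>'"
    and "T ** R = mat 1"
    and h: "\<And>u v. h' (T *v u) (T *v v) = h u v"
    and \<Phi>: "\<And>a b c d. \<Phi>' (T *v a) (T *v b) (T *v c) (T *v d) = \<Phi> a b c d"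
  shows "form4_sharp h' \<Phi>' (T ** A ** transpose T) = T ** form4_sharp h \<Phi> A ** transpose T"
proof (rule form4_sharp_eqI[OF assms(2)])
  fix B
  have bil: "bilinear h" "bilinear h'"
    using assms(1,2) by (auto simp: inner_product_form_def)
  have R: "transpose R ** transpose T = mat 1"
    by (simp add: assms(5) transpose_mat flip: matrix_transpose_mul)
  then have B: "T ** (R ** B ** transpose R) ** transpose T = B"
    unfolding matrix_mul_assoc assms(5) unfolding matrix_mul_assoc[symmetric] by (simp add: R)
  show "tensor_inner h' (T ** form4_sharp h \<Phi> A ** transpose T) B
      = form4_bivec \<Phi>' (T ** A ** transpose T) B"
    using tensor_inner_congruence[OF bil, of T "form4_sharp h \<Phi> A" "R ** B ** transpose R"]
      form4_bivec_congruence[OF assms(3,4), of T A "R ** B ** transpose R"]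
    unfolding B by (simp add: tensor_inner_sharp assms(1) h \<Phi>)
qed

lemma smooth_on_form4_sharp:
  fixes h :: "'a::euclidean_space \<Rightarrow> real^'n \<Rightarrow> real^'n \<Rightarrow> real"
  assumes S: "open S" and h: "\<And>x. x \<in> S \<Longrightarrow> inner_product_form (h x)"
    and "\<And>u v. smooth_on S (\<lambda>x. h x u v)"
    and "\<And>a b c d. smooth_on S (\<lambda>x. \<Phi> x a b c d)"
    and M: "smooth_on S M"
  shows "smooth_on S (\<lambda>x. form4_sharp (h x) (\<Phi> x) (M x))"
proof -
  have M: "smooth_on S (\<lambda>x. M x $ i $ j)" for i j
    using M unfolding smooth_on_matrix_iff[OF S] by blast
  have G: "smooth_on S (\<lambda>x. matrix_inv (gram_matrix (h x)) $ i $ j)" for i j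
    by (rule smooth_on_matrix_inv[OF S]) (use assms(3) in \<open>simp_all add: gram_matrix_def[abs_def]
        det_gram_matrix[OF h, unfolded gram_matrix_def]\<close>)
  show ?thesis
    unfolding smooth_on_matrix_iff[OF S] form4_sharp_def matrix_matrix_mult_def form4_bivec_def
    by (simp only: vec_lambda_beta, intro allI smooth_on_sum smooth_on_mult smooth_on_const S G M assms(4))
qed

section \<open>Alternating forms, orientations and the Hodge star\<close>

lemma alternating4D:
  assumes "alternating4 \<Phi>"
  shows "linear (\<lambda>x. \<Phi> x a b c)" "linear (\<lambda>x. \<Phi> a x b c)"
    "linear (\<lambda>x. \<Phi> a b x c)" "linear (\<lambda>x. \<Phi> a b c x)"
    "\<Phi> a a b c = 0" "\<Phi> b a a c = 0" "\<Phi> b c a a = 0"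
  using assms by (auto simp: alternating4_def)

lemma alternating4_swap:
  assumes "alternating4 \<Phi>"
  shows "\<Phi> b a c d = - \<Phi> a b c d" "\<Phi> a c b d = - \<Phi> a b c d" "\<Phi> a b d c = - \<Phi> a b c d"
proof -
  note A = alternating4D[OF assms]
  have "\<Phi> (a + b) (a + b) c d = 0" "\<Phi> a (b + c) (b + c) d = 0" "\<Phi> a b (c + d) (c + d) = 0"
    by (rule A)+
  then have "\<Phi> b a c d + \<Phi> a b c d = 0" "\<Phi> a c b d + \<Phi> a b c d = 0"
    "\<Phi> a b d c + \<Phi> a b c d = 0"
    unfolding linear_add[OF A(1)] linear_add[OF A(2)] linear_add[OF A(3)] linear_add[OF A(4)]
    by (simp_all only: A(5-7) add_0_left add_0_right add.commute)
  then show "\<Phi> b a c d = - \<Phi> a b c d" "\<Phi> a c b d = - \<Phi> a b c d" "\<Phi> a b d c = - \<Phi> a b c d"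
    unfolding eq_neg_iff_add_eq_0 by -
qed

lemma alternating4_zero:
  assumes "alternating4 \<Phi>"
  shows "\<Phi> a b a c = 0" "\<Phi> b a c a = 0" "\<Phi> a b c a = 0"
proof -
  note A = alternating4D(5-7)[OF assms] and swap = alternating4_swap[OF assms]
  show ab: "\<Phi> a b a c = 0" for a b c
    using swap(1)[of a b a c] A(2)[of b a c] by simp
  show "\<Phi> b a c a = 0"
    using swap(2)[of b a c a] A(3)[of b c a] by simp
  show "\<Phi> a b c a = 0"
    using swap(3)[of a b c a] ab[of a b c] by simp
qed

lemma alternating4_perm:
  assumes "alternating4 \<Phi>"
  shows "\<Phi> a d b c = \<Phi> a b c d" "\<Phi> a c d b = \<Phi> a b c d" "\<Phi> c d a b = \<Phi> a b c d"
    "\<Phi> d b a c = \<Phi> a b c d" "\<Phi> b c a d = \<Phi> a b c d"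
  using alternating4_swap[OF assms] by (metis minus_minus)+

text \<open>Linearity, used one slot at a time, reduces the claim to arguments among the
  \<open>e\<close>'s. There either an argument is repeated or the arguments are a permutation of
  \<open>e1, e2, e3, e4\<close>.\<close>

lemma alternating4_span_eq_0:
  assumes "alternating4 \<Phi>" and zero: "\<Phi> e1 e2 e3 e4 = 0"
    and "{x1, x2, x3, x4} \<subseteq> span {e1, e2, e3, e4}"
  shows "\<Phi> x1 x2 x3 x4 = 0"
proof -
  let ?S = "{e1, e2, e3, e4}"
  note swap = alternating4_swap[OF assms(1)]
  have cyc: "\<Phi> a b d c = 0 \<and> \<Phi> a c b d = 0 \<and> \<Phi> a c d b = 0 \<and> \<Phi> a d b c = 0 \<and> \<Phi> a d c b = 0"
    if "\<Phi> a b c d = 0" for a b c d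
    using that by (simp add: swap(3)[of a b d c] swap(2)[of a c b d] swap(3)[of a c d b]
        swap(2)[of a d b c] swap(3)[of a d c b])
  have first: "\<Phi> b a c d = 0 \<and> \<Phi> c a b d = 0 \<and> \<Phi> d a b c = 0" if "\<Phi> a b c d = 0" for a b c d
    using that cyc[OF that] by (simp add: swap(1)[of b a c d] swap(1)[of c a b d] swap(1)[of d a b c])
  note perm = zero cyc[OF zero] first[OF zero] cyc[OF first[OF zero, THEN conjunct1]]
    cyc[OF first[OF zero, THEN conjunct2, THEN conjunct1]]
    cyc[OF first[OF zero, THEN conjunct2, THEN conjunct2]]
  have "\<forall>a\<in>?S. \<forall>b\<in>?S. \<forall>c\<in>?S. \<forall>d\<in>?S. \<Phi> a b c d = 0"
    by (simp add: perm alternating4D(5-7)[OF assms(1)] alternating4_zero[OF assms(1)])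
  then have base: "\<Phi> a b c d = 0" if "a \<in> ?S" "b \<in> ?S" "c \<in> ?S" "d \<in> ?S" for a b c d
    using that by blast
  have x: "x1 \<in> span ?S" "x2 \<in> span ?S" "x3 \<in> span ?S" "x4 \<in> span ?S"
    using assms(3) by simp_all
  note L = alternating4D(1-4)[OF assms(1)]
  have 1: "\<Phi> x1 b c d = 0" if "b \<in> ?S" "c \<in> ?S" "d \<in> ?S" for b c d
    by (rule linear_eq_0_on_span[OF L(1) base[OF _ that] x(1)])
  have 2: "\<Phi> x1 x2 c d = 0" if "c \<in> ?S" "d \<in> ?S" for c d
    by (rule linear_eq_0_on_span[OF L(2) 1[OF _ that] x(2)])
  have 3: "\<Phi> x1 x2 x3 d = 0" if "d \<in> ?S" for d
    by (rule linear_eq_0_on_span[OF L(3) 2[OF _ that] x(3)])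
  show ?thesis
    by (rule linear_eq_0_on_span[OF L(4) 3 x(4)])
qed

text \<open>The combination of \<Phi> and \<Psi> with crossed values as coefficients vanishes on
  \<open>e1, e2, e3, e4\<close>, hence on their span. All comparisons of orientations and volume
  forms rest on this.\<close>

lemma alternating4_proportional:
  fixes \<Phi> \<Psi> :: "'a::real_vector \<Rightarrow> 'a \<Rightarrow> 'a \<Rightarrow> 'a \<Rightarrow> real"
  assumes "alternating4 \<Phi>" "alternating4 \<Psi>" "{x1, x2, x3, x4} \<subseteq> span {e1, e2, e3, e4}"
  shows "\<Phi> x1 x2 x3 x4 * \<Psi> e1 e2 e3 e4 = \<Psi> x1 x2 x3 x4 * \<Phi> e1 e2 e3 e4"
proof -
  define r s where "r = \<Psi> e1 e2 e3 e4" and "s = \<Phi> e1 e2 e3 e4"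
  have "alternating4 (\<lambda>a b c d. \<Phi> a b c d * r - \<Psi> a b c d * s)"
    using assms(1,2) unfolding alternating4_def linear_iff by (simp add: algebra_simps)
  from alternating4_span_eq_0[OF this _ assms(3)] show ?thesis
    by (simp add: r_def s_def)
qed

lemma alternating4_wedge22:
  fixes \<alpha> \<beta> :: "'a::real_vector \<Rightarrow> 'a \<Rightarrow> real"
  assumes "bilinear \<alpha>" "bilinear \<beta>" "\<And>x. \<alpha> x x = 0" "\<And>x. \<beta> x x = 0"
  shows "alternating4 (wedge22 \<alpha> \<beta>)"
  using assms(1,2) unfolding alternating4_def bilinear_def linear_iff wedge22_def
  by (simp add: assms(3,4) algebra_simps)

lemma orthonormal_4:
  "orthonormal h [x1, x2, x3, x4] \<longleftrightarrow>
     h x1 x1 = 1 \<and> h x1 x2 = 0 \<and> h x1 x3 = 0 \<and> h x1 x4 = 0 \<and>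
     h x2 x1 = 0 \<and> h x2 x2 = 1 \<and> h x2 x3 = 0 \<and> h x2 x4 = 0 \<and>
     h x3 x1 = 0 \<and> h x3 x2 = 0 \<and> h x3 x3 = 1 \<and> h x3 x4 = 0 \<and>
     h x4 x1 = 0 \<and> h x4 x2 = 0 \<and> h x4 x3 = 0 \<and> h x4 x4 = 1"
  by (simp add: orthonormal_def numeral_eq_Suc All_less_Suc2)

text \<open>Pairing with a member of \<open>xs\<close> extracts its coefficient, which gives
  independence; the dimension bound then makes \<open>xs\<close> span \<open>V\<close>. Lists of any
  length are allowed, so that four vectors in a plane and eight in the whole space are treated
  alike.\<close>

lemma orthonormal_expand:
  fixes h :: "'a::euclidean_space \<Rightarrow> 'a \<Rightarrow> real"
  assumes "bilinear h" "orthonormal h xs" "set xs \<subseteq> V" "dim V \<le> length xs" "v \<in> V"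
  shows "v = (\<Sum>i<length xs. h v (xs!i) *\<^sub>R xs!i)" "v \<in> span (set xs)"
proof -
  let ?n = "length xs"
  have h1: "linear (\<lambda>x. h x y)" for y
    using assms(1) by (simp add: bilinear_def)
  have on: "h (xs!i) (xs!j) = (if i = j then 1 else 0)" if "i < ?n" "j < ?n" for i j
    using assms(2) that by (simp add: orthonormal_def)
  have coeff: "h (\<Sum>j<?n. c j *\<^sub>R xs!j) (xs!i) = c i" if "i < ?n" for c i
  proof -
    have "h (\<Sum>j<?n. c j *\<^sub>R xs!j) (xs!i) = (\<Sum>j<?n. if j = i then c j else 0)"
      unfolding linear_sum[OF h1] linear_scale[OF h1] using on that
      by (intro sum.cong) auto
    also have "\<dots> = c i"
      using that by simp
    finally show ?thesis .
  qed
  have dist: "distinct xs"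
    unfolding distinct_conv_nth using on by (metis zero_neq_one)
  have set: "set xs = (!) xs ` {..<?n}" and inj: "inj_on ((!) xs) {..<?n}"
    using dist by (auto simp: set_conv_nth inj_on_nth)
  have "independent (set xs)"
    unfolding independent_explicit
  proof (intro conjI allI impI ballI)
    fix u x
    assume u: "(\<Sum>v\<in>set xs. u v *\<^sub>R v) = 0" and "x \<in> set xs"
    then obtain i where i: "i < ?n" "x = xs!i"
      by (auto simp: in_set_conv_nth)
    have "(\<Sum>j<?n. u (xs!j) *\<^sub>R xs!j) = 0"
      using u unfolding set sum.reindex[OF inj] by (simp add: o_def)
    then have "u (xs!i) = h 0 (xs!i)"
      using coeff[OF i(1), of "\<lambda>j. u (xs!j)"] by simp
    then show "u x = 0"
      using linear_0[OF h1] i(2) by simp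
  qed simp
  then have "V \<subseteq> span (set xs)"
    using assms(3,4) distinct_card[OF dist] by (intro card_ge_dim_independent) auto
  then show v: "v \<in> span (set xs)"
    using assms(5) by blast
  have "linear (\<lambda>v. \<Sum>i<?n. h v (xs!i) *\<^sub>R xs!i)"
    using h1 by (intro linear_compose_sum ballI linearI) (simp_all add: linear_iff scaleR_add_left)
  moreover have "x = (\<Sum>i<?n. h x (xs!i) *\<^sub>R xs!i)" if x: "x \<in> set xs" for x
  proof -
    obtain k where k: "k < ?n" "x = xs!k"
      using x by (auto simp: in_set_conv_nth)
    have "(\<Sum>i<?n. h x (xs!i) *\<^sub>R xs!i) = (\<Sum>i<?n. if i = k then xs!i else 0)"
      unfolding k(2) using on[OF k(1)] by (intro sum.cong) auto
    also have "\<dots> = x"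
      using k by simp
    finally show ?thesis
      by simp
  qed
  ultimately show "v = (\<Sum>i<?n. h v (xs!i) *\<^sub>R xs!i)"
    using linear_eq_on_span[OF linear_ident, of _ "set xs" v] v by blast
qed

lemma orthonormal_expand_4:
  fixes h :: "'a::euclidean_space \<Rightarrow> 'a \<Rightarrow> real"
  assumes "bilinear h" "orthonormal h [x1, x2, x3, x4]" "{x1, x2, x3, x4} \<subseteq> V" "dim V \<le> 4" "v \<in> V"
  shows "v = h v x1 *\<^sub>R x1 + h v x2 *\<^sub>R x2 + h v x3 *\<^sub>R x3 + h v x4 *\<^sub>R x4"
  using orthonormal_expand(1)[OF assms(1,2), of V v] assms(3-5)
  by (simp add: numeral_eq_Suc lessThan_Suc add_ac)

lemma inner_product_formD:
  assumes "inner_product_form h"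
  shows "bilinear h" "h u v = h v u"
  using assms by (auto simp: inner_product_form_def)

text \<open>The orientation is encoded by the sign of a 4-form. Direct bases of the tangent and of
  the normal space are later both brought into this shape with the Cayley form as \<Psi>, so one
  computation of the Hodge star covers both.\<close>

definition oriented_bases ::
    "('a::real_vector \<Rightarrow> 'a \<Rightarrow> real) \<Rightarrow> 'a set \<Rightarrow> ('a \<Rightarrow> 'a \<Rightarrow> 'a \<Rightarrow> 'a \<Rightarrow> real) \<Rightarrow>
     ('a \<times> 'a \<times> 'a \<times> 'a) set" where
  "oriented_bases h V \<Psi> = {(x1, x2, x3, x4). orthonormal h [x1, x2, x3, x4] \<and>
     {x1, x2, x3, x4} \<subseteq> V \<and> \<Psi> x1 x2 x3 x4 > 0}"

definition minor :: "('a \<Rightarrow> 'a \<Rightarrow> real) \<Rightarrow> 'a \<Rightarrow> 'a \<Rightarrow> 'a \<Rightarrow> 'a \<Rightarrow> real" where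
  "minor h a b x y = h x a * h y b - h x b * h y a"

text \<open>The wedge product of the four 1-forms \<open>h _ e1\<close>, ..., \<open>h _ e4\<close>,
  that is, the determinant of the pairings of the arguments with the frame.\<close>

definition frame_volume ::
    "('a \<Rightarrow> 'a \<Rightarrow> real) \<Rightarrow> 'a \<Rightarrow> 'a \<Rightarrow> 'a \<Rightarrow> 'a \<Rightarrow> 'a \<Rightarrow> 'a \<Rightarrow> 'a \<Rightarrow> 'a \<Rightarrow> real" where
  "frame_volume h e1 e2 e3 e4 = wedge22 (minor h e1 e2) (minor h e3 e4)"

lemma alternating4_frame_volume:
  assumes "bilinear h"
  shows "alternating4 (frame_volume h e1 e2 e3 e4)"
  unfolding frame_volume_def
  by (rule alternating4_wedge22)
    (use assms in \<open>simp_all add: bilinear_def linear_iff minor_def algebra_simps\<close>)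

text \<open>A determinant equals the determinant of the transposed matrix.\<close>

lemma frame_volume_commute:
  assumes "\<And>u v. h u v = h v u"
  shows "frame_volume h e1 e2 e3 e4 x1 x2 x3 x4 = frame_volume h x1 x2 x3 x4 e1 e2 e3 e4"
  unfolding frame_volume_def wedge22_def minor_def
  by (simp add: assms[of x1] assms[of x2] assms[of x3] assms[of x4] algebra_simps)

lemma frame_volume_self:
  assumes "orthonormal h [e1, e2, e3, e4]"
  shows "frame_volume h e1 e2 e3 e4 e1 e2 e3 e4 = 1"
  using assms unfolding frame_volume_def wedge22_def minor_def orthonormal_4 by simp


section \<open>The Hodge star in an orthonormal frame\<close>

lemma dim_span_4: "dim (span {e1, e2, e3, e4 :: 'a::euclidean_space}) \<le> 4"
proof -
  have "dim {e1, e2, e3, e4} \<le> card (set [e1, e2, e3, e4])"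
    using dim_le_card'[of "{e1, e2, e3, e4}"] by simp
  also have "\<dots> \<le> 4"
    using card_length[of "[e1, e2, e3, e4]"] by simp
  finally show ?thesis
    by (simp add: dim_span)
qed

lemma wedge_in_bivectors: "x \<in> V \<Longrightarrow> y \<in> V \<Longrightarrow> wedge x y \<in> bivectors V"
  unfolding bivectors_def by (rule span_base) blast

lemma subspace_bivectors: "subspace (bivectors V)"
  unfolding bivectors_def by (rule subspace_span)

lemma linear_eq_on_bivectors:
  assumes "linear F" "linear G" "\<And>x y. x \<in> V \<Longrightarrow> y \<in> V \<Longrightarrow> F (wedge x y) = G (wedge x y)"
    and "A \<in> bivectors V"
  shows "F A = G A"
  by (rule linear_eq_on_span[OF assms(1,2) _ assms(4)[unfolded bivectors_def]])
    (use assms(3) in blast)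

lemma bivec_inner_minor:
  "bilinear h \<Longrightarrow> bivec_inner h (wedge x y) (wedge u v) = minor h u v x y"
  by (simp add: bivec_inner_wedge minor_def)

context
  fixes h :: "real^'n \<Rightarrow> real^'n \<Rightarrow> real" and e1 e2 e3 e4
  assumes h: "inner_product_form h" and e: "orthonormal h [e1, e2, e3, e4]"
begin

text \<open>The Hodge star in coordinates: complementary basis bivectors are exchanged, and the
  minus signs occur because the complement of \<open>wedge e1 e3\<close> is
  \<open>wedge e4 e2\<close>. The formula is linear on all tensors.\<close>

definition frame_star :: "real^'n^'n \<Rightarrow> real^'n^'n" where
  "frame_star A =
     bivec_inner h A (wedge e3 e4) *\<^sub>R wedge e1 e2 + bivec_inner h A (wedge e1 e2) *\<^sub>R wedge e3 e4
     - bivec_inner h A (wedge e2 e4) *\<^sub>R wedge e1 e3 - bivec_inner h A (wedge e1 e3) *\<^sub>R wedge e2 e4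
     + bivec_inner h A (wedge e2 e3) *\<^sub>R wedge e1 e4 + bivec_inner h A (wedge e1 e4) *\<^sub>R wedge e2 e3"

lemma frame_expand:
  assumes "x \<in> span {e1, e2, e3, e4}"
  shows "x = h x e1 *\<^sub>R e1 + h x e2 *\<^sub>R e2 + h x e3 *\<^sub>R e3 + h x e4 *\<^sub>R e4"
  by (rule orthonormal_expand_4[OF inner_product_formD(1)[OF h] e _ dim_span_4 assms]) (auto intro: span_base)

lemma bivectors_expand:
  assumes "A \<in> bivectors (span {e1, e2, e3, e4})"
  shows "A = bivec_inner h A (wedge e1 e2) *\<^sub>R wedge e1 e2 + bivec_inner h A (wedge e1 e3) *\<^sub>R wedge e1 e3
    + bivec_inner h A (wedge e1 e4) *\<^sub>R wedge e1 e4 + bivec_inner h A (wedge e2 e3) *\<^sub>R wedge e2 e3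
    + bivec_inner h A (wedge e2 e4) *\<^sub>R wedge e2 e4 + bivec_inner h A (wedge e3 e4) *\<^sub>R wedge e3 e4"
    (is "A = ?R A")
proof (rule linear_eq_on_bivectors[OF linear_ident _ _ assms])
  show "linear ?R"
    using linear_bivec_inner(2)[of h] by (auto simp: linear_iff algebra_simps)
  fix x y
  assume xy: "x \<in> span {e1, e2, e3, e4}" "y \<in> span {e1, e2, e3, e4}"
  have "wedge x y = wedge (h x e1 *\<^sub>R e1 + h x e2 *\<^sub>R e2 + h x e3 *\<^sub>R e3 + h x e4 *\<^sub>R e4)
      (h y e1 *\<^sub>R e1 + h y e2 *\<^sub>R e2 + h y e3 *\<^sub>R e3 + h y e4 *\<^sub>R e4)"
    using frame_expand[OF xy(1)] frame_expand[OF xy(2)] by simp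
  also have "\<dots> = ?R (wedge x y)"
    unfolding bivec_inner_minor[OF inner_product_formD(1)[OF h]] minor_def
    by (simp add: vec_eq_iff wedge_def algebra_simps)
  finally show "wedge x y = ?R (wedge x y)" .
qed

lemma frame_star_in_bivectors: "frame_star A \<in> bivectors (span {e1, e2, e3, e4})"
  unfolding frame_star_def
  by (intro subspace_add subspace_diff subspace_scale subspace_bivectors wedge_in_bivectors span_base)
    simp_all

lemma linear_frame_star: "linear frame_star"
  using linear_bivec_inner(2)[of h] by (auto simp: linear_iff frame_star_def algebra_simps)

text \<open>Both sides are Laplace expansions of one determinant, on the left along the arguments
  \<open>x\<close>, \<open>y\<close> and on the right along the frame vectors \<open>e1\<close>,
  \<open>e2\<close>.\<close>

lemma bivec_inner_frame_star:
  "bivec_inner h (frame_star (wedge x y)) (wedge u v) = frame_volume h e1 e2 e3 e4 x y u v"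
proof -
  have *: "bivec_inner h (frame_star A) B
    = bivec_inner h A (wedge e3 e4) * bivec_inner h (wedge e1 e2) B
    + bivec_inner h A (wedge e1 e2) * bivec_inner h (wedge e3 e4) B
    - bivec_inner h A (wedge e2 e4) * bivec_inner h (wedge e1 e3) B
    - bivec_inner h A (wedge e1 e3) * bivec_inner h (wedge e2 e4) B
    + bivec_inner h A (wedge e2 e3) * bivec_inner h (wedge e1 e4) B
    + bivec_inner h A (wedge e1 e4) * bivec_inner h (wedge e2 e3) B" for A B
    unfolding frame_star_def
    by (simp add: linear_add[OF linear_bivec_inner(2)] linear_diff[OF linear_bivec_inner(2)]
        linear_scale[OF linear_bivec_inner(2)])
  show ?thesis
    unfolding * bivec_inner_minor[OF inner_product_formD(1)[OF h]] minor_def frame_volume_def wedge22_def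
    by (simp add: inner_product_formD(2)[OF h, of e1] inner_product_formD(2)[OF h, of e2] inner_product_formD(2)[OF h, of e3] inner_product_formD(2)[OF h, of e4] algebra_simps)
qed

text \<open>The volume forms of the two frames differ by a factor \<open>c\<close>. Exchanging the
  frames transposes the matrix, so \<open>c * c = 1\<close>, and positivity leaves
  \<open>c = 1\<close>. In the frame of the \<open>x\<close>'s, the arguments \<open>x3\<close> and
  \<open>x4\<close> leave only the minor of \<open>x1\<close> and \<open>x2\<close>.\<close>

lemma frame_volume_dual_basis:
  assumes "orthonormal h [x1, x2, x3, x4]" "{x1, x2, x3, x4} \<subseteq> span {e1, e2, e3, e4}"
    and "x \<in> span {e1, e2, e3, e4}" "y \<in> span {e1, e2, e3, e4}"
    and "frame_volume h e1 e2 e3 e4 x1 x2 x3 x4 > 0"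
  shows "frame_volume h e1 e2 e3 e4 x y x3 x4 = minor h x1 x2 x y"
proof -
  define c where "c = frame_volume h e1 e2 e3 e4 x1 x2 x3 x4"
  have sub: "u \<in> span {x1, x2, x3, x4}" if "u \<in> span {e1, e2, e3, e4}" for u
    using orthonormal_expand(2)[OF inner_product_formD(1)[OF h] assms(1) _ _ that] assms(2) dim_span_4[of e1 e2 e3 e4] by simp
  have vol: "frame_volume h e1 e2 e3 e4 u1 u2 u3 u4 = c * frame_volume h x1 x2 x3 x4 u1 u2 u3 u4"
    if "{u1, u2, u3, u4} \<subseteq> span {e1, e2, e3, e4}" for u1 u2 u3 u4
    using alternating4_proportional[OF alternating4_frame_volume[OF inner_product_formD(1)[OF h], of e1 e2 e3 e4]
        alternating4_frame_volume[OF inner_product_formD(1)[OF h], of x1 x2 x3 x4], of u1 u2 u3 u4 x1 x2 x3 x4] that sub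
    by (simp add: frame_volume_self[OF assms(1)] c_def mult.commute)
  have "1 = c * c"
    using vol[of e1 e2 e3 e4] frame_volume_commute[of h x1 x2 x3 x4 e1 e2 e3 e4, OF inner_product_formD(2)[OF h]]
    by (simp add: span_base frame_volume_self[OF e] c_def)
  then have "c = 1 \<or> c = -1"
    using square_eq_1_iff[of c] by simp
  then have "c = 1"
    using assms(5) by (auto simp: c_def)
  have "frame_volume h e1 e2 e3 e4 x y x3 x4 = frame_volume h x1 x2 x3 x4 x y x3 x4"
    using vol[of x y x3 x4] assms(2-4) \<open>c = 1\<close> by simp
  also have "\<dots> = minor h x1 x2 x y"
    using assms(1) unfolding frame_volume_def wedge22_def orthonormal_4 by (simp add: minor_def)
  finally show ?thesis .
qed

lemma hodge_star_eq_frame_star: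
  assumes "alternating4 \<Psi>" and V: "V = span {e1, e2, e3, e4}"
    and "(e1, e2, e3, e4) \<in> oriented_bases h V \<Psi>" and A: "A \<in> bivectors V"
  shows "hodge_star h V (oriented_bases h V \<Psi>) A = frame_star A"
  unfolding hodge_star_def
proof (rule the_equality)
  let ?D = "oriented_bases h V \<Psi>"
  have pos: "\<Psi> e1 e2 e3 e4 > 0"
    using assms(3) by (simp add: oriented_bases_def)
  have "bivec_inner h (frame_star A) (wedge x3 x4) = bivec_inner h A (wedge x1 x2)"
    if D: "(x1, x2, x3, x4) \<in> ?D" for x1 x2 x3 x4
  proof (rule linear_eq_on_bivectors[OF _ linear_bivec_inner(2) _ A])
    show "linear (\<lambda>A. bivec_inner h (frame_star A) (wedge x3 x4))"
      using linear_compose[OF linear_frame_star linear_bivec_inner(2)] by (simp add: o_def)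
    fix x y
    assume "x \<in> V" "y \<in> V"
    have x: "orthonormal h [x1, x2, x3, x4]" "{x1, x2, x3, x4} \<subseteq> span {e1, e2, e3, e4}"
      "\<Psi> x1 x2 x3 x4 > 0"
      using D V by (simp_all add: oriented_bases_def)
    have "\<Psi> x1 x2 x3 x4 = frame_volume h e1 e2 e3 e4 x1 x2 x3 x4 * \<Psi> e1 e2 e3 e4"
      using alternating4_proportional[OF assms(1) alternating4_frame_volume[OF inner_product_formD(1)[OF h]] x(2),
          of e1 e2 e3 e4] by (simp add: frame_volume_self[OF e])
    then have "frame_volume h e1 e2 e3 e4 x1 x2 x3 x4 > 0"
      using pos x(3) by (simp add: zero_less_mult_iff)
    then show "bivec_inner h (frame_star (wedge x y)) (wedge x3 x4) = bivec_inner h (wedge x y) (wedge x1 x2)"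
      using frame_volume_dual_basis[OF x(1,2)] \<open>x \<in> V\<close> \<open>y \<in> V\<close> V
      by (simp add: bivec_inner_frame_star bivec_inner_minor[OF inner_product_formD(1)[OF h]])
  qed
  then show "frame_star A \<in> bivectors V \<and> (\<forall>(x1, x2, x3, x4)\<in>?D.
      bivec_inner h (frame_star A) (wedge x3 x4) = bivec_inner h A (wedge x1 x2))"
    using frame_star_in_bivectors V by blast
next
  let ?D = "oriented_bases h V \<Psi>"
  fix B
  assume B: "B \<in> bivectors V \<and> (\<forall>(x1, x2, x3, x4)\<in>?D.
      bivec_inner h B (wedge x3 x4) = bivec_inner h A (wedge x1 x2))"
  \<comment> \<open>Even permutations of the frame are direct bases too. Together with the frame
    itself they prescribe all six coefficients of \<open>B\<close>.\<close>
  have even: "(e3, e4, e1, e2) \<in> ?D" "(e1, e3, e4, e2) \<in> ?D" "(e4, e2, e1, e3) \<in> ?D"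
    "(e1, e4, e2, e3) \<in> ?D" "(e2, e3, e1, e4) \<in> ?D"
    using assms(3) alternating4_perm[OF assms(1)] unfolding oriented_bases_def orthonormal_4
    by simp_all
  have neg: "bivec_inner h C (wedge e4 e2) = - bivec_inner h C (wedge e2 e4)" for C
  proof -
    have "wedge e4 e2 = - wedge e2 e4"
      by (simp add: vec_eq_iff wedge_def)
    then show ?thesis
      using linear_neg[OF linear_bivec_inner(1)] by metis
  qed
  have cond: "bivec_inner h B (wedge x3 x4) = bivec_inner h A (wedge x1 x2)"
    if "(x1, x2, x3, x4) \<in> ?D" for x1 x2 x3 x4
    using B that by blast
  have "bivec_inner h B (wedge e3 e4) = bivec_inner h A (wedge e1 e2)"
    "bivec_inner h B (wedge e1 e2) = bivec_inner h A (wedge e3 e4)"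
    "bivec_inner h B (wedge e2 e4) = - bivec_inner h A (wedge e1 e3)"
    "bivec_inner h B (wedge e1 e3) = - bivec_inner h A (wedge e2 e4)"
    "bivec_inner h B (wedge e2 e3) = bivec_inner h A (wedge e1 e4)"
    "bivec_inner h B (wedge e1 e4) = bivec_inner h A (wedge e2 e3)"
    using cond[OF assms(3)] even[THEN cond] by (simp_all add: neg)
  then show "B = frame_star A"
    using bivectors_expand[of B] B V by (simp add: frame_star_def)
qed

lemma self_dual_bivectors_eq_span:
  assumes "alternating4 \<Psi>" and V: "V = span {e1, e2, e3, e4}"
    and "(e1, e2, e3, e4) \<in> oriented_bases h V \<Psi>"
  shows "self_dual_bivectors h V (oriented_bases h V \<Psi>)
    = span {wedge e1 e2 + wedge e3 e4, wedge e1 e3 - wedge e2 e4, wedge e1 e4 + wedge e2 e3}"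
    (is "_ = span ?S")
proof -
  note star = hodge_star_eq_frame_star[OF assms]
  show ?thesis
  proof (intro subset_antisym subsetI)
    fix A
    assume "A \<in> self_dual_bivectors h V (oriented_bases h V \<Psi>)"
    then have A: "A \<in> bivectors V" "frame_star A = A"
      by (auto simp: self_dual_bivectors_def star)
    let ?a = "\<lambda>x y. bivec_inner h A (wedge x y) / 2"
    \<comment> \<open>Averaging \<open>A\<close> with its star gives complementary pairs equal
      coefficients up to the sign of the pair, so only the three self-dual combinations
      occur.\<close>
    have "A = (1/2) *\<^sub>R (A + frame_star A)"
      by (simp add: A(2) flip: scaleR_2)
    also have "\<dots> = (?a e1 e2 + ?a e3 e4) *\<^sub>R (wedge e1 e2 + wedge e3 e4)
        + (?a e1 e3 - ?a e2 e4) *\<^sub>R (wedge e1 e3 - wedge e2 e4)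
        + (?a e1 e4 + ?a e2 e3) *\<^sub>R (wedge e1 e4 + wedge e2 e3)"
      by (subst bivectors_expand[OF A(1)[unfolded V]], unfold frame_star_def)
        (simp add: algebra_simps add_divide_distrib diff_divide_distrib)
    also have "\<dots> \<in> span ?S"
      by (intro span_add span_scale span_base) auto
    finally show "A \<in> span ?S" .
  next
    fix A
    assume A: "A \<in> span ?S"
    have "s \<in> bivectors V" if "s \<in> ?S" for s
      using that unfolding V
      by (auto intro!: subspace_add subspace_diff subspace_bivectors wedge_in_bivectors span_base)
    then have V: "A \<in> bivectors V"
      using span_minimal[OF _ subspace_bivectors] A by blast
    have "frame_star s = s" if "s \<in> ?S" for s
      using that e unfolding orthonormal_4
      by (auto simp: frame_star_def linear_add[OF linear_bivec_inner(2)]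
          linear_diff[OF linear_bivec_inner(2)] bivec_inner_minor[OF inner_product_formD(1)[OF h]] minor_def)
    then have "frame_star A = A"
      using linear_eq_on_span[OF linear_frame_star linear_ident _ A] by simp
    then show "A \<in> self_dual_bivectors h V (oriented_bases h V \<Psi>)"
      using V by (simp add: self_dual_bivectors_def star)
  qed
qed

end

section \<open>Orientation of complex bases\<close>

lemma exhaust_8:
  fixes x :: 8
  shows "x = 1 \<or> x = 2 \<or> x = 3 \<or> x = 4 \<or> x = 5 \<or> x = 6 \<or> x = 7 \<or> x = 8"
proof (induct x)
  case (of_int z)
  then have "z = 0 \<or> z = 1 \<or> z = 2 \<or> z = 3 \<or> z = 4 \<or> z = 5 \<or> z = 6 \<or> z = 7" by fastforce
  then show ?case by auto
qed

lemma forall_8: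
  "(\<forall>i::8. P i) \<longleftrightarrow> P 1 \<and> P 2 \<and> P 3 \<and> P 4 \<and> P 5 \<and> P 6 \<and> P 7 \<and> P 8"
  by (metis exhaust_8)

lemma vector_4:
  "(vector [a, b, c, d] :: 'a::zero^4) $ 1 = a" "(vector [a, b, c, d] :: 'a^4) $ 2 = b"
  "(vector [a, b, c, d] :: 'a^4) $ 3 = c" "(vector [a, b, c, d] :: 'a^4) $ 4 = d"
  unfolding vector_def by simp_all

lemma vector_8:
  fixes a b c d p q r s :: "'a::zero"
  defines "v \<equiv> (vector [a, b, c, d, p, q, r, s] :: 'a^8)"
  shows "v $ 1 = a" "v $ 2 = b" "v $ 3 = c" "v $ 4 = d" "v $ 5 = p" "v $ 6 = q" "v $ 7 = r" "v $ 8 = s"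
  unfolding v_def vector_def by simp_all

lemma linear_cJ: "linear cJ"
  by (rule linearI) (simp_all add: vec_eq_iff forall_8 cJ_def vector_8)

lemma cJ_cJ [simp]: "cJ (cJ v) = - v"
  by (simp add: vec_eq_iff forall_8 cJ_def vector_8)

definition cscale :: "complex \<Rightarrow> real^8 \<Rightarrow> real^8" where
  "cscale z v = Re z *\<^sub>R v + Im z *\<^sub>R cJ v"

lemma continuous_det:
  fixes F :: "'a::topological_space \<Rightarrow> real^'n^'n"
  assumes "\<And>i j. continuous_on S (\<lambda>x. F x $ i $ j)"
  shows "continuous_on S (\<lambda>x. det (F x))"
  unfolding det_def by (intro continuous_intros assms)

lemma det_complexify: "det (\<chi> i j. complex_of_real (M$i$j)) = complex_of_real (det M)"
  by (simp add: det_def)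

text \<open>The determinant is formed over the ring of polynomials in \<open>z\<close>. It is not
  the zero polynomial, because its value at 0 is the determinant of the identity.\<close>

lemma finite_singular_pencil:
  fixes M :: "complex^'n^'n"
  shows "finite {z. det (\<chi> i j. (1 - z) * mat 1 $ i $ j + z * M$i$j) = 0}"
proof -
  define P where "P = (\<chi> i j. [: mat 1 $ i $ j, M$i$j - mat 1 $ i $ j :])"
  have P: "poly (det P) z = det (\<chi> i j. (1 - z) * mat 1 $ i $ j + z * M$i$j)" for z
    by (simp add: det_def P_def poly_sum poly_prod algebra_simps)
  have "(\<chi> i j. mat 1 $ i $ j) = (mat 1 :: complex^'n^'n)"
    by (simp add: vec_eq_iff)
  then have "poly (det P) 0 = 1"
    by (simp add: P)
  then have "det P \<noteq> 0"
    by auto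
  then show ?thesis
    using poly_roots_finite[of "det P"] by (simp add: P)
qed

text \<open>The pencil from the identity to \<open>A\<close> over the complex scalars is singular at finitely many
  parameters only, since these are roots of a complex polynomial; their complement is connected.\<close>

lemma det_complex_linear_nonneg:
  assumes A: "linear A" and commute: "\<And>v. A (cJ v) = cJ (A v)"
  shows "det (matrix A) \<ge> 0"
proof (rule ccontr)
  define M where "M = matrix A"
  assume "\<not> det (matrix A) \<ge> 0"
  then have neg: "det M < 0"
    by (simp add: M_def)
  define F where "F z v = v - cscale z v + cscale z (A v)" for z v
  define N where "N z = (\<chi> i j. (1 - z) * mat 1 $ i $ j + z * complex_of_real (M$i$j))" for z
  \<comment> \<open>\<open>W u\<close> lies in the eigenspace of the complexified \<open>cJ\<close>
    for the eigenvalue \<i>, where \<open>cscale z\<close> becomes multiplication by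
    \<open>z\<close>. Hence \<open>N z\<close> acts on \<open>W v\<close> as \<open>F z\<close> acts
    on \<open>v\<close>, and a kernel vector of \<open>F z\<close> yields one of
    \<open>N z\<close>.\<close>
  define W where "W u = (\<chi> i. complex_of_real (u$i) - \<i> * complex_of_real (cJ u $ i))" for u
  have F: "linear (F z)" for z
    using A linear_cJ by (auto simp: linear_iff F_def cscale_def algebra_simps)
  have Mv: "M *v v = A v" for v
    by (simp add: M_def matrix_works A)
  have "N z *v W v = W (F z v)" for z v
  proof -
    have "(\<Sum>j\<in>UNIV. complex_of_real (M$i$j) * W v $ j)
        = complex_of_real ((M *v v) $ i) - \<i> * complex_of_real ((M *v cJ v) $ i)" for i
      by (simp add: W_def matrix_vector_mult_def algebra_simps sum_subtractf sum_distrib_left)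
    then have M: "(\<Sum>j\<in>UNIV. complex_of_real (M$i$j) * W v $ j) = W (A v) $ i" for i
      by (simp add: Mv commute W_def)
    have "(N z *v W v) $ i = (1 - z) * (\<Sum>j\<in>UNIV. mat 1 $ i $ j * W v $ j)
        + z * (\<Sum>j\<in>UNIV. complex_of_real (M$i$j) * W v $ j)" for i
      by (simp add: N_def matrix_vector_mult_def algebra_simps sum.distrib sum_distrib_left sum_subtractf)
    moreover have "(\<Sum>j\<in>UNIV. mat 1 $ i $ j * W v $ j) = W v $ i" for i
      by (simp add: mat_def if_distrib if_distribR cong: if_cong)
    moreover have "W (cscale z u) $ i = z * W u $ i" for u i
      using linear_cJ by (simp add: linear_iff W_def cscale_def complex_eq_iff algebra_simps)
    moreover have "W (F z v) $ i = W v $ i - W (cscale z v) $ i + W (cscale z (A v)) $ i" for i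
      using linear_cJ by (simp add: F_def linear_add linear_diff W_def algebra_simps)
    ultimately have "(N z *v W v) $ i = W (F z v) $ i" for i
      by (simp only: M) (simp add: algebra_simps)
    then show ?thesis
      by (simp add: vec_eq_iff)
  qed
  note NW = this
  have sing: "det (N z) = 0" if "det (matrix (F z)) = 0" for z
  proof -
    have "\<not> invertible (matrix (F z))"
      using that by (simp add: invertible_det_nz)
    then obtain v where v: "matrix (F z) *v v = 0" "v \<noteq> 0"
      using matrix_left_invertible_ker invertible_left_inverse by blast
    have "W 0 = 0"
      using linear_0[OF linear_cJ] by (simp add: W_def vec_eq_iff)
    then have "N z *v W v = 0"
      using v(1) by (simp add: NW matrix_works F)
    moreover have "Re (W v $ i) = v $ i" for i
      by (simp add: W_def)
    then have "W v \<noteq> 0"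
      using v(2) by (metis vec_eq_iff zero_complex.sel(1) zero_index)
    ultimately have "\<not> invertible (N z)"
      using matrix_left_invertible_ker invertible_left_inverse by blast
    then show ?thesis
      by (simp add: invertible_det_nz)
  qed
  define S where "S = - {z. det (N z) = 0}"
  have "{z. det (N z) = 0} = {z. det (\<chi> i j. (1 - z) * mat 1 $ i $ j
      + z * (\<chi> i j. complex_of_real (M$i$j)) $ i $ j) = 0}"
    by (simp add: N_def)
  then have "finite {z. det (N z) = 0}"
    using finite_singular_pencil[of "\<chi> i j. complex_of_real (M$i$j)"] by simp
  then have "connected S"
    unfolding S_def
    by (intro path_connected_imp_connected path_connected_complement_countable countable_finite) simp
  moreover have "continuous_on S (\<lambda>z. det (matrix (F z)))"
    by (rule continuous_det) (simp add: matrix_def F_def cscale_def, intro continuous_intros)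
  ultimately have "connected ((\<lambda>z. det (matrix (F z))) ` S)"
    by (rule connected_continuous_image[rotated])
  moreover have "det (matrix (F 0)) = 1"
  proof -
    have "F 0 = id"
      by (simp add: F_def cscale_def fun_eq_iff)
    then show ?thesis
      by (simp add: matrix_id)
  qed
  moreover have "matrix (F 1) = M"
    by (simp add: F_def[abs_def] cscale_def M_def)
  moreover have "0 \<in> S"
  proof -
    have "N 0 = mat 1"
      by (simp add: N_def vec_eq_iff)
    then show ?thesis
      by (simp add: S_def)
  qed
  moreover have "1 \<in> S"
  proof -
    have "N 1 = (\<chi> i j. complex_of_real (M$i$j))"
      by (simp add: N_def)
    then show ?thesis
      using neg by (simp add: S_def det_complexify)
  qed
  ultimately have "0 \<in> (\<lambda>z. det (matrix (F z))) ` S"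
    using connected_contains_Icc[of _ "det M" 1] neg
    by (metis (no_types, lifting) atLeastAtMost_iff imageI less_eq_real_def subsetD zero_le_one)
  then obtain z where "z \<in> S" "det (matrix (F z)) = 0"
    by force
  then show False
    using sing by (simp add: S_def)
qed

text \<open>The rows are the columns of the matrix of the complex linear map that sends the standard
  complex basis to \<open>u1, u2, u3, u4\<close>.\<close>

lemma det_complex_basis_nonneg:
  "det (vector [u1, cJ u1, u2, cJ u2, u3, cJ u3, u4, cJ u4] :: real^8^8) \<ge> 0"
proof -
  define A where "A v = cscale (Complex (v$1) (v$2)) u1 + cscale (Complex (v$3) (v$4)) u2
    + cscale (Complex (v$5) (v$6)) u3 + cscale (Complex (v$7) (v$8)) u4" for v :: "real^8"
  have "linear A"
    by (rule linearI) (simp_all add: A_def cscale_def algebra_simps)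
  moreover have "A (cJ v) = cJ (A v)" for v
    by (simp add: A_def cscale_def linear_add[OF linear_cJ] linear_scale[OF linear_cJ])
      (simp add: cJ_def vector_8 algebra_simps)
  ultimately have "det (matrix A) \<ge> 0"
    by (rule det_complex_linear_nonneg)
  moreover have "transpose (matrix A) = vector [u1, cJ u1, u2, cJ u2, u3, cJ u3, u4, cJ u4]"
    by (simp add: vec_eq_iff forall_8 vector_8 transpose_def matrix_def A_def cscale_def axis_def)
  ultimately show ?thesis
    by (metis det_transpose)
qed

section \<open>Adapted frames\<close>

text \<open>Laplace expansion of the \<open>4 \<times> 4\<close> determinant along the first two rows.\<close>

definition cdet :: "complex \<Rightarrow> complex \<Rightarrow> complex \<Rightarrow> complex \<Rightarrow> complex \<Rightarrow> complex \<Rightarrow> complex \<Rightarrow> complex \<Rightarrow>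
    complex \<Rightarrow> complex \<Rightarrow> complex \<Rightarrow> complex \<Rightarrow> complex \<Rightarrow> complex \<Rightarrow> complex \<Rightarrow> complex \<Rightarrow> complex" where
  "cdet z1 z2 z3 z4 w1 w2 w3 w4 s1 s2 s3 s4 t1 t2 t3 t4 =
     (z1 * w2 - z2 * w1) * (s3 * t4 - s4 * t3) - (z1 * w3 - z3 * w1) * (s2 * t4 - s4 * t2)
     + (z1 * w4 - z4 * w1) * (s2 * t3 - s3 * t2) + (z2 * w3 - z3 * w2) * (s1 * t4 - s4 * t1)
     - (z2 * w4 - z4 * w2) * (s1 * t3 - s3 * t1) + (z3 * w4 - z4 * w3) * (s1 * t2 - s2 * t1)"

text \<open>A tangent space of a Calabi--Yau manifold of complex dimension 4.\<close>

locale calabi_yau_space =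
  fixes h :: "real^8 \<Rightarrow> real^8 \<Rightarrow> real"
    and \<rho> :: "real^8 \<Rightarrow> real^8 \<Rightarrow> real^8 \<Rightarrow> real^8 \<Rightarrow> complex"
  assumes h: "inner_product_form h"
    and h_cJ: "h (cJ x) (cJ y) = h x y"
    and alternating_\<rho>: "alternating4 \<rho>"
    and \<rho>_cJ: "\<rho> (cJ x) y u v = \<i> * \<rho> x y u v"
    and norm_\<rho>: "orthonormal h [u1, cJ u1, u2, cJ u2, u3, cJ u3, u4, cJ u4] \<Longrightarrow> cmod (\<rho> u1 u2 u3 u4) = 1"
begin

definition cayley :: "real^8 \<Rightarrow> real^8 \<Rightarrow> real^8 \<Rightarrow> real^8 \<Rightarrow> real" where
  "cayley x y u v = (1/2) * wedge22 (\<lambda>x. h (cJ x)) (\<lambda>x. h (cJ x)) x y u v + Re (\<rho> x y u v)"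

lemma h_linear: "linear (\<lambda>x. h x y)" "linear (h x)"
  using inner_product_formD(1)[OF h] by (auto simp: bilinear_def)

lemmas h_simps = linear_add[OF h_linear(1)] linear_add[OF h_linear(2)]
  linear_diff[OF h_linear(1)] linear_diff[OF h_linear(2)]
  linear_scale[OF h_linear(1)] linear_scale[OF h_linear(2)]
  linear_neg[OF h_linear(1)] linear_neg[OF h_linear(2)]

lemmas h_commute = inner_product_formD(2)[OF h]

lemmas cJ_simps = linear_add[OF linear_cJ] linear_scale[OF linear_cJ] linear_neg[OF linear_cJ]

lemma h_eq_0: "h x x = 0 \<longleftrightarrow> x = 0"
  using h linear_0[OF h_linear(1)] by (fastforce simp: inner_product_form_def)

lemma h_cJ_left: "h (cJ x) y = - h x (cJ y)"
  using h_cJ[of x "cJ y"] by (simp add: h_simps)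

lemma h_cJ_self: "h x (cJ x) = 0" "h (cJ x) x = 0"
  using h_cJ_left[of x x] h_commute[of "cJ x" x] by simp_all

lemma alternating_cayley: "alternating4 cayley"
proof -
  have "bilinear (\<lambda>x. h (cJ x))"
    unfolding bilinear_def linear_iff by (simp add: h_simps cJ_simps)
  then have "alternating4 (wedge22 (\<lambda>x. h (cJ x)) (\<lambda>x. h (cJ x)))"
    by (simp add: alternating4_wedge22 h_cJ_self)
  then show ?thesis
    using alternating_\<rho> unfolding alternating4_def linear_iff cayley_def
    by (simp add: algebra_simps)
qed

lemma \<rho>_cscale:
  "\<rho> (cscale z x) y u v = z * \<rho> x y u v" "\<rho> x (cscale z y) u v = z * \<rho> x y u v"
  "\<rho> x y (cscale z u) v = z * \<rho> x y u v" "\<rho> x y u (cscale z v) = z * \<rho> x y u v"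
proof -
  have 1: "\<rho> (cscale z x) y u v = z * \<rho> x y u v" for x y u v
    using alternating4D(1)[OF alternating_\<rho>]
    by (simp add: cscale_def linear_iff \<rho>_cJ scaleR_conv_of_real complex_eq_iff)
  note swap = alternating4_swap[OF alternating_\<rho>]
  have 2: "\<rho> x (cscale z y) u v = z * \<rho> x y u v" for x y u v
    using 1[of y x u v] by (simp add: swap(1)[of x "cscale z y"] swap(1)[of x y])
  have 3: "\<rho> x y (cscale z u) v = z * \<rho> x y u v" for x y u v
    using 2[of x u y v] by (simp add: swap(2)[of x "cscale z u"] swap(2)[of x u])
  have 4: "\<rho> x y u (cscale z v) = z * \<rho> x y u v" for x y u v
    using 3[of x y v u] by (simp add: swap(3)[of x y "cscale z v"] swap(3)[of x y v])
  show "\<rho> (cscale z x) y u v = z * \<rho> x y u v" "\<rho> x (cscale z y) u v = z * \<rho> x y u v"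
    "\<rho> x y (cscale z u) v = z * \<rho> x y u v" "\<rho> x y u (cscale z v) = z * \<rho> x y u v"
    by (fact 1 2 3 4)+
qed

lemma h_cscale:
  "h (cscale z x) (cscale w y) = Re (z * cnj w) * h x y + Im (z * cnj w) * h (cJ x) y"
  by (simp add: cscale_def h_simps h_cJ h_cJ_left algebra_simps)

text \<open>Up to sign, the two conditions are the vanishing of the real and the imaginary part of
  the Hermitian product.\<close>

definition complex_orthogonal :: "real^8 \<Rightarrow> real^8 \<Rightarrow> bool" where
  "complex_orthogonal x y \<longleftrightarrow> h x y = 0 \<and> h (cJ x) y = 0"

lemma complex_orthogonal_commute: "complex_orthogonal x y \<longleftrightarrow> complex_orthogonal y x"
  unfolding complex_orthogonal_def using h_cJ_left[of x y] h_cJ_left[of y x] h_commute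
  by (metis neg_equal_0_iff_equal)

text \<open>One step of the Gram-Schmidt process over the complex numbers. For \<open>r = 0\<close>
  the vector \<open>w\<close> is any unit vector complex orthogonal to \<open>U\<close>, and
  \<open>b = 0\<close>; it exists because \<open>U\<close> and its image under \<open>cJ\<close>
  span at most six of the eight dimensions. Degenerate positions such as complex planes are thereby
  included.\<close>

lemma ex_unit_complex_orthogonal:
  assumes "finite U" "card U \<le> 3" "\<And>u. u \<in> U \<Longrightarrow> complex_orthogonal r u"
  shows "\<exists>w b. h w w = 1 \<and> r = b *\<^sub>R w \<and> (\<forall>u\<in>U. complex_orthogonal w u)"
proof -
  have "\<exists>y. y \<noteq> 0 \<and> (\<forall>u\<in>U. complex_orthogonal y u)"
  proof -
    \<comment> \<open>Multiplication by the Gram matrix turns orthogonality for \<open>h\<close>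
      into Euclidean orthogonality.\<close>
    let ?X = "(*v) (gram_matrix h) ` (U \<union> cJ ` U)"
    have "dim ?X \<le> card ?X"
      using assms(1) by (intro dim_le_card') simp
    also have "\<dots> \<le> card U + card (cJ ` U)"
      using card_image_le[of "U \<union> cJ ` U"] card_Un_le[of U "cJ ` U"] assms(1)
      by (meson finite_UnI finite_imageI order_trans)
    also have "\<dots> \<le> 6"
      using card_image_le[OF assms(1), of cJ] assms(2) by simp
    finally have "dim ?X < DIM(real^8)"
      by simp
    then obtain y where y: "y \<noteq> 0" "\<And>x. x \<in> span ?X \<Longrightarrow> orthogonal y x"
      using orthogonal_to_subspace_exists by blast
    have "h y x = 0" if "x \<in> U \<union> cJ ` U" for x
      using y(2)[OF span_base[OF imageI[OF that]]] gram_matrix_mult[OF inner_product_formD(1)[OF h]]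
      by (simp add: orthogonal_def)
    then have "complex_orthogonal y u" if "u \<in> U" for u
      using that by (simp add: complex_orthogonal_def h_cJ_left)
    then show ?thesis
      using y(1) by blast
  qed
  then obtain y where y: "y \<noteq> 0" "\<And>u. u \<in> U \<Longrightarrow> complex_orthogonal y u"
    by blast
  have unit: "h (v /\<^sub>R sqrt (h v v)) (v /\<^sub>R sqrt (h v v)) = 1" if "v \<noteq> 0" for v
  proof -
    have "h v v > 0"
      using h that by (simp add: inner_product_form_def)
    then show ?thesis
      by (simp add: h_simps field_simps)
  qed
  have orth: "complex_orthogonal (c *\<^sub>R v) u" if "complex_orthogonal v u" for c v u
    using that by (simp add: complex_orthogonal_def h_simps cJ_simps)
  show ?thesis
  proof (cases "r = 0")
    case True
    then have "r = 0 *\<^sub>R (y /\<^sub>R sqrt (h y y))"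
      by simp
    with unit[OF y(1)] orth y(2) show ?thesis
      by blast
  next
    case False
    then have "r = sqrt (h r r) *\<^sub>R (r /\<^sub>R sqrt (h r r))"
      using h_eq_0[of r] by simp
    with unit[OF False] orth assms(3) show ?thesis
      by blast
  qed
qed

definition unitary :: "real^8 \<Rightarrow> real^8 \<Rightarrow> real^8 \<Rightarrow> real^8 \<Rightarrow> bool" where
  "unitary u1 u2 u3 u4 \<longleftrightarrow> h u1 u1 = 1 \<and> h u2 u2 = 1 \<and> h u3 u3 = 1 \<and> h u4 u4 = 1 \<and>
     complex_orthogonal u1 u2 \<and> complex_orthogonal u1 u3 \<and> complex_orthogonal u1 u4 \<and>
     complex_orthogonal u2 u3 \<and> complex_orthogonal u2 u4 \<and> complex_orthogonal u3 u4"

lemma unitary_simps: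
  assumes "unitary u1 u2 u3 u4"
  shows "h u1 u1 = 1" "h u2 u2 = 1" "h u3 u3 = 1" "h u4 u4 = 1"
    "h u1 u2 = 0" "h u1 u3 = 0" "h u1 u4 = 0" "h u2 u3 = 0" "h u2 u4 = 0" "h u3 u4 = 0"
    "h u2 u1 = 0" "h u3 u1 = 0" "h u4 u1 = 0" "h u3 u2 = 0" "h u4 u2 = 0" "h u4 u3 = 0"
    "h (cJ u1) u2 = 0" "h (cJ u1) u3 = 0" "h (cJ u1) u4 = 0" "h (cJ u2) u3 = 0"
    "h (cJ u2) u4 = 0" "h (cJ u3) u4 = 0" "h (cJ u2) u1 = 0" "h (cJ u3) u1 = 0"
    "h (cJ u4) u1 = 0" "h (cJ u3) u2 = 0" "h (cJ u4) u2 = 0" "h (cJ u4) u3 = 0"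
  using assms complex_orthogonal_commute unfolding unitary_def complex_orthogonal_def by auto

text \<open>Replaces the list positions 0 to 7 by indices of type \<open>8\<close>, so that
  \<open>forall_8\<close> can split the condition into its 64 equations.\<close>

lemma orthonormal_8:
  "orthonormal k [x1, x2, x3, x4, x5, x6, x7, x8] \<longleftrightarrow>
     (\<forall>i::8. \<forall>j. k (vector [x1, x2, x3, x4, x5, x6, x7, x8] $ i)
       (vector [x1, x2, x3, x4, x5, x6, x7, x8] $ j) = (if i = j then 1 else 0))"
  unfolding orthonormal_def forall_8
  by (simp add: numeral_eq_Suc All_less_Suc2 vector_8[unfolded numeral_eq_Suc])


section \<open>Complex coordinates in a unitary basis\<close>

definition comb :: "real^8 \<Rightarrow> real^8 \<Rightarrow> real^8 \<Rightarrow> real^8 \<Rightarrow> complex \<Rightarrow> complex \<Rightarrow> complex \<Rightarrow> complex \<Rightarrow> real^8" where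
  "comb u1 u2 u3 u4 z1 z2 z3 z4 = cscale z1 u1 + cscale z2 u2 + cscale z3 u3 + cscale z4 u4"

lemma cJ_comb:
  "cJ (comb u1 u2 u3 u4 z1 z2 z3 z4) = comb u1 u2 u3 u4 (\<i> * z1) (\<i> * z2) (\<i> * z3) (\<i> * z4)"
  by (simp add: comb_def cscale_def cJ_simps)

context
  fixes u1 u2 u3 u4
  assumes unitary: "unitary u1 u2 u3 u4"
begin

lemma h_comb:
  "h (comb u1 u2 u3 u4 z1 z2 z3 z4) (comb u1 u2 u3 u4 w1 w2 w3 w4)
    = Re (z1 * cnj w1) + Re (z2 * cnj w2) + Re (z3 * cnj w3) + Re (z4 * cnj w4)"
  by (simp add: comb_def h_simps h_cscale unitary_simps[OF unitary] h_cJ_self)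

text \<open>A form of type (4,0) is fixed by its value on one complex basis; with the value 1 it is
  the complex determinant of the coordinates.\<close>

lemma \<rho>_comb:
  assumes "\<rho> u1 u2 u3 u4 = 1"
  shows "\<rho> (comb u1 u2 u3 u4 z1 z2 z3 z4) (comb u1 u2 u3 u4 w1 w2 w3 w4)
      (comb u1 u2 u3 u4 s1 s2 s3 s4) (comb u1 u2 u3 u4 t1 t2 t3 t4)
    = cdet z1 z2 z3 z4 w1 w2 w3 w4 s1 s2 s3 s4 t1 t2 t3 t4"
proof -
  note L = alternating4D(1-4)[OF alternating_\<rho>]
  note zero = alternating4D(5-7)[OF alternating_\<rho>] alternating4_zero[OF alternating_\<rho>]
  note swap = alternating4_swap[OF alternating_\<rho>]
  have 1: "\<rho> (comb u1 u2 u3 u4 z1 z2 z3 z4) b c d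
      = z1 * \<rho> u1 b c d + z2 * \<rho> u2 b c d + z3 * \<rho> u3 b c d + z4 * \<rho> u4 b c d" for b c d
    by (simp add: comb_def linear_add[OF L(1)] \<rho>_cscale)
  have 2: "\<rho> a (comb u1 u2 u3 u4 z1 z2 z3 z4) c d
      = z1 * \<rho> a u1 c d + z2 * \<rho> a u2 c d + z3 * \<rho> a u3 c d + z4 * \<rho> a u4 c d" for z1 z2 z3 z4 a c d
    by (simp add: comb_def linear_add[OF L(2)] \<rho>_cscale)
  have 3: "\<rho> a b (comb u1 u2 u3 u4 z1 z2 z3 z4) d
      = z1 * \<rho> a b u1 d + z2 * \<rho> a b u2 d + z3 * \<rho> a b u3 d + z4 * \<rho> a b u4 d" for z1 z2 z3 z4 a b d
    by (simp add: comb_def linear_add[OF L(3)] \<rho>_cscale)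
  have 4: "\<rho> a b c (comb u1 u2 u3 u4 z1 z2 z3 z4)
      = z1 * \<rho> a b c u1 + z2 * \<rho> a b c u2 + z3 * \<rho> a b c u3 + z4 * \<rho> a b c u4" for z1 z2 z3 z4 a b c
    by (simp add: comb_def linear_add[OF L(4)] \<rho>_cscale)
  note sort = swap(1)[of u2 u1] swap(1)[of u3 u1] swap(1)[of u4 u1] swap(1)[of u3 u2]
    swap(1)[of u4 u2] swap(1)[of u4 u3]
    swap(2)[of _ u2 u1] swap(2)[of _ u3 u1] swap(2)[of _ u4 u1] swap(2)[of _ u3 u2]
    swap(2)[of _ u4 u2] swap(2)[of _ u4 u3]
    swap(3)[of _ _ u2 u1] swap(3)[of _ _ u3 u1] swap(3)[of _ _ u4 u1] swap(3)[of _ _ u3 u2]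
    swap(3)[of _ _ u4 u2] swap(3)[of _ _ u4 u3]
  show ?thesis
    unfolding 1 unfolding 2 unfolding 3 unfolding 4
    by (simp add: zero sort assms) (simp add: cdet_def algebra_simps)
qed

lemma cayley_comb:
  assumes "\<rho> u1 u2 u3 u4 = 1"
  shows "cayley (comb u1 u2 u3 u4 z1 z2 z3 z4) (comb u1 u2 u3 u4 w1 w2 w3 w4)
      (comb u1 u2 u3 u4 s1 s2 s3 s4) (comb u1 u2 u3 u4 t1 t2 t3 t4)
    = Im (z1 * cnj w1 + z2 * cnj w2 + z3 * cnj w3 + z4 * cnj w4)
        * Im (s1 * cnj t1 + s2 * cnj t2 + s3 * cnj t3 + s4 * cnj t4)
      - Im (z1 * cnj s1 + z2 * cnj s2 + z3 * cnj s3 + z4 * cnj s4)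
        * Im (w1 * cnj t1 + w2 * cnj t2 + w3 * cnj t3 + w4 * cnj t4)
      + Im (z1 * cnj t1 + z2 * cnj t2 + z3 * cnj t3 + z4 * cnj t4)
        * Im (w1 * cnj s1 + w2 * cnj s2 + w3 * cnj s3 + w4 * cnj s4)
      + Re (cdet z1 z2 z3 z4 w1 w2 w3 w4 s1 s2 s3 s4 t1 t2 t3 t4)"
proof -
  have "h (cJ (comb u1 u2 u3 u4 z1 z2 z3 z4)) (comb u1 u2 u3 u4 w1 w2 w3 w4)
      = - Im (z1 * cnj w1 + z2 * cnj w2 + z3 * cnj w3 + z4 * cnj w4)" for z1 z2 z3 z4 w1 w2 w3 w4
    by (simp add: cJ_comb h_comb)
  \<comment> \<open>The six terms of \<omega> \<and> \<omega> agree in pairs, which absorbs the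
    factor 1/2. Each remaining term is quadratic in \<omega>, so the minus sign of the preceding
    formula cancels.\<close>
  moreover have "cayley x y u v = h (cJ x) y * h (cJ u) v - h (cJ x) u * h (cJ y) v
      + h (cJ x) v * h (cJ y) u + Re (\<rho> x y u v)" for x y u v
    by (simp add: cayley_def wedge22_def)
  ultimately show ?thesis
    by (simp only: \<rho>_comb[OF assms] minus_mult_minus)
qed

lemma orthonormal_unitary: "orthonormal h [u1, cJ u1, u2, cJ u2, u3, cJ u3, u4, cJ u4]"
  unfolding orthonormal_8 forall_8
  by (simp add: vector_8 unitary_simps[OF unitary] h_cJ h_cJ_self)
    (simp add: unitary_simps[OF unitary] h_cJ_left[symmetric] flip: neg_equal_0_iff_equal)

lemma ex_comb: "\<exists>z1 z2 z3 z4. x = comb u1 u2 u3 u4 z1 z2 z3 z4"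
proof -
  have "x = (\<Sum>i<length [u1, cJ u1, u2, cJ u2, u3, cJ u3, u4, cJ u4].
      h x ([u1, cJ u1, u2, cJ u2, u3, cJ u3, u4, cJ u4] ! i)
        *\<^sub>R [u1, cJ u1, u2, cJ u2, u3, cJ u3, u4, cJ u4] ! i)"
    by (rule orthonormal_expand[OF inner_product_formD(1)[OF h] orthonormal_unitary, of UNIV])
      simp_all
  then have "x = comb u1 u2 u3 u4 (Complex (h x u1) (h x (cJ u1))) (Complex (h x u2) (h x (cJ u2)))
      (Complex (h x u3) (h x (cJ u3))) (Complex (h x u4) (h x (cJ u4)))"
    by (simp add: numeral_eq_Suc lessThan_Suc comb_def cscale_def add_ac)
  then show ?thesis
    by blast
qed

end

text \<open>Complex Gram-Schmidt applied to \<open>e1, e2, e3\<close>. The number \<open>a\<close>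
  is \<omega>(e1, e2), the cosine of the Kaehler angle of the first two vectors, and
  \<open>b\<close> measures what remains of \<open>e2\<close> outside the complex line of
  \<open>e1\<close>.\<close>

lemma adapted_unitary_basis:
  assumes "h e1 e1 = 1" "h e2 e2 = 1" "h e3 e3 = 1" "h e1 e2 = 0" "h e1 e3 = 0" "h e2 e3 = 0"
  obtains u1 u2 u3 u4 and a b \<alpha> \<beta> \<gamma> :: real
  where "unitary u1 u2 u3 u4" "\<rho> u1 u2 u3 u4 = 1"
    and "a\<^sup>2 + b\<^sup>2 = 1" "\<alpha>\<^sup>2 + \<beta>\<^sup>2 + \<gamma>\<^sup>2 = 1"
    and "e1 = comb u1 u2 u3 u4 1 0 0 0"
    and "e2 = comb u1 u2 u3 u4 (Complex 0 a) (of_real b) 0 0"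
    and "e3 = comb u1 u2 u3 u4 (Complex 0 (- b * \<alpha>)) (Complex (a * \<alpha>) \<beta>) (of_real \<gamma>) 0"
proof -
  define a where "a = h e2 (cJ e1)"
  have "complex_orthogonal (e2 - a *\<^sub>R cJ e1) e1"
    using assms by (simp add: complex_orthogonal_def a_def h_simps cJ_simps linear_diff[OF linear_cJ]
        h_cJ_self h_commute[of e2 e1]) (simp add: h_cJ_left)
  then obtain u2 b where u2: "h u2 u2 = 1" "e2 - a *\<^sub>R cJ e1 = b *\<^sub>R u2" "complex_orthogonal u2 e1"
    using ex_unit_complex_orthogonal[of "{e1}" "e2 - a *\<^sub>R cJ e1"] by auto
  have e2: "e2 = a *\<^sub>R cJ e1 + b *\<^sub>R u2"
    using u2(2) by (simp add: algebra_simps)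
  have o12: "h e1 u2 = 0" "h u2 e1 = 0" "h (cJ e1) u2 = 0" "h (cJ u2) e1 = 0" "h u2 (cJ e1) = 0" "h e1 (cJ u2) = 0"
    using u2(3) complex_orthogonal_commute[of u2 e1] h_cJ_left[of u2 e1] h_cJ_left[of e1 u2]
    by (simp_all add: complex_orthogonal_def)
  have ab: "a\<^sup>2 + b\<^sup>2 = 1"
    using assms(1,2) u2(1) by (simp add: e2 h_simps h_cJ o12 power2_eq_square)
  define y x \<beta> where "y = h e3 (cJ e1)" and "x = h e3 u2" and "\<beta> = h e3 (cJ u2)"
  define r where "r = e3 - y *\<^sub>R cJ e1 - x *\<^sub>R u2 - \<beta> *\<^sub>R cJ u2"
  have "complex_orthogonal r e1" "complex_orthogonal r u2"
    using assms u2(1)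
    by (simp_all add: complex_orthogonal_def r_def h_simps linear_diff[OF linear_cJ] cJ_simps
        h_cJ h_cJ_self o12 h_commute[of e3 e1] x_def y_def \<beta>_def)
      (simp_all add: h_cJ_left)
  then obtain u3 \<gamma> where u3: "h u3 u3 = 1" "r = \<gamma> *\<^sub>R u3" "complex_orthogonal u3 e1" "complex_orthogonal u3 u2"
    using ex_unit_complex_orthogonal[of "{e1, u2}" r] card_insert_le_m1[of 3 "{u2}" e1] by auto
  have o3: "h e1 u3 = 0" "h u3 e1 = 0" "h (cJ e1) u3 = 0" "h u3 (cJ e1) = 0"
    "h u2 u3 = 0" "h u3 u2 = 0" "h (cJ u2) u3 = 0" "h u3 (cJ u2) = 0"
    using u3(3,4) complex_orthogonal_commute[of u3 e1] complex_orthogonal_commute[of u3 u2]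
      h_cJ_left[of u3] h_commute[of u3]
    by (simp_all add: complex_orthogonal_def)
  have e3: "e3 = y *\<^sub>R cJ e1 + x *\<^sub>R u2 + \<beta> *\<^sub>R cJ u2 + \<gamma> *\<^sub>R u3"
    using u3(2) by (simp add: r_def algebra_simps)
  \<comment> \<open>Orthogonality of \<open>e2\<close> and \<open>e3\<close> makes
    \<open>(y, x)\<close> orthogonal to the unit vector \<open>(a, b)\<close>, so it is a multiple
    of \<open>(- b, a)\<close>; \<alpha> is the factor.\<close>
  have "a * y + b * x = 0"
    using assms(6) unfolding e2 by (simp add: h_simps x_def y_def h_commute[of _ e3])
  define \<alpha> where "\<alpha> = a * x - b * y"
  have \<alpha>: "y = - b * \<alpha>" "x = a * \<alpha>"
    using ab \<open>a * y + b * x = 0\<close> unfolding \<alpha>_def by algebra+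
  have "y\<^sup>2 + x\<^sup>2 + \<beta>\<^sup>2 + \<gamma>\<^sup>2 = 1"
    using assms(1,3) u2(1) u3(1)
    by (simp add: e3 h_simps h_cJ h_cJ_self o12 o3 power2_eq_square)
  then have \<gamma>: "\<alpha>\<^sup>2 + \<beta>\<^sup>2 + \<gamma>\<^sup>2 = 1"
    using ab unfolding \<alpha> by algebra
  obtain v where v: "h v v = 1" "complex_orthogonal v e1" "complex_orthogonal v u2" "complex_orthogonal v u3"
  proof -
    have "card {e1, u2, u3} \<le> 3"
      using card_length[of "[e1, u2, u3]"] by simp
    moreover have "complex_orthogonal 0 u" for u
      by (simp add: complex_orthogonal_def linear_0[OF h_linear(1)] linear_0[OF linear_cJ])
    ultimately show ?thesis
      using ex_unit_complex_orthogonal[of "{e1, u2, u3}" 0] that by auto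
  qed
  have "unitary e1 u2 u3 v"
    using assms(1) u2(1,3) u3(1,3,4) v complex_orthogonal_commute unfolding unitary_def by blast
  from norm_\<rho>[OF orthonormal_unitary[OF this]] have c: "cmod (\<rho> e1 u2 u3 v) = 1" .
  then have c: "\<rho> e1 u2 u3 v * cnj (\<rho> e1 u2 u3 v) = 1"
    by (simp flip: complex_norm_square)
  \<comment> \<open>\<rho> is complex linear and has modulus 1 on the basis with \<open>v\<close>,
    so multiplying \<open>v\<close> by the conjugate phase turns the value into 1.\<close>
  define u4 where "u4 = cscale (cnj (\<rho> e1 u2 u3 v)) v"
  have u4: "unitary e1 u2 u3 u4"
  proof -
    have "complex_orthogonal (cscale z x) y" if "complex_orthogonal x y" for x y z
      using that by (simp add: complex_orthogonal_def cscale_def h_simps cJ_simps)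
    moreover have "h u4 u4 = 1"
      using c v(1) by (simp add: u4_def h_cscale mult.commute[of "cnj _"] del: times_complex.sel)
    ultimately show ?thesis
      using \<open>unitary e1 u2 u3 v\<close> complex_orthogonal_commute unfolding unitary_def u4_def by blast
  qed
  moreover have "\<rho> e1 u2 u3 u4 = 1"
    using c by (simp add: u4_def \<rho>_cscale mult.commute)
  moreover have "e1 = comb e1 u2 u3 u4 1 0 0 0"
    "e2 = comb e1 u2 u3 u4 (Complex 0 a) (of_real b) 0 0"
    "e3 = comb e1 u2 u3 u4 (Complex 0 (- b * \<alpha>)) (Complex (a * \<alpha>) \<beta>) (of_real \<gamma>) 0"
    using e2 e3 by (simp_all add: comb_def cscale_def \<alpha>)
  ultimately show ?thesis
    using that[OF _ _ ab \<gamma>] by blast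
qed


text \<open>The triple product \<open>p\<close> of \<open>e\<^sub>1, e\<^sub>2, e\<^sub>3\<close> is a unit vector with \<open>h p e\<^sub>4 = 1\<close>, so \<open>p = e\<^sub>4\<close>.\<close>

lemma cayley_triple:
  assumes "orthonormal h [e1, e2, e3, e4]" "cayley e1 e2 e3 e4 = 1"
  shows "cayley e1 e2 e3 x = h e4 x"
    and "unitary u1 u2 u3 u4 \<Longrightarrow> \<rho> u1 u2 u3 u4 = 1 \<Longrightarrow> a\<^sup>2 + b\<^sup>2 = 1 \<Longrightarrow> \<alpha>\<^sup>2 + \<beta>\<^sup>2 + \<gamma>\<^sup>2 = 1 \<Longrightarrow>
      e1 = comb u1 u2 u3 u4 1 0 0 0 \<Longrightarrow>
      e2 = comb u1 u2 u3 u4 (Complex 0 a) (of_real b) 0 0 \<Longrightarrow>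
      e3 = comb u1 u2 u3 u4 (Complex 0 (- b * \<alpha>)) (Complex (a * \<alpha>) \<beta>) (of_real \<gamma>) 0 \<Longrightarrow>
      e4 = comb u1 u2 u3 u4 (Complex 0 (b * \<beta>)) (Complex (- a * \<beta>) \<alpha>) (Complex 0 (a * \<gamma>)) (of_real (b * \<gamma>))"
proof -
  have *: "e4 = comb u1 u2 u3 u4 (Complex 0 (b * \<beta>)) (Complex (- a * \<beta>) \<alpha>) (Complex 0 (a * \<gamma>)) (of_real (b * \<gamma>))
      \<and> cayley e1 e2 e3 x = h e4 x"
    if A: "unitary u1 u2 u3 u4" "\<rho> u1 u2 u3 u4 = 1" "a\<^sup>2 + b\<^sup>2 = 1" "\<alpha>\<^sup>2 + \<beta>\<^sup>2 + \<gamma>\<^sup>2 = 1"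
      "e1 = comb u1 u2 u3 u4 1 0 0 0" "e2 = comb u1 u2 u3 u4 (Complex 0 a) (of_real b) 0 0"
      "e3 = comb u1 u2 u3 u4 (Complex 0 (- b * \<alpha>)) (Complex (a * \<alpha>) \<beta>) (of_real \<gamma>) 0"
    for u1 u2 u3 u4 a b \<alpha> \<beta> \<gamma>
  proof -
    \<comment> \<open>The coordinates of the vector dual to \<Omega>(e1, e2, e3, .), as the next
      claim confirms.\<close>
    define p where "p = comb u1 u2 u3 u4 (Complex 0 (b * \<beta>)) (Complex (- a * \<beta>) \<alpha>) (Complex 0 (a * \<gamma>)) (of_real (b * \<gamma>))"
    have p: "cayley e1 e2 e3 x = h p x" for x
    proof -
      obtain z1 z2 z3 z4 where x: "x = comb u1 u2 u3 u4 z1 z2 z3 z4"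
        using ex_comb[OF A(1)] by blast
      show ?thesis
        unfolding x A(5-7) p_def cayley_comb[OF A(1,2)] h_comb[OF A(1)]
        by (simp add: cdet_def) (use A(3) in algebra)
    qed
    have "h p p = 1"
      unfolding p_def h_comb[OF A(1)] using A(3,4) by simp algebra
    moreover have "h p e4 = 1"
      using p[of e4] assms(2) by simp
    moreover have "h e4 e4 = 1"
      using assms(1) by (simp add: orthonormal_4)
    ultimately have "h (p - e4) (p - e4) = 0"
      by (simp add: h_simps h_commute[of e4 p])
    then have "e4 = p"
      by (simp add: h_eq_0)
    then show ?thesis
      using p p_def by simp
  qed
  then show "unitary u1 u2 u3 u4 \<Longrightarrow> \<rho> u1 u2 u3 u4 = 1 \<Longrightarrow> a\<^sup>2 + b\<^sup>2 = 1 \<Longrightarrow> \<alpha>\<^sup>2 + \<beta>\<^sup>2 + \<gamma>\<^sup>2 = 1 \<Longrightarrow>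
      e1 = comb u1 u2 u3 u4 1 0 0 0 \<Longrightarrow>
      e2 = comb u1 u2 u3 u4 (Complex 0 a) (of_real b) 0 0 \<Longrightarrow>
      e3 = comb u1 u2 u3 u4 (Complex 0 (- b * \<alpha>)) (Complex (a * \<alpha>) \<beta>) (of_real \<gamma>) 0 \<Longrightarrow>
      e4 = comb u1 u2 u3 u4 (Complex 0 (b * \<beta>)) (Complex (- a * \<beta>) \<alpha>) (Complex 0 (a * \<gamma>)) (of_real (b * \<gamma>))"
    by blast
  show "cayley e1 e2 e3 x = h e4 x"
    by (rule adapted_unitary_basis[of e1 e2 e3]) (use assms(1) * in \<open>auto simp: orthonormal_4\<close>)
qed


text \<open>The fourth vector is the triple product of the first three (see \<open>cayley_triple\<close>). The normal vectors are
  \<open>n\<^sub>1 = i u\<^sub>4\<close>, \<open>n\<^sub>2 = e\<^sub>1 \<times> e\<^sub>2 \<times> n\<^sub>1\<close>, \<open>n\<^sub>3 = e\<^sub>1 \<times> e\<^sub>3 \<times> n\<^sub>1\<close> and \<open>n\<^sub>4 = - e\<^sub>1 \<times> e\<^sub>4 \<times> n\<^sub>1\<close>.\<close>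

definition adapted_frame ::
    "real^8 \<Rightarrow> real^8 \<Rightarrow> real^8 \<Rightarrow> real^8 \<Rightarrow> real \<Rightarrow> real \<Rightarrow> real \<Rightarrow> real \<Rightarrow> real \<Rightarrow> (real^8) list" where
  "adapted_frame u1 u2 u3 u4 a b \<alpha> \<beta> \<gamma> =
    [comb u1 u2 u3 u4 1 0 0 0,
     comb u1 u2 u3 u4 (Complex 0 a) (of_real b) 0 0,
     comb u1 u2 u3 u4 (Complex 0 (- b * \<alpha>)) (Complex (a * \<alpha>) \<beta>) (of_real \<gamma>) 0,
     comb u1 u2 u3 u4 (Complex 0 (b * \<beta>)) (Complex (- a * \<beta>) \<alpha>) (Complex 0 (a * \<gamma>)) (of_real (b * \<gamma>)),
     comb u1 u2 u3 u4 0 0 0 \<i>,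
     comb u1 u2 u3 u4 0 0 (Complex 0 b) (of_real (- a)),
     comb u1 u2 u3 u4 0 (Complex 0 (- \<gamma>)) (Complex \<beta> (a * \<alpha>)) (of_real (b * \<alpha>)),
     comb u1 u2 u3 u4 (Complex 0 (- b * \<gamma>)) (of_real (a * \<gamma>)) (Complex (- \<alpha>) (a * \<beta>)) (of_real (b * \<beta>))]"

lemma orthonormal_adapted_frame:
  assumes "unitary u1 u2 u3 u4" "a\<^sup>2 + b\<^sup>2 = 1" "\<alpha>\<^sup>2 + \<beta>\<^sup>2 + \<gamma>\<^sup>2 = 1"
  shows "orthonormal h (adapted_frame u1 u2 u3 u4 a b \<alpha> \<beta> \<gamma>)"
  unfolding adapted_frame_def orthonormal_8 forall_8 vector_8 h_comb[OF assms(1)]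
  by (simp, intro conjI; use assms(2,3) in algebra)

text \<open>Pairing a linear relation between the rows with row \<open>j\<close> isolates the
  coefficient of that row.\<close>

lemma det_orthonormal_neq_0:
  assumes "orthonormal h [x1, x2, x3, x4, x5, x6, x7, x8]"
  shows "det (vector [x1, x2, x3, x4, x5, x6, x7, x8] :: real^8^8) \<noteq> 0"
proof -
  let ?M = "vector [x1, x2, x3, x4, x5, x6, x7, x8] :: real^8^8"
  have on: "h (?M $ i) (?M $ j) = (if i = j then 1 else 0)" for i j
    using assms orthonormal_8 by blast
  have "c = 0" if "transpose ?M *v c = 0" for c
  proof -
    have "c $ j = 0" for j
    proof -
      have "(\<Sum>i\<in>UNIV. c$i *\<^sub>R ?M $ i) = 0"
        using that by (simp add: vec_eq_iff matrix_vector_mult_def transpose_def mult.commute)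
      then have "h (\<Sum>i\<in>UNIV. c$i *\<^sub>R ?M $ i) (?M $ j) = 0"
        using linear_0[OF h_linear(1)] by simp
      then show ?thesis
        unfolding linear_sum[OF h_linear(1)] linear_scale[OF h_linear(1)] on
        by (simp add: if_distrib cong: if_cong)
    qed
    then show ?thesis
      by (simp add: vec_eq_iff)
  qed
  then have "invertible (transpose ?M)"
    using matrix_left_invertible_ker invertible_left_inverse by blast
  then show ?thesis
    by (simp add: invertible_det_nz)
qed

text \<open>The determinant does not vanish on the connected space of parameters, and it is positive where
  the frame consists of complex lines.\<close>

lemma det_adapted_frame_pos:
  assumes u: "unitary u1 u2 u3 u4" and "a\<^sup>2 + b\<^sup>2 = 1" "\<alpha>\<^sup>2 + \<beta>\<^sup>2 + \<gamma>\<^sup>2 = 1"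
  shows "det (vector (adapted_frame u1 u2 u3 u4 a b \<alpha> \<beta> \<gamma>) :: real^8^8) > 0"
proof -
  define D where "D q = det (vector (adapted_frame u1 u2 u3 u4 (Re (fst q)) (Im (fst q))
      (snd q $ 1) (snd q $ 2) (snd q $ 3)) :: real^8^8)" for q :: "complex \<times> (real^3)"
  define S where "S = sphere (0::complex) 1 \<times> sphere (0::real^3) 1"
  have S: "q \<in> S \<longleftrightarrow> (Re (fst q))\<^sup>2 + (Im (fst q))\<^sup>2 = 1
      \<and> (snd q $ 1)\<^sup>2 + (snd q $ 2)\<^sup>2 + (snd q $ 3)\<^sup>2 = 1" for q
    by (cases q) (simp add: S_def cmod_def norm_vec_def L2_set_def sum_3)
  have "connected S"
    unfolding S_def by (intro connected_Times connected_sphere) simp_all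
  moreover have "continuous_on S D"
    unfolding D_def
  proof (rule continuous_det)
    fix i j :: 8
    show "continuous_on S (\<lambda>q. (vector (adapted_frame u1 u2 u3 u4 (Re (fst q)) (Im (fst q))
      (snd q $ 1) (snd q $ 2) (snd q $ 3)) :: real^8^8) $ i $ j)"
      using exhaust_8[of i]
      by (elim disjE; simp only: adapted_frame_def vector_8 comb_def cscale_def)
        (simp_all, (intro continuous_intros)+)
  qed
  ultimately have "connected (D ` S)"
    by (rule connected_continuous_image[rotated])
  moreover have "0 \<notin> D ` S"
  proof
    assume "0 \<in> D ` S"
    then obtain q where q: "q \<in> S" "D q = 0"
      by force
    show False
      using det_orthonormal_neq_0 orthonormal_adapted_frame[OF u] q
      unfolding S D_def adapted_frame_def by blast
  qed
  moreover have "D (1, axis 1 1) \<ge> 0"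
  proof -
    \<comment> \<open>At \<open>a = \<alpha> = 1\<close> and
      \<open>b = \<beta> = \<gamma> = 0\<close> the tangent half is
      \<open>u1, cJ u1, u2, cJ u2\<close>, and the normal half is spanned by the complex lines of
      \<open>cJ u4\<close> and \<open>cJ u3\<close>.\<close>
    have "D (1, axis 1 1) = det (vector [u1, cJ u1, u2, cJ u2, cJ u4, cJ (cJ u4), cJ u3, cJ (cJ u3)] :: real^8^8)"
      by (simp add: D_def adapted_frame_def comb_def cscale_def axis_def)
    then show ?thesis
      using det_complex_basis_nonneg[of u1 u2 "cJ u4" "cJ u3"] by simp
  qed
  moreover have "(1, axis 1 1) \<in> S"
    by (simp add: S axis_def)
  moreover define q where "q = (Complex a b, vector [\<alpha>, \<beta>, \<gamma>] :: real^3)"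
  then have "q \<in> S"
    using assms(2,3) by (simp add: S)
  ultimately have "D q > 0"
    using connected_contains_Icc[of "D ` S" "D q" "D (1, axis 1 1)"]
    by (metis (no_types, lifting) atLeastAtMost_iff image_eqI linorder_not_less subsetD)
  then show ?thesis
    by (simp add: D_def q_def)
qed

text \<open>The table of the standard Cayley form. Values with three arguments in one half and one
  in the other are not listed: they follow from the triple product, which is the fourth vector of
  that half up to sign.\<close>

definition cayley_frame ::
    "real^8 \<Rightarrow> real^8 \<Rightarrow> real^8 \<Rightarrow> real^8 \<Rightarrow> real^8 \<Rightarrow> real^8 \<Rightarrow> real^8 \<Rightarrow> real^8 \<Rightarrow> bool" where
  "cayley_frame e1 e2 e3 e4 n1 n2 n3 n4 \<longleftrightarrow>
     orthonormal h [e1, e2, e3, e4, n1, n2, n3, n4] \<and>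
     cayley e1 e2 e3 e4 = 1 \<and> cayley n1 n2 n3 n4 = 1 \<and>
     cayley e1 e2 n1 n2 = 1 \<and> cayley e1 e2 n1 n3 = 0 \<and> cayley e1 e2 n1 n4 = 0 \<and>
     cayley e1 e2 n2 n3 = 0 \<and> cayley e1 e2 n2 n4 = 0 \<and> cayley e1 e2 n3 n4 = 1 \<and>
     cayley e1 e3 n1 n2 = 0 \<and> cayley e1 e3 n1 n3 = 1 \<and> cayley e1 e3 n1 n4 = 0 \<and>
     cayley e1 e3 n2 n3 = 0 \<and> cayley e1 e3 n2 n4 = -1 \<and> cayley e1 e3 n3 n4 = 0 \<and>
     cayley e1 e4 n1 n2 = 0 \<and> cayley e1 e4 n1 n3 = 0 \<and> cayley e1 e4 n1 n4 = -1 \<and>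
     cayley e1 e4 n2 n3 = -1 \<and> cayley e1 e4 n2 n4 = 0 \<and> cayley e1 e4 n3 n4 = 0 \<and>
     cayley e2 e3 n1 n2 = 0 \<and> cayley e2 e3 n1 n3 = 0 \<and> cayley e2 e3 n1 n4 = -1 \<and>
     cayley e2 e3 n2 n3 = -1 \<and> cayley e2 e3 n2 n4 = 0 \<and> cayley e2 e3 n3 n4 = 0 \<and>
     cayley e2 e4 n1 n2 = 0 \<and> cayley e2 e4 n1 n3 = -1 \<and> cayley e2 e4 n1 n4 = 0 \<and>
     cayley e2 e4 n2 n3 = 0 \<and> cayley e2 e4 n2 n4 = 1 \<and> cayley e2 e4 n3 n4 = 0 \<and>
     cayley e3 e4 n1 n2 = 1 \<and> cayley e3 e4 n1 n3 = 0 \<and> cayley e3 e4 n1 n4 = 0 \<and>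
     cayley e3 e4 n2 n3 = 0 \<and> cayley e3 e4 n2 n4 = 0 \<and> cayley e3 e4 n3 n4 = 1"

text \<open>In the adapted basis each entry of the table is a polynomial in the five parameters,
  which is evaluated modulo the two sphere equations. The positive determinant later fixes the
  orientation of the normal space.\<close>

lemma cayley_normal_frame:
  assumes e: "orthonormal h [e1, e2, e3, e4]" "cayley e1 e2 e3 e4 = 1"
  obtains n1 n2 n3 n4
  where "cayley_frame e1 e2 e3 e4 n1 n2 n3 n4"
    and "det (vector [e1, e2, e3, e4, n1, n2, n3, n4] :: real^8^8) > 0"
proof (rule adapted_unitary_basis[of e1 e2 e3])
  fix u1 u2 u3 u4 a b \<alpha> \<beta> \<gamma>
  assume u: "unitary u1 u2 u3 u4" "\<rho> u1 u2 u3 u4 = 1"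
    and ab: "a\<^sup>2 + b\<^sup>2 = 1" and \<alpha>\<beta>\<gamma>: "\<alpha>\<^sup>2 + \<beta>\<^sup>2 + \<gamma>\<^sup>2 = 1"
    and e123: "e1 = comb u1 u2 u3 u4 1 0 0 0"
      "e2 = comb u1 u2 u3 u4 (Complex 0 a) (of_real b) 0 0"
      "e3 = comb u1 u2 u3 u4 (Complex 0 (- b * \<alpha>)) (Complex (a * \<alpha>) \<beta>) (of_real \<gamma>) 0"
  note e4 = cayley_triple(2)[OF e u ab \<alpha>\<beta>\<gamma> e123]
  define n1 n2 n3 n4 where n: "n1 = comb u1 u2 u3 u4 0 0 0 \<i>"
     "n2 = comb u1 u2 u3 u4 0 0 (Complex 0 b) (of_real (- a))"
     "n3 = comb u1 u2 u3 u4 0 (Complex 0 (- \<gamma>)) (Complex \<beta> (a * \<alpha>)) (of_real (b * \<alpha>))"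
     "n4 = comb u1 u2 u3 u4 (Complex 0 (- b * \<gamma>)) (of_real (a * \<gamma>)) (Complex (- \<alpha>) (a * \<beta>)) (of_real (b * \<beta>))"
  have frame: "adapted_frame u1 u2 u3 u4 a b \<alpha> \<beta> \<gamma> = [e1, e2, e3, e4, n1, n2, n3, n4]"
    by (simp only: adapted_frame_def e123 e4 n)
  have on: "orthonormal h [e1, e2, e3, e4, n1, n2, n3, n4]"
    and det: "det (vector [e1, e2, e3, e4, n1, n2, n3, n4] :: real^8^8) > 0"
    using orthonormal_adapted_frame[OF u(1) ab \<alpha>\<beta>\<gamma>] det_adapted_frame_pos[OF u(1) ab \<alpha>\<beta>\<gamma>]
    unfolding frame by blast+
  have "cayley_frame e1 e2 e3 e4 n1 n2 n3 n4"
    unfolding cayley_frame_def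
    by (intro conjI on e(2); unfold e123 e4 n cayley_comb[OF u]; simp add: cdet_def;
        (simp add: algebra_simps; fail | use ab \<alpha>\<beta>\<gamma> in algebra))
  then show thesis
    using that det by blast
qed (use e(1) in \<open>simp_all add: orthonormal_4\<close>)

end

section \<open>The bundle map at a point\<close>

text \<open>By skew symmetry the pairs \<open>i < j\<close> suffice, and \<open>sorted_wrt\<close>
  expresses exactly these: 28 equations for a list of eight vectors.\<close>

lemma alternating_bilinear_eq_0:
  assumes "\<And>y. linear (\<lambda>x. \<beta> x y)" "\<And>x. linear (\<beta> x)" and zero: "\<And>x. \<beta> x x = (0::real)"
    and "sorted_wrt (\<lambda>u v. \<beta> u v = 0) xs"
    and x: "x \<in> span (set xs)" "y \<in> span (set xs)"
  shows "\<beta> x y = 0"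
proof -
  have skew: "\<beta> u v = - \<beta> v u" for u v
  proof -
    have "\<beta> (u + v) (u + v) = 0"
      by (rule zero)
    then show ?thesis
      unfolding linear_add[OF assms(1)] linear_add[OF assms(2)] by (simp add: zero)
  qed
  have pairs: "\<beta> (xs!i) (xs!j) = 0" if "i < j" "j < length xs" for i j
    using assms(4) that by (simp add: sorted_wrt_iff_nth_less)
  have "\<beta> (xs!i) (xs!j) = 0" if "i < length xs" "j < length xs" for i j
    using pairs[of i j] pairs[of j i] zero skew[of "xs!i" "xs!j"] that
    by (cases i j rule: linorder_cases) auto
  then have "\<beta> u v = 0" if "u \<in> set xs" "v \<in> set xs" for u v
    using that by (auto simp: in_set_conv_nth)
  then have "\<beta> x v = 0" if "v \<in> set xs" for v
    using linear_eq_0_on_span[OF assms(1) _ x(1)] that by blast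
  then show ?thesis
    using linear_eq_0_on_span[OF assms(2) _ x(2)] by blast
qed

lemma span_3:
  assumes "x \<in> span {a, b, c :: 'a::real_vector}"
  obtains r s t where "x = r *\<^sub>R a + s *\<^sub>R b + t *\<^sub>R c"
  using assms unfolding span_insert span_empty
  by (auto simp: algebra_simps eq_diff_eq diff_eq_eq)

lemma tensor_inner_wedge_outer:
  "inner_product_form h \<Longrightarrow> tensor_inner h (wedge a b) (outer x y) = minor h a b x y"
  using inner_product_formD(2)[of h]
  by (simp add: wedge_eq_outer linear_diff[OF linear_tensor_inner(2)] tensor_inner_outer
      inner_product_formD(1) minor_def mult.commute)

lemma form4_bivec_wedge_outer:
  assumes "alternating4 \<Phi>"
  shows "form4_bivec \<Phi> (wedge a b) (outer x y) = \<Phi> a b x y / 2"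
  using alternating4_swap(1)[OF assms, of b a]
  by (simp add: wedge_eq_outer linear_diff[OF linear_form4_bivec(2)] form4_bivec_outer[OF assms])

lemma linear_sandwich:
  fixes M N :: "real^'n^'n"
  assumes "linear F"
  shows "linear (\<lambda>A. M ** F A ** N)"
proof -
  have "linear (\<lambda>X. M ** X ** N)"
    by (rule linearI) (simp_all add: vec_eq_iff matrix_matrix_mult_def algebra_simps sum.distrib
        sum_distrib_left sum_distrib_right)
  from linear_compose[OF assms this] show ?thesis
    by (simp only: o_def)
qed

lemma linear_form4_bivec_matrix:
  "linear (\<lambda>A. \<chi> k l. form4_bivec \<Phi> A (outer (axis k 1) (axis l 1)))"
  unfolding linear_iff vec_eq_iff
  by (simp add: linear_add[OF linear_form4_bivec(2)] linear_scale[OF linear_form4_bivec(2)])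

lemma linear_form4_sharp: "linear (form4_sharp h \<Phi>)"
proof -
  have eq: "form4_sharp h \<Phi> = (\<lambda>A. matrix_inv (gram_matrix h)
      ** (\<chi> k l. form4_bivec \<Phi> A (outer (axis k 1) (axis l 1))) ** matrix_inv (gram_matrix h))"
    by (rule ext) (rule form4_sharp_def)
  show ?thesis
    unfolding eq by (intro linear_sandwich linear_form4_bivec_matrix)
qed

context calabi_yau_space
begin

lemma orthonormal_8_D:
  assumes "orthonormal h [x1, x2, x3, x4, x5, x6, x7, x8]"
  shows "h x1 x1 = 1" "h x2 x2 = 1" "h x3 x3 = 1" "h x4 x4 = 1"
    "h x5 x5 = 1" "h x6 x6 = 1" "h x7 x7 = 1" "h x8 x8 = 1"
    "h x1 x2 = 0" "h x1 x3 = 0" "h x1 x4 = 0" "h x1 x5 = 0" "h x1 x6 = 0" "h x1 x7 = 0" "h x1 x8 = 0"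
    "h x2 x1 = 0" "h x2 x3 = 0" "h x2 x4 = 0" "h x2 x5 = 0" "h x2 x6 = 0" "h x2 x7 = 0" "h x2 x8 = 0"
    "h x3 x1 = 0" "h x3 x2 = 0" "h x3 x4 = 0" "h x3 x5 = 0" "h x3 x6 = 0" "h x3 x7 = 0" "h x3 x8 = 0"
    "h x4 x1 = 0" "h x4 x2 = 0" "h x4 x3 = 0" "h x4 x5 = 0" "h x4 x6 = 0" "h x4 x7 = 0" "h x4 x8 = 0"
    "h x5 x1 = 0" "h x5 x2 = 0" "h x5 x3 = 0" "h x5 x4 = 0" "h x5 x6 = 0" "h x5 x7 = 0" "h x5 x8 = 0"
    "h x6 x1 = 0" "h x6 x2 = 0" "h x6 x3 = 0" "h x6 x4 = 0" "h x6 x5 = 0" "h x6 x7 = 0" "h x6 x8 = 0"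
    "h x7 x1 = 0" "h x7 x2 = 0" "h x7 x3 = 0" "h x7 x4 = 0" "h x7 x5 = 0" "h x7 x6 = 0" "h x7 x8 = 0"
    "h x8 x1 = 0" "h x8 x2 = 0" "h x8 x3 = 0" "h x8 x4 = 0" "h x8 x5 = 0" "h x8 x6 = 0" "h x8 x7 = 0"
  by (simp_all only: assms[unfolded orthonormal_8 forall_8 vector_8, simplified])

text \<open>Exchanging the two pairs of arguments is an even permutation, and the table is
  symmetric. Results for the tangent half therefore hold for the normal half, including the formula
  for the inverse map.\<close>

lemma cayley_frame_commute:
  assumes "cayley_frame e1 e2 e3 e4 n1 n2 n3 n4"
  shows "cayley_frame n1 n2 n3 n4 e1 e2 e3 e4"
proof -
  have on: "orthonormal h [e1, e2, e3, e4, n1, n2, n3, n4]"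
    using assms by (simp add: cayley_frame_def)
  have "orthonormal h [n1, n2, n3, n4, e1, e2, e3, e4]"
    unfolding orthonormal_8 forall_8 vector_8 by (simp add: orthonormal_8_D[OF on])
  moreover have sym: "cayley x y u v = cayley u v x y" for x y u v
    by (rule alternating4_perm(3)[OF alternating_cayley])
  ultimately show ?thesis
    using assms unfolding cayley_frame_def
    by (elim conjE, intro conjI) (assumption | (subst sym, assumption))+
qed

lemma cayley_frame_span:
  assumes "cayley_frame e1 e2 e3 e4 n1 n2 n3 n4"
  shows "x \<in> span (set [e1, e2, e3, e4, n1, n2, n3, n4])"
  by (rule orthonormal_expand(2)[OF inner_product_formD(1)[OF h], of _ UNIV])
    (use assms in \<open>simp_all add: cayley_frame_def\<close>)

text \<open>The difference of the two sides is alternating in \<open>x\<close> and \<open>y\<close>.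
  Triple products decide the pairs that contain a tangent vector, the table decides the normal
  pairs. The tangential part reproduces the bivector, since \<Omega> restricts to the volume form
  and the bivector is fixed by the star.\<close>

lemma cayley_frame_self_dual:
  assumes frame: "cayley_frame e1 e2 e3 e4 n1 n2 n3 n4"
  shows "cayley e1 e2 x y + cayley e3 e4 x y = minor h e1 e2 x y + minor h e3 e4 x y
      + 2 * (minor h n1 n2 x y + minor h n3 n4 x y)"
    and "cayley e1 e3 x y - cayley e2 e4 x y = minor h e1 e3 x y - minor h e2 e4 x y
      + 2 * (minor h n1 n3 x y - minor h n2 n4 x y)"
    and "cayley e1 e4 x y + cayley e2 e3 x y = minor h e1 e4 x y + minor h e2 e3 x y
      - 2 * (minor h n1 n4 x y + minor h n2 n3 x y)"
proof -
  have on8: "orthonormal h [e1, e2, e3, e4, n1, n2, n3, n4]"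
    using frame by (simp add: cayley_frame_def)
  note on = orthonormal_8_D[OF on8]
  have one: "cayley e1 e2 e3 e4 = 1"
    using frame by (simp add: cayley_frame_def)
  note L = alternating4D(3,4)[OF alternating_cayley]
  note zero = alternating4D(5-7)[OF alternating_cayley] alternating4_zero[OF alternating_cayley]
  note swap = alternating4_swap[OF alternating_cayley]
  note perm = alternating4_perm[OF alternating_cayley]
  have t4: "cayley e1 e2 e3 x = h e4 x" for x
    by (rule cayley_triple(1)) (simp_all add: orthonormal_4 on one)
  have "cayley e2 e1 e4 x = h e3 x" for x
    by (rule cayley_triple(1)) (simp_all add: orthonormal_4 on one swap(1)[of e2 e1] swap(3)[of e1 e2 e4])
  then have t3: "cayley e1 e2 e4 x = - h e3 x" for x
    using swap(1)[of e2 e1 e4 x] by simp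
  have t2: "cayley e1 e3 e4 x = h e2 x" for x
    by (rule cayley_triple(1)) (simp_all add: orthonormal_4 on one perm)
  have "cayley e3 e2 e4 x = h e1 x" for x
    by (rule cayley_triple(1)) (simp_all add: orthonormal_4 on one swap(3)[of e3 e2 e4 e1]
        swap(2)[of e3 e2 e1 e4] swap(1)[of e3 e1 e2 e4] swap(2)[of e1 e3 e2 e4])
  then have t1: "cayley e2 e3 e4 x = - h e1 x" for x
    using swap(1)[of e3 e2 e4 x] by simp
  have t: "cayley e3 e4 e1 x = h e2 x" "cayley e3 e4 e2 x = - h e1 x"
    "cayley e1 e3 e2 x = - h e4 x" "cayley e2 e4 e1 x = - h e3 x" "cayley e2 e4 e3 x = h e1 x"
    "cayley e1 e4 e2 x = h e3 x" "cayley e1 e4 e3 x = - h e2 x" "cayley e2 e3 e1 x = h e4 x" for x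
    using t1 t2 t3 t4 swap(1)[of e3 e1 e4] swap(2)[of e3 e4 e1] swap(2)[of e3 e4 e2] swap(1)[of e3 e2 e4]
      swap(2)[of e1 e3 e2] swap(2)[of e2 e4 e1] swap(1)[of e2 e1 e4] swap(2)[of e2 e4 e3]
      swap(2)[of e1 e4 e2] swap(2)[of e1 e4 e3] swap(2)[of e2 e3 e1] swap(1)[of e2 e1 e3]
    by simp_all
  \<comment> \<open>\<sigma> is the sign inside the self-dual bivector, and \<tau>, which will be 2
    or -2, is the coefficient of the normal part.\<close>
  have key: "cayley a b x y + \<sigma> * cayley c d x y = minor h a b x y + \<sigma> * minor h c d x y
      + \<tau> * (minor h p q x y + \<sigma> * minor h r s x y)"
    if "sorted_wrt (\<lambda>x y. cayley a b x y + \<sigma> * cayley c d x y - (minor h a b x y + \<sigma> * minor h c d x y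
      + \<tau> * (minor h p q x y + \<sigma> * minor h r s x y)) = 0) [e1, e2, e3, e4, n1, n2, n3, n4]"
    for a b c d p q r s \<sigma> \<tau>
  proof -
    have "linear (\<lambda>x. minor h a b x y)" "linear (minor h a b x)" "minor h a b x x = 0" for a b x y
      using h_linear(1) by (auto simp: linear_iff minor_def algebra_simps)
    with L alternating_bilinear_eq_0[OF _ _ _ that cayley_frame_span[OF frame] cayley_frame_span[OF frame]]
    show ?thesis
      by (simp add: linear_iff zero algebra_simps)
  qed
  note vals = frame[unfolded cayley_frame_def]
  show "cayley e1 e2 x y + cayley e3 e4 x y = minor h e1 e2 x y + minor h e3 e4 x y
      + 2 * (minor h n1 n2 x y + minor h n3 n4 x y)"
    using key[of e1 e2 1 e3 e4 2 n1 n2 n3 n4] by (simp add: t t3 t4 on minor_def vals zero)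
  show "cayley e1 e3 x y - cayley e2 e4 x y = minor h e1 e3 x y - minor h e2 e4 x y
      + 2 * (minor h n1 n3 x y - minor h n2 n4 x y)"
    using key[of e1 e3 "-1" e2 e4 2 n1 n3 n2 n4] by (simp add: t t2 on minor_def vals zero)
  show "cayley e1 e4 x y + cayley e2 e3 x y = minor h e1 e4 x y + minor h e2 e3 x y
      - 2 * (minor h n1 n4 x y + minor h n2 n3 x y)"
    using key[of e1 e4 1 e2 e3 "-2" n1 n4 n2 n3] by (simp add: t t1 on minor_def vals zero algebra_simps)
qed


text \<open>On self-dual bivectors of the tangent space, the term \<open>A / 2\<close> is the tangential part of \<open>form4_sharp\<close>; the
  same formula gives the inverse map on the normal side.\<close>

definition bivec_map :: "real^8^8 \<Rightarrow> real^8^8" where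
  "bivec_map A = form4_sharp h cayley A - (1/2) *\<^sub>R A"

lemma linear_bivec_map: "linear bivec_map"
  using linear_form4_sharp[of h cayley] by (simp add: linear_iff bivec_map_def algebra_simps)

text \<open>Paired with \<open>outer x y\<close>, a wedge gives a minor for the metric but half a
  value of the form. This turns the coefficients 1 and 2 of the preceding identities into 1/2 for
  the tangential and 1 for the normal part.\<close>

lemma bivec_map_frame:
  assumes frame: "cayley_frame e1 e2 e3 e4 n1 n2 n3 n4"
  shows "bivec_map (wedge e1 e2 + wedge e3 e4) = wedge n1 n2 + wedge n3 n4"
    and "bivec_map (wedge e1 e3 - wedge e2 e4) = wedge n1 n3 - wedge n2 n4"
    and "bivec_map (wedge e1 e4 + wedge e2 e3) = - (wedge n1 n4 + wedge n2 n3)"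
proof -
  have sharp: "form4_sharp h cayley A = X"
    if "\<And>x y. tensor_inner h X (outer x y) = form4_bivec cayley A (outer x y)" for A X
    by (rule form4_sharp_eqI[OF h], rule fun_cong,
        rule linear_eq_outer[OF linear_tensor_inner(1) linear_form4_bivec(1) that])
  note simps = linear_add[OF linear_tensor_inner(2)] linear_diff[OF linear_tensor_inner(2)]
    linear_scale[OF linear_tensor_inner(2)] linear_neg[OF linear_tensor_inner(2)]
    linear_add[OF linear_form4_bivec(2)] linear_diff[OF linear_form4_bivec(2)]
    tensor_inner_wedge_outer[OF h] form4_bivec_wedge_outer[OF alternating_cayley]
  note S = cayley_frame_self_dual[OF frame]
  have "form4_sharp h cayley (wedge e1 e2 + wedge e3 e4)
      = (1/2) *\<^sub>R (wedge e1 e2 + wedge e3 e4) + (wedge n1 n2 + wedge n3 n4)"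
    by (rule sharp) (use S(1) in \<open>simp add: simps flip: add_divide_distrib\<close>)
  then show "bivec_map (wedge e1 e2 + wedge e3 e4) = wedge n1 n2 + wedge n3 n4"
    by (simp add: bivec_map_def)
  have "form4_sharp h cayley (wedge e1 e3 - wedge e2 e4)
      = (1/2) *\<^sub>R (wedge e1 e3 - wedge e2 e4) + (wedge n1 n3 - wedge n2 n4)"
    by (rule sharp) (use S(2) in \<open>simp add: simps flip: diff_divide_distrib\<close>)
  then show "bivec_map (wedge e1 e3 - wedge e2 e4) = wedge n1 n3 - wedge n2 n4"
    by (simp add: bivec_map_def)
  have "form4_sharp h cayley (wedge e1 e4 + wedge e2 e3)
      = (1/2) *\<^sub>R (wedge e1 e4 + wedge e2 e3) - (wedge n1 n4 + wedge n2 n3)"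
    by (rule sharp) (use S(3) in \<open>simp add: simps flip: add_divide_distrib\<close>)
  then show "bivec_map (wedge e1 e4 + wedge e2 e3) = - (wedge n1 n4 + wedge n2 n3)"
    by (simp add: bivec_map_def)
qed

lemma bivec_inner_frame:
  assumes "orthonormal h [e1, e2, e3, e4]"
  shows "bivec_inner h (a *\<^sub>R (wedge e1 e2 + wedge e3 e4) + b *\<^sub>R (wedge e1 e3 - wedge e2 e4)
        + c *\<^sub>R (wedge e1 e4 + wedge e2 e3))
      (a' *\<^sub>R (wedge e1 e2 + wedge e3 e4) + b' *\<^sub>R (wedge e1 e3 - wedge e2 e4)
        + c' *\<^sub>R (wedge e1 e4 + wedge e2 e3)) = 2 * (a * a' + b * b' + c * c')"
  using assms unfolding orthonormal_4
  by (simp add: linear_add[OF linear_bivec_inner(1)] linear_add[OF linear_bivec_inner(2)]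
      linear_diff[OF linear_bivec_inner(1)] linear_diff[OF linear_bivec_inner(2)]
      linear_scale[OF linear_bivec_inner(1)] linear_scale[OF linear_bivec_inner(2)]
      bivec_inner_wedge inner_product_formD(1)[OF h] algebra_simps)

definition sd_span :: "real^8 \<Rightarrow> real^8 \<Rightarrow> real^8 \<Rightarrow> real^8 \<Rightarrow> (real^8^8) set" where
  "sd_span e1 e2 e3 e4 =
     span {wedge e1 e2 + wedge e3 e4, wedge e1 e3 - wedge e2 e4, wedge e1 e4 + wedge e2 e3}"

lemma bivec_map_combination:
  assumes "cayley_frame e1 e2 e3 e4 n1 n2 n3 n4"
  shows "bivec_map (r *\<^sub>R (wedge e1 e2 + wedge e3 e4) + s *\<^sub>R (wedge e1 e3 - wedge e2 e4)
        + t *\<^sub>R (wedge e1 e4 + wedge e2 e3))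
      = r *\<^sub>R (wedge n1 n2 + wedge n3 n4) + s *\<^sub>R (wedge n1 n3 - wedge n2 n4)
        + (- t) *\<^sub>R (wedge n1 n4 + wedge n2 n3)"
proof -
  have "bivec_map (r *\<^sub>R X + s *\<^sub>R Y + t *\<^sub>R Z)
      = r *\<^sub>R bivec_map X + s *\<^sub>R bivec_map Y + t *\<^sub>R bivec_map Z" for X Y Z
    using linear_bivec_map by (simp add: linear_iff)
  then show ?thesis
    by (simp only: bivec_map_frame[OF assms] scaleR_minus_right scaleR_minus_left)
qed

text \<open>In the self-dual bases the map is diagonal with entries 1, 1, -1, and so is the map
  back, which makes it an involution. Both bases are orthogonal with equal norms, which makes it
  isometric.\<close>

lemma bivec_map_sd_span:
  assumes frame: "cayley_frame e1 e2 e3 e4 n1 n2 n3 n4" and A: "A \<in> sd_span e1 e2 e3 e4"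
  shows "bivec_map A \<in> sd_span n1 n2 n3 n4" "bivec_map (bivec_map A) = A"
    and "B \<in> sd_span e1 e2 e3 e4 \<Longrightarrow> bivec_inner h (bivec_map A) (bivec_map B) = bivec_inner h A B"
proof -
  have on: "orthonormal h [e1, e2, e3, e4]" "orthonormal h [n1, n2, n3, n4]"
    using frame cayley_frame_commute[OF frame]
    unfolding cayley_frame_def orthonormal_8 forall_8 vector_8 orthonormal_4 by simp_all
  note map = bivec_map_combination[OF frame]
  obtain r s t where A': "A = r *\<^sub>R (wedge e1 e2 + wedge e3 e4) + s *\<^sub>R (wedge e1 e3 - wedge e2 e4)
        + t *\<^sub>R (wedge e1 e4 + wedge e2 e3)"
    using A unfolding sd_span_def by (rule span_3)
  show "bivec_map A \<in> sd_span n1 n2 n3 n4"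
    unfolding A' map sd_span_def by (intro span_add span_scale span_base) auto
  show "bivec_map (bivec_map A) = A"
    unfolding A' map bivec_map_combination[OF cayley_frame_commute[OF frame]] minus_minus ..
  show "bivec_inner h (bivec_map A) (bivec_map B) = bivec_inner h A B" if B: "B \<in> sd_span e1 e2 e3 e4"
  proof -
    obtain r' s' t' where B': "B = r' *\<^sub>R (wedge e1 e2 + wedge e3 e4)
        + s' *\<^sub>R (wedge e1 e3 - wedge e2 e4) + t' *\<^sub>R (wedge e1 e4 + wedge e2 e3)"
      using B unfolding sd_span_def by (rule span_3)
    show ?thesis
      unfolding A' B' map bivec_inner_frame[OF on(1)] bivec_inner_frame[OF on(2)] by simp
  qed
qed

lemma bivec_map_bij_betw:
  assumes "cayley_frame e1 e2 e3 e4 n1 n2 n3 n4"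
  shows "bij_betw bivec_map (sd_span e1 e2 e3 e4) (sd_span n1 n2 n3 n4)"
  by (rule bij_betw_byWitness[where f' = bivec_map])
    (use bivec_map_sd_span[OF assms] bivec_map_sd_span[OF cayley_frame_commute[OF assms]] in auto)

text \<open>\<open>form4_sharp\<close> has the required pairing with every tensor, and subtracting
  \<open>A / 2\<close> does not change it here because tangential and normal bivectors are
  orthogonal.\<close>

lemma tensor_inner_bivec_map:
  assumes frame: "cayley_frame e1 e2 e3 e4 n1 n2 n3 n4"
    and A: "A \<in> sd_span e1 e2 e3 e4" and B: "B \<in> sd_span n1 n2 n3 n4"
  shows "tensor_inner h (bivec_map A) B = form4_bivec cayley A B"
proof -
  have on: "orthonormal h [e1, e2, e3, e4, n1, n2, n3, n4]"
    using frame by (simp add: cayley_frame_def)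
  have zero: "tensor_inner h (wedge a b) (wedge c d) = 0"
    if "a \<in> {e1, e2, e3, e4}" "b \<in> {e1, e2, e3, e4}" "c \<in> {n1, n2, n3, n4}" "d \<in> {n1, n2, n3, n4}"
    for a b c d
  proof -
    have "h a c = 0" "h a d = 0"
      using that orthonormal_8_D[OF on] by auto
    then show ?thesis
      using bivec_inner_wedge[OF inner_product_formD(1)[OF h], of a b c d] by (simp add: bivec_inner_def)
  qed
  obtain r s t where A: "A = r *\<^sub>R (wedge e1 e2 + wedge e3 e4) + s *\<^sub>R (wedge e1 e3 - wedge e2 e4)
        + t *\<^sub>R (wedge e1 e4 + wedge e2 e3)"
    using A unfolding sd_span_def by (rule span_3)
  obtain r' s' t' where B: "B = r' *\<^sub>R (wedge n1 n2 + wedge n3 n4)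
      + s' *\<^sub>R (wedge n1 n3 - wedge n2 n4) + t' *\<^sub>R (wedge n1 n4 + wedge n2 n3)"
    using B unfolding sd_span_def by (rule span_3)
  have "tensor_inner h A B = 0"
    unfolding A B
    by (simp add: linear_add[OF linear_tensor_inner(1)] linear_add[OF linear_tensor_inner(2)]
      linear_diff[OF linear_tensor_inner(1)] linear_diff[OF linear_tensor_inner(2)]
      linear_scale[OF linear_tensor_inner(1)] linear_scale[OF linear_tensor_inner(2)] zero)
  then show ?thesis
    by (simp add: bivec_map_def linear_diff[OF linear_tensor_inner(2)]
        linear_scale[OF linear_tensor_inner(2)] tensor_inner_sharp[OF h])
qed

text \<open>The difference of two solutions is itself a self-dual bivector of the normal half and
  pairs to zero with itself, so positivity makes it vanish.\<close>

lemma bivec_map_unique: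
  assumes frame: "cayley_frame e1 e2 e3 e4 n1 n2 n3 n4" and A: "A \<in> sd_span e1 e2 e3 e4"
    and B: "B \<in> sd_span n1 n2 n3 n4"
    and "\<And>B'. B' \<in> sd_span n1 n2 n3 n4 \<Longrightarrow> tensor_inner h B B' = form4_bivec cayley A B'"
  shows "B = bivec_map A"
proof -
  have C: "B - bivec_map A \<in> sd_span n1 n2 n3 n4"
    using B bivec_map_sd_span(1)[OF frame A] unfolding sd_span_def by (rule span_diff)
  have "tensor_inner h (B - bivec_map A) (B - bivec_map A) = 0"
    using assms(4)[OF C] tensor_inner_bivec_map[OF frame A C]
    by (simp only: linear_diff[OF linear_tensor_inner(2)])
  then have zero: "bivec_inner h (B - bivec_map A) (B - bivec_map A) = 0"
    by (simp add: bivec_inner_def)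
  obtain r s t where D: "B - bivec_map A = r *\<^sub>R (wedge n1 n2 + wedge n3 n4)
      + s *\<^sub>R (wedge n1 n3 - wedge n2 n4) + t *\<^sub>R (wedge n1 n4 + wedge n2 n3)"
    using C unfolding sd_span_def by (rule span_3)
  have "orthonormal h [n1, n2, n3, n4]"
    using cayley_frame_commute[OF frame]
    unfolding cayley_frame_def orthonormal_8 forall_8 vector_8 orthonormal_4 by simp
  from bivec_inner_frame[OF this] have "r * r + s * s + t * t = 0"
    using zero unfolding D by simp
  then have "r = 0" "s = 0" "t = 0"
    by (smt (verit) mult_eq_0_iff zero_le_square)+
  then show ?thesis
    using D by simp
qed

end

section \<open>Tangent and normal spaces\<close>

lemma linear_det_row: "linear (\<lambda>x. det (\<chi> i. if i = k then x else r $ i :: real^'n^'n))"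
proof (rule linearI)
  fix x y :: "real^'n" and c
  show "det (\<chi> i. if i = k then x + y else r $ i)
      = det (\<chi> i. if i = k then x else r $ i) + det (\<chi> i. if i = k then y else r $ i)"
    by (rule det_row_add)
  show "det (\<chi> i. if i = k then c *\<^sub>R x else r $ i) = c *\<^sub>R det (\<chi> i. if i = k then x else r $ i)"
    using det_row_mul[of k c "\<lambda>_. x" "($) r"] unfolding scalar_mult_eq_scaleR by simp
qed

lemma linear_det_rowI:
  assumes "\<And>x. F x = (\<chi> i. if i = k then x else F 0 $ i :: real^'n^'n)"
  shows "linear (\<lambda>x. det (F x))"
  using linear_det_row[of k "F 0"] by (subst assms)

lemma alternating4_det_4: "alternating4 (\<lambda>a b c d. det (vector [a, b, c, d] :: real^4^4))"
  unfolding alternating4_def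
proof (intro conjI allI)
  fix a b c :: "real^4"
  show "linear (\<lambda>x. det (vector [x, a, b, c] :: real^4^4))"
    by (rule linear_det_rowI[of _ 1]) (simp add: vec_eq_iff[where 'b = 4] forall_4 vector_4)
  show "linear (\<lambda>x. det (vector [a, x, b, c] :: real^4^4))"
    by (rule linear_det_rowI[of _ 2]) (simp add: vec_eq_iff[where 'b = 4] forall_4 vector_4)
  show "linear (\<lambda>x. det (vector [a, b, x, c] :: real^4^4))"
    by (rule linear_det_rowI[of _ 3]) (simp add: vec_eq_iff[where 'b = 4] forall_4 vector_4)
  show "linear (\<lambda>x. det (vector [a, b, c, x] :: real^4^4))"
    by (rule linear_det_rowI[of _ 4]) (simp add: vec_eq_iff[where 'b = 4] forall_4 vector_4)
  show "det (vector [a, a, b, c] :: real^4^4) = 0"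
    by (rule det_identical_rows[of 1 2]) (simp_all add: row_def vector_4)
  show "det (vector [b, a, a, c] :: real^4^4) = 0"
    by (rule det_identical_rows[of 2 3]) (simp_all add: row_def vector_4)
  show "det (vector [b, c, a, a] :: real^4^4) = 0"
    by (rule det_identical_rows[of 3 4]) (simp_all add: row_def vector_4)
qed

text \<open>With four rows frozen, the determinant is an alternating 4-form in the others, so it can
  be compared with the Cayley form on the tangent and on the normal space separately.\<close>

lemma alternating4_det_8:
  "alternating4 (\<lambda>a b c d. det (vector [a, b, c, d, p, q, r, s] :: real^8^8))"
  "alternating4 (\<lambda>a b c d. det (vector [p, q, r, s, a, b, c, d] :: real^8^8))"
proof -
  note simps = vec_eq_iff[where 'b = 8] forall_8 vector_8
  show "alternating4 (\<lambda>a b c d. det (vector [a, b, c, d, p, q, r, s] :: real^8^8))"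
    unfolding alternating4_def
  proof (intro conjI allI)
    fix a b c :: "real^8"
    show "linear (\<lambda>x. det (vector [x, a, b, c, p, q, r, s] :: real^8^8))"
      by (rule linear_det_rowI[of _ 1]) (simp add: simps)
    show "linear (\<lambda>x. det (vector [a, x, b, c, p, q, r, s] :: real^8^8))"
      by (rule linear_det_rowI[of _ 2]) (simp add: simps)
    show "linear (\<lambda>x. det (vector [a, b, x, c, p, q, r, s] :: real^8^8))"
      by (rule linear_det_rowI[of _ 3]) (simp add: simps)
    show "linear (\<lambda>x. det (vector [a, b, c, x, p, q, r, s] :: real^8^8))"
      by (rule linear_det_rowI[of _ 4]) (simp add: simps)
    show "det (vector [a, a, b, c, p, q, r, s] :: real^8^8) = 0"
      by (rule det_identical_rows[of 1 2]) (simp_all add: row_def vector_8)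
    show "det (vector [b, a, a, c, p, q, r, s] :: real^8^8) = 0"
      by (rule det_identical_rows[of 2 3]) (simp_all add: row_def vector_8)
    show "det (vector [b, c, a, a, p, q, r, s] :: real^8^8) = 0"
      by (rule det_identical_rows[of 3 4]) (simp_all add: row_def vector_8)
  qed
  show "alternating4 (\<lambda>a b c d. det (vector [p, q, r, s, a, b, c, d] :: real^8^8))"
    unfolding alternating4_def
  proof (intro conjI allI)
    fix a b c :: "real^8"
    show "linear (\<lambda>x. det (vector [p, q, r, s, x, a, b, c] :: real^8^8))"
      by (rule linear_det_rowI[of _ 5]) (simp add: simps)
    show "linear (\<lambda>x. det (vector [p, q, r, s, a, x, b, c] :: real^8^8))"
      by (rule linear_det_rowI[of _ 6]) (simp add: simps)
    show "linear (\<lambda>x. det (vector [p, q, r, s, a, b, x, c] :: real^8^8))"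
      by (rule linear_det_rowI[of _ 7]) (simp add: simps)
    show "linear (\<lambda>x. det (vector [p, q, r, s, a, b, c, x] :: real^8^8))"
      by (rule linear_det_rowI[of _ 8]) (simp add: simps)
    show "det (vector [p, q, r, s, a, a, b, c] :: real^8^8) = 0"
      by (rule det_identical_rows[of 5 6]) (simp_all add: row_def vector_8)
    show "det (vector [p, q, r, s, b, a, a, c] :: real^8^8) = 0"
      by (rule det_identical_rows[of 6 7]) (simp_all add: row_def vector_8)
    show "det (vector [p, q, r, s, b, c, a, a] :: real^8^8) = 0"
      by (rule det_identical_rows[of 7 8]) (simp_all add: row_def vector_8)
  qed
qed

lemma alternating4_pullback:
  assumes "alternating4 \<Phi>" "linear d"
  shows "alternating4 (\<lambda>a b c e. \<Phi> (d a) (d b) (d c) (d e))"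
  using assms unfolding alternating4_def linear_iff by simp

lemma ex_orthonormal:
  fixes k :: "'a::euclidean_space \<Rightarrow> 'a \<Rightarrow> real"
  assumes "inner_product_form k" "n \<le> DIM('a)"
  shows "\<exists>xs. length xs = n \<and> orthonormal k xs"
  using assms(2)
proof (induction n)
  case 0
  then show ?case
    by (simp add: orthonormal_def)
next
  case (Suc n)
  then obtain xs where xs: "length xs = n" "orthonormal k xs"
    by auto
  have k1: "linear (\<lambda>x. k x y)" and k2: "linear (k y)" for y
    using inner_product_formD(1)[OF assms(1)] by (simp_all add: bilinear_def)
  have "dim (set xs) \<le> card (set xs)"
    by (rule dim_le_card') simp
  also have "\<dots> < DIM('a)"
    using card_length[of xs] xs(1) Suc.prems by linarith
  finally have "span (set xs) \<noteq> UNIV"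
    using dim_span[of "set xs"] by (metis dim_UNIV less_irrefl)
  then obtain y where y: "y \<notin> span (set xs)"
    by blast
  define r where "r = y - (\<Sum>i<n. k y (xs!i) *\<^sub>R xs!i)"
  have "(\<Sum>i<n. k y (xs!i) *\<^sub>R xs!i) \<in> span (set xs)"
    using xs(1) by (intro span_sum span_scale span_base) simp
  then have "r \<noteq> 0"
    using y by (auto simp: r_def)
  then have pos: "k r r > 0"
    using assms(1) by (simp add: inner_product_form_def)
  have orth: "k r (xs!j) = 0" if j: "j < n" for j
  proof -
    have "(\<Sum>i<n. k y (xs!i) * k (xs!i) (xs!j)) = (\<Sum>i<n. if i = j then k y (xs!i) else 0)"
      using xs j by (intro sum.cong) (auto simp: orthonormal_def)
    also have "\<dots> = k y (xs!j)"
      using j by simp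
    finally show ?thesis
      by (simp add: r_def linear_diff[OF k1] linear_sum[OF k1] linear_scale[OF k1])
  qed
  define w where "w = r /\<^sub>R sqrt (k r r)"
  have w: "k w (xs!j) = 0" "k (xs!j) w = 0" if "j < n" for j
    using orth[OF that] inner_product_formD(2)[OF assms(1), of "xs!j" r]
    by (simp_all add: w_def linear_scale[OF k1] linear_scale[OF k2])
  have ww: "k w w = 1"
    using pos by (simp add: w_def linear_scale[OF k1] linear_scale[OF k2] field_simps)
  have "orthonormal k (xs @ [w])"
    unfolding orthonormal_def
    using xs w ww by (auto simp: nth_append orthonormal_def less_Suc_eq)
  then show ?case
    using xs(1) by (intro exI[of _ "xs @ [w]"]) simp
qed

context calabi_yau_space
begin

text \<open>Pulled back along \<open>d\<close>, the Cayley form is a multiple of the determinant on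
  \<real>^4, and calibration makes the factor positive. Direct bases are thus the orthonormal bases
  on which the form is positive.\<close>

lemma cayley_tangent_frames:
  fixes d :: "real^4 \<Rightarrow> real^8"
  defines "D \<equiv> {(e1, e2, e3, e4). orthonormal h [e1, e2, e3, e4] \<and>
      (\<exists>b1 b2 b3 b4. det (vector [b1, b2, b3, b4] :: real^4^4) > 0 \<and>
         [e1, e2, e3, e4] = map d [b1, b2, b3, b4])}"
  assumes d: "linear d" "inj d"
    and calibrated: "\<And>e1 e2 e3 e4. (e1, e2, e3, e4) \<in> D \<Longrightarrow> cayley e1 e2 e3 e4 = 1"
  shows "D \<noteq> {}" "D = oriented_bases h (range d) cayley"
proof -
  define k where "k x y = h (d x) (d y)" for x y
  have k: "inner_product_form k"
  proof -
    have "d u \<noteq> 0" if "u \<noteq> 0" for u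
      using that d(2) linear_0[OF d(1)] by (metis injD)
    then have "k u u > 0" if "u \<noteq> 0" for u
      using h that by (simp add: inner_product_form_def k_def)
    moreover have "bilinear k"
      using d(1) unfolding bilinear_def linear_iff k_def by (simp add: h_simps)
    ultimately show ?thesis
      by (simp add: inner_product_form_def k_def h_commute)
  qed
  have span: "b \<in> span {x1, x2, x3, x4}" if on: "orthonormal k [x1, x2, x3, x4]" for x1 x2 x3 x4 b
    using orthonormal_expand(2)[OF inner_product_formD(1)[OF k] on, of UNIV b] by simp
  obtain xs where "length xs = 4" "orthonormal k xs"
    using ex_orthonormal[OF k, of 4] by auto
  then obtain x1 x2 x3 x4 where x: "orthonormal k [x1, x2, x3, x4]"
    by (auto simp: numeral_eq_Suc length_Suc_conv)
  have "det (vector [x1, x2, x3, x4] :: real^4^4) \<noteq> 0"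
  proof
    assume zero: "det (vector [x1, x2, x3, x4] :: real^4^4) = 0"
    have "det (vector [axis 1 1, axis 2 1, axis 3 1, axis 4 1] :: real^4^4) = 0"
      by (rule alternating4_span_eq_0[OF alternating4_det_4 zero]) (use span[OF x] in simp)
    moreover have "(vector [axis 1 1, axis 2 1, axis 3 1, axis 4 1] :: real^4^4) = mat 1"
      by (simp add: vec_eq_iff[where 'b = 4] forall_4 vector_4 axis_def mat_def)
    ultimately show False
      by simp
  qed
  \<comment> \<open>Exchanging two vectors reverses the sign, so a basis orthonormal for the pulled
    back metric can be made direct.\<close>
  then consider "det (vector [x1, x2, x3, x4] :: real^4^4) > 0"
    | "det (vector [x2, x1, x3, x4] :: real^4^4) > 0"
    using alternating4_swap(1)[OF alternating4_det_4, of x2 x1 x3 x4] by linarith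
  then obtain b1 b2 b3 b4 where b: "det (vector [b1, b2, b3, b4] :: real^4^4) > 0"
    "orthonormal k [b1, b2, b3, b4]"
  proof cases
    case 1
    then show ?thesis
      using that x by blast
  next
    case 2
    then show ?thesis
      using that[of x2 x1 x3 x4] x by (simp add: orthonormal_4)
  qed
  have "(d b1, d b2, d b3, d b4) \<in> D"
    using b by (auto simp: D_def orthonormal_4 k_def)
  then show "D \<noteq> {}"
    by blast
  have pos: "det (vector [c1, c2, c3, c4] :: real^4^4) > 0"
    if "cayley (d c1) (d c2) (d c3) (d c4) > 0" for c1 c2 c3 c4
  proof -
    have "cayley (d b1) (d b2) (d b3) (d b4) = 1"
      using calibrated \<open>(d b1, d b2, d b3, d b4) \<in> D\<close> by blast
    moreover have "{c1, c2, c3, c4} \<subseteq> span {b1, b2, b3, b4}"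
      using span[OF b(2)] by blast
    ultimately have "cayley (d c1) (d c2) (d c3) (d c4) * det (vector [b1, b2, b3, b4] :: real^4^4)
        = det (vector [c1, c2, c3, c4] :: real^4^4)"
      using alternating4_proportional[OF alternating4_pullback[OF alternating_cayley d(1)]
          alternating4_det_4, of c1 c2 c3 c4 b1 b2 b3 b4] by simp
    then show ?thesis
      using mult_pos_pos[OF that b(1)] by simp
  qed
  show "D = oriented_bases h (range d) cayley"
  proof (intro subset_antisym subsetI)
    fix e
    assume e: "e \<in> D"
    obtain e1 e2 e3 e4 where "e = (e1, e2, e3, e4)"
      by (cases e)
    then show "e \<in> oriented_bases h (range d) cayley"
      using calibrated[of e1 e2 e3 e4] e unfolding D_def oriented_bases_def by auto
  next
    fix e
    assume e: "e \<in> oriented_bases h (range d) cayley"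
    obtain e1 e2 e3 e4 where e': "e = (e1, e2, e3, e4)"
      by (cases e)
    then obtain c1 c2 c3 c4 where c: "e1 = d c1" "e2 = d c2" "e3 = d c3" "e4 = d c4"
      using e by (auto simp: oriented_bases_def)
    have "cayley (d c1) (d c2) (d c3) (d c4) > 0" and on: "orthonormal h [e1, e2, e3, e4]"
      using e by (simp_all add: oriented_bases_def e' c)
    from pos[OF this(1)] have "\<exists>b1 b2 b3 b4. det (vector [b1, b2, b3, b4] :: real^4^4) > 0
        \<and> [e1, e2, e3, e4] = map d [b1, b2, b3, b4]"
      unfolding c by (intro exI[of _ c1] exI[of _ c2] exI[of _ c3] exI[of _ c4]) simp
    with on show "e \<in> D"
      by (simp add: D_def e')
  qed
qed

lemma cayley_normal_frames:
  fixes d :: "real^4 \<Rightarrow> real^8"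
  assumes frame: "cayley_frame e1 e2 e3 e4 n1 n2 n3 n4"
    and det: "det (vector [e1, e2, e3, e4, n1, n2, n3, n4] :: real^8^8) > 0"
    and e: "(e1, e2, e3, e4) \<in> D" and D: "D = oriented_bases h V cayley" and V: "subspace V" "dim V \<le> 4"
    and calibrated: "\<And>e1 e2 e3 e4. (e1, e2, e3, e4) \<in> D \<Longrightarrow> cayley e1 e2 e3 e4 = 1"
  defines "N \<equiv> {n. \<forall>v\<in>V. h n v = 0}"
  shows "V = span {e1, e2, e3, e4}" "N = span {n1, n2, n3, n4}"
    and "(n1, n2, n3, n4) \<in> oriented_bases h N cayley"
    and "{(x1, x2, x3, x4). orthonormal h [x1, x2, x3, x4] \<and> {x1, x2, x3, x4} \<subseteq> N \<and>
        (\<exists>(e1, e2, e3, e4)\<in>D. det (vector [e1, e2, e3, e4, x1, x2, x3, x4] :: real^8^8) > 0)}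
      = oriented_bases h N cayley"
proof -
  have on: "orthonormal h [e1, e2, e3, e4, n1, n2, n3, n4]" and one: "cayley n1 n2 n3 n4 = 1"
      "cayley e1 e2 e3 e4 = 1"
    using frame by (simp_all add: cayley_frame_def)
  have eV: "orthonormal h [e1, e2, e3, e4]" "{e1, e2, e3, e4} \<subseteq> V"
    using e D by (simp_all add: oriented_bases_def)
  show VE: "V = span {e1, e2, e3, e4}"
    using orthonormal_expand(2)[OF inner_product_formD(1)[OF h] eV(1), of V] eV(2) V(2)
      span_minimal[OF eV(2) V(1)] by auto
  have n0: "h n e = 0" if "n \<in> {n1, n2, n3, n4}" "e \<in> {e1, e2, e3, e4}" for n e
    using that orthonormal_8_D[OF on] by auto
  have nN: "{n1, n2, n3, n4} \<subseteq> N"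
  proof
    fix n
    assume n: "n \<in> {n1, n2, n3, n4}"
    have "h n v = 0" if "v \<in> span {e1, e2, e3, e4}" for v
      by (rule linear_eq_0_on_span[OF h_linear(2) n0[OF n] that])
    then show "n \<in> N"
      by (simp add: N_def VE)
  qed
  show NE: "N = span {n1, n2, n3, n4}"
  proof (intro subset_antisym subsetI)
    fix n
    assume "n \<in> N"
    then have zero: "h n e1 = 0" "h n e2 = 0" "h n e3 = 0" "h n e4 = 0"
      using eV(2) by (auto simp: N_def)
    have "n = (\<Sum>i<length [e1, e2, e3, e4, n1, n2, n3, n4].
        h n ([e1, e2, e3, e4, n1, n2, n3, n4] ! i) *\<^sub>R [e1, e2, e3, e4, n1, n2, n3, n4] ! i)"
      by (rule orthonormal_expand[OF inner_product_formD(1)[OF h] on, of UNIV]) simp_all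
    then have "n = h n n1 *\<^sub>R n1 + h n n2 *\<^sub>R n2 + h n n3 *\<^sub>R n3 + h n n4 *\<^sub>R n4"
      by (simp add: numeral_eq_Suc lessThan_Suc add_ac zero)
    also have "\<dots> \<in> span {n1, n2, n3, n4}"
      by (intro span_add span_scale span_base) auto
    finally show "n \<in> span {n1, n2, n3, n4}" .
  next
    fix n
    assume "n \<in> span {n1, n2, n3, n4}"
    moreover have "subspace N"
      unfolding subspace_def N_def by (simp add: h_simps linear_0[OF h_linear(1)])
    ultimately show "n \<in> N"
      using span_minimal[OF nN] by blast
  qed
  show "(n1, n2, n3, n4) \<in> oriented_bases h N cayley"
    using nN one(1) orthonormal_8_D[OF on] by (simp add: oriented_bases_def orthonormal_4)
  \<comment> \<open>Two comparisons of alternating forms: the tangent rows may be replaced by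
    \<open>e1, e2, e3, e4\<close>, since \<Omega> is 1 on both bases; the determinant is then
    \<Omega> of the normal rows times the positive determinant of the frame.\<close>
  have sign: "det (vector [a1, a2, a3, a4, x1, x2, x3, x4] :: real^8^8) > 0 \<longleftrightarrow> cayley x1 x2 x3 x4 > 0"
    if a: "(a1, a2, a3, a4) \<in> D" and x: "{x1, x2, x3, x4} \<subseteq> N" for a1 a2 a3 a4 x1 x2 x3 x4
  proof -
    have "{a1, a2, a3, a4} \<subseteq> span {e1, e2, e3, e4}"
      using a unfolding D VE by (simp add: oriented_bases_def)
    then have "det (vector [a1, a2, a3, a4, x1, x2, x3, x4] :: real^8^8)
        = det (vector [e1, e2, e3, e4, x1, x2, x3, x4] :: real^8^8)"
      using alternating4_proportional[OF alternating4_det_8(1) alternating_cayley,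
          of a1 a2 a3 a4 e1 e2 e3 e4 x1 x2 x3 x4] calibrated[OF a] one(2) by simp
    also have "\<dots> = cayley x1 x2 x3 x4 * det (vector [e1, e2, e3, e4, n1, n2, n3, n4] :: real^8^8)"
      using alternating4_proportional[OF alternating4_det_8(2) alternating_cayley,
          of x1 x2 x3 x4 n1 n2 n3 n4 e1 e2 e3 e4] x one(1) by (simp add: NE)
    finally show ?thesis
      using det by (simp add: zero_less_mult_iff)
  qed
  show "{(x1, x2, x3, x4). orthonormal h [x1, x2, x3, x4] \<and> {x1, x2, x3, x4} \<subseteq> N \<and>
        (\<exists>(e1, e2, e3, e4)\<in>D. det (vector [e1, e2, e3, e4, x1, x2, x3, x4] :: real^8^8) > 0)}
      = oriented_bases h N cayley"
  proof -
    have "(\<exists>(a1, a2, a3, a4)\<in>D. det (vector [a1, a2, a3, a4, x1, x2, x3, x4] :: real^8^8) > 0)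
        \<longleftrightarrow> cayley x1 x2 x3 x4 > 0" if "{x1, x2, x3, x4} \<subseteq> N" for x1 x2 x3 x4
    proof
      assume "\<exists>(a1, a2, a3, a4)\<in>D. det (vector [a1, a2, a3, a4, x1, x2, x3, x4] :: real^8^8) > 0"
      then obtain a1 a2 a3 a4 where "(a1, a2, a3, a4) \<in> D"
        "det (vector [a1, a2, a3, a4, x1, x2, x3, x4] :: real^8^8) > 0"
        by blast
      then show "cayley x1 x2 x3 x4 > 0"
        using sign[OF _ that] by simp
    next
      assume "cayley x1 x2 x3 x4 > 0"
      then show "\<exists>(a1, a2, a3, a4)\<in>D. det (vector [a1, a2, a3, a4, x1, x2, x3, x4] :: real^8^8) > 0"
        using sign[OF e that] by (intro bexI[OF _ e]) simp
    qed
    note key = this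
    show ?thesis
    proof (rule set_eqI)
      fix x :: "(real^8) \<times> (real^8) \<times> (real^8) \<times> (real^8)"
      obtain x1 x2 x3 x4 where x: "x = (x1, x2, x3, x4)"
        by (cases x)
      show "x \<in> {(x1, x2, x3, x4). orthonormal h [x1, x2, x3, x4] \<and> {x1, x2, x3, x4} \<subseteq> N \<and>
          (\<exists>(e1, e2, e3, e4)\<in>D. det (vector [e1, e2, e3, e4, x1, x2, x3, x4] :: real^8^8) > 0)}
        \<longleftrightarrow> x \<in> oriented_bases h N cayley"
        using key[of x1 x2 x3 x4] unfolding oriented_bases_def x mem_Collect_eq prod.case by argo
    qed
  qed
qed

end

section \<open>Charts\<close>

lemma chart_at:
  assumes "smooth_atlas \<A>"
  shows "chart_at \<A> p \<in> \<A>" "p \<in> fst (chart_at \<A> p)"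
proof -
  have "p \<in> (\<Union>c\<in>\<A>. fst c)"
    using assms by (simp add: smooth_atlas_def)
  then have "\<exists>c. c \<in> \<A> \<and> p \<in> fst c"
    by blast
  from someI_ex[OF this] show "chart_at \<A> p \<in> \<A>" "p \<in> fst (chart_at \<A> p)"
    by (simp_all add: chart_at_def)
qed

lemma chart_homeomorphism:
  assumes "smooth_atlas \<A>" "c \<in> \<A>"
  shows "homeomorphism (fst c) (snd c ` fst c) (snd c) (chart_inv c)" "open (snd c ` fst c)" "open (fst c)"
  using assms by (auto simp: smooth_atlas_def)

lemma chart_inv_cancel:
  assumes "smooth_atlas \<A>" "c \<in> \<A>" "p \<in> fst c"
  shows "chart_inv c (snd c p) = p"
  using chart_homeomorphism(1)[OF assms(1,2)] assms(3) by (simp add: homeomorphism_def)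

lemma open_chart_image:
  assumes "smooth_atlas \<A>" "c \<in> \<A>" "open U"
  shows "open (snd c ` (fst c \<inter> U))"
proof -
  have "openin (top_of_set (snd c ` fst c)) (snd c ` (fst c \<inter> U))"
    using assms(3)
    by (intro homeomorphism_imp_open_map[OF chart_homeomorphism(1)[OF assms(1,2)]]) auto
  then show ?thesis
    using chart_homeomorphism(2)[OF assms(1,2)] openin_open_trans by blast
qed

lemma transition_differentiable:
  assumes "smooth_atlas \<A>" "c \<in> \<A>" "d \<in> \<A>" "p \<in> fst c" "p \<in> fst d"
  shows "(transition c d has_derivative dir_deriv (transition c d) (snd c p)) (at (snd c p))"
proof -
  have "smooth_on (snd c ` (fst c \<inter> fst d)) (transition c d)"
    using assms(1-3) by (auto simp: smooth_atlas_def)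
  then have "transition c d differentiable (at (snd c p))"
    by (rule smooth_on_differentiable) (use assms(4,5) in auto)
  then show ?thesis
    unfolding dir_deriv_def[abs_def] by (simp add: frechet_derivative_works)
qed

lemma transition_derivative_inverse:
  assumes "smooth_atlas \<A>" "c \<in> \<A>" "d \<in> \<A>" "p \<in> fst c" "p \<in> fst d"
  shows "dir_deriv (transition d c) (snd d p) (dir_deriv (transition c d) (snd c p) v) = v"
proof -
  note cancel = chart_inv_cancel[OF assms(1)]
  let ?D = "\<lambda>v. dir_deriv (transition d c) (snd d p) (dir_deriv (transition c d) (snd c p) v)"
  have "transition c d (snd c p) = snd d p"
    using cancel[OF assms(2,4)] by (simp add: transition_def)
  with has_derivative_compose[OF transition_differentiable[OF assms]]
    transition_differentiable[OF assms(1,3,2,5,4)]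
  have "((\<lambda>x. transition d c (transition c d x)) has_derivative ?D) (at (snd c p))"
    by metis
  moreover have "((\<lambda>x. transition d c (transition c d x)) has_derivative (\<lambda>v. v)) (at (snd c p))"
  proof (rule has_derivative_transform_within_open[OF has_derivative_ident])
    show "open (snd c ` (fst c \<inter> fst d))"
      by (rule open_chart_image[OF assms(1,2) chart_homeomorphism(3)[OF assms(1,3)]])
    show "snd c p \<in> snd c ` (fst c \<inter> fst d)"
      using assms(4,5) by blast
    show "x = transition d c (transition c d x)" if x: "x \<in> snd c ` (fst c \<inter> fst d)" for x
      using x cancel[OF assms(2)] cancel[OF assms(3)] by (auto simp: transition_def)
  qed
  ultimately have "?D = (\<lambda>v. v)"
    by (rule has_derivative_unique)
  then show ?thesis
    by meson
qed

lemma chart_components: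
  assumes "smooth_atlas \<A>" "c \<in> \<A>" "p \<in> fst c"
  shows "linear (from_chart \<A> c p)" "linear (to_chart \<A> c p)"
    and "from_chart \<A> c p (to_chart \<A> c p v) = v" "to_chart \<A> c p (from_chart \<A> c p v) = v"
proof -
  note c = chart_at[OF assms(1), of p]
  show "linear (from_chart \<A> c p)"
    using has_derivative_linear[OF transition_differentiable[OF assms(1,2) c(1) assms(3) c(2)]]
    by (simp add: from_chart_def[abs_def])
  show "linear (to_chart \<A> c p)"
    using has_derivative_linear[OF transition_differentiable[OF assms(1) c(1) assms(2) c(2) assms(3)]]
    by (simp add: to_chart_def[abs_def])
  show "from_chart \<A> c p (to_chart \<A> c p v) = v"
    unfolding from_chart_def to_chart_def
    by (rule transition_derivative_inverse[OF assms(1) c(1) assms(2) c(2) assms(3)])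
  show "to_chart \<A> c p (from_chart \<A> c p v) = v"
    unfolding from_chart_def to_chart_def
    by (rule transition_derivative_inverse[OF assms(1,2) c(1) assms(3) c(2)])
qed

lemma differential_linear:
  assumes "smooth_atlas \<A>" "smooth_atlas \<B>" "immersion \<A> \<B> f"
  shows "linear (differential \<A> \<B> f p)"
proof -
  let ?c = "chart_at \<A> p" and ?d = "chart_at \<B> (f p)"
  have "smooth_on (snd ?c ` (fst ?c \<inter> f -` fst ?d)) (snd ?d \<circ> f \<circ> chart_inv ?c)"
    using assms(3) chart_at(1)[OF assms(1)] chart_at(1)[OF assms(2)] by (auto simp: immersion_def)
  then have "(snd ?d \<circ> f \<circ> chart_inv ?c) differentiable (at (snd ?c p))"
    by (rule smooth_on_differentiable)
      (use chart_at(2)[OF assms(1)] chart_at(2)[OF assms(2)] in auto)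
  then show ?thesis
    unfolding differential_def[abs_def] dir_deriv_def[abs_def] by (rule linear_frechet_derivative)
qed

lemma smooth_bivec_section_cong:
  assumes "smooth_atlas \<A>" "\<And>p. p \<in> W \<Longrightarrow> \<sigma> p = \<tau> p"
    and "open W" "smooth_atlas \<B>" "continuous_on UNIV f"
    and "smooth_bivec_section \<A> \<B> f W \<sigma>"
  shows "smooth_bivec_section \<A> \<B> f W \<tau>"
  unfolding smooth_bivec_section_def
proof (intro ballI)
  fix c d
  assume c: "c \<in> \<A>" and d: "d \<in> \<B>"
  have "open (snd c ` (fst c \<inter> (W \<inter> f -` fst d)))"
    using assms(3,5) chart_homeomorphism(3)[OF assms(4) d]
    by (intro open_chart_image[OF assms(1) c] open_Int open_vimage)
  then have "open (snd c ` (W \<inter> fst c \<inter> f -` fst d))"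
    by (simp add: Int_ac)
  then show "smooth_on (snd c ` (W \<inter> fst c \<inter> f -` fst d))
      (\<lambda>x. let p = chart_inv c x; T = matrix (to_chart \<B> d (f p)) in T ** \<tau> p ** transpose T)"
  proof (rule smooth_on_cong)
    show "smooth_on (snd c ` (W \<inter> fst c \<inter> f -` fst d))
        (\<lambda>x. let p = chart_inv c x; T = matrix (to_chart \<B> d (f p)) in T ** \<sigma> p ** transpose T)"
      using assms(6) c d by (auto simp: smooth_bivec_section_def)
    show "(let p = chart_inv c x; T = matrix (to_chart \<B> d (f p)) in T ** \<sigma> p ** transpose T)
        = (let p = chart_inv c x; T = matrix (to_chart \<B> d (f p)) in T ** \<tau> p ** transpose T)"
      if "x \<in> snd c ` (W \<inter> fst c \<inter> f -` fst d)" for x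
      using that assms(2) chart_inv_cancel[OF assms(1) c] by auto
  qed
qed

section \<open>The bundle map of a Calabi--Yau manifold\<close>

lemma calabi_yau_space:
  assumes "calabi_yau4 \<B> g \<rho>"
  shows "calabi_yau_space (g q) (\<rho> q)"
  using assms unfolding calabi_yau4_def kaehler_metric_def riemannian_metric_def
    holomorphic_volume_form_def calabi_yau_space_def by simp

lemma cayley_form_eq:
  assumes "calabi_yau4 \<B> g \<rho>"
  shows "cayley_form g \<rho> q = calabi_yau_space.cayley (g q) (\<rho> q)"
  by (intro ext) (simp add: cayley_form_def kaehler_form_def[abs_def]
      calabi_yau_space.cayley_def[OF calabi_yau_space[OF assms]])

text \<open>Holomorphy of the transition maps: the Kaehler form has in every chart the components
  obtained from those of the metric with the constant \<open>cJ\<close>.\<close>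

lemma from_chart_cJ:
  assumes "calabi_yau4 \<B> g \<rho>" "d \<in> \<B>" "q \<in> fst d"
  shows "from_chart \<B> d q (cJ v) = cJ (from_chart \<B> d q v)"
proof -
  have \<B>: "smooth_atlas \<B>" and "complex_atlas \<B>"
    using assms(1) by (auto simp: calabi_yau4_def complex_atlas_def)
  moreover have "snd d q \<in> snd d ` (fst d \<inter> fst (chart_at \<B> q))"
    using assms(3) chart_at(2)[OF \<B>] by blast
  ultimately show ?thesis
    using assms(2) chart_at(1)[OF \<B>, of q] unfolding complex_atlas_def from_chart_def by blast
qed

text \<open>In the fixed chart \<open>d\<close> the metric and the Cayley form have smooth
  components \<open>k\<close> and \<Phi> along \<open>f\<close>. Naturality of
  \<open>form4_sharp\<close> under the coordinate change \<open>T\<close> shows that the image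
  section has the components computed from \<open>k\<close>, \<Phi> and \<tau>, although
  \<open>T\<close> itself need not depend smoothly on the point.\<close>

lemma smooth_bivec_section_bivec_map:
  assumes cy: "calabi_yau4 \<B> g \<rho>" and \<A>: "smooth_atlas \<A>" and f: "immersion \<A> \<B> f"
    and W: "open W" and \<sigma>: "smooth_bivec_section \<A> \<B> f W \<sigma>"
  shows "smooth_bivec_section \<A> \<B> f W (\<lambda>p. calabi_yau_space.bivec_map (g (f p)) (\<rho> (f p)) (\<sigma> p))"
  unfolding smooth_bivec_section_def
proof (intro ballI)
  fix c d
  assume c: "c \<in> \<A>" and d: "d \<in> \<B>"
  have \<B>: "smooth_atlas \<B>"
    using cy by (simp add: calabi_yau4_def complex_atlas_def)
  define S where "S = snd c ` (W \<inter> fst c \<inter> f -` fst d)"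
  define y where "y = snd d \<circ> f \<circ> chart_inv c"
  define q where "q x = f (chart_inv c x)" for x
  define T where "T x = matrix (to_chart \<B> d (q x))" for x
  define R where "R x = matrix (from_chart \<B> d (q x))" for x
  define k where "k x u v = comp2 \<B> g d (y x) u v" for x u v
  define \<Phi> where "\<Phi> x u1 u2 u3 u4
      = (1/2) * wedge22 (\<lambda>u. k x (cJ u)) (\<lambda>u. k x (cJ u)) u1 u2 u3 u4
        + Re (comp4 \<B> \<rho> d (y x) u1 u2 u3 u4)" for x u1 u2 u3 u4
  define \<tau> where "\<tau> x = T x ** \<sigma> (chart_inv c x) ** transpose (T x)" for x
  have fc: "continuous_on UNIV f"
    using f by (simp add: immersion_def)
  have "open (snd c ` (fst c \<inter> (W \<inter> f -` fst d)))"
    using W fc chart_homeomorphism(3)[OF \<B> d]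
    by (intro open_chart_image[OF \<A> c] open_Int open_vimage)
  then have S: "open S"
    by (simp add: S_def Int_ac)
  have qd: "q x \<in> fst d" "y x \<in> snd d ` fst d" "chart_inv d (y x) = q x" if "x \<in> S" for x
    using that chart_inv_cancel[OF \<A> c] chart_inv_cancel[OF \<B> d] by (auto simp: S_def q_def y_def)
  have "smooth_on (snd c ` (fst c \<inter> f -` fst d)) y"
    using f c d by (simp add: immersion_def y_def)
  then have y: "smooth_on S y"
    by (rule smooth_on_subset) (auto simp: S_def)
  note compose = smooth_on_compose[OF S chart_homeomorphism(2)[OF \<B> d] _ y]
  have sub: "y ` S \<subseteq> snd d ` fst d"
    using qd(2) by blast
  have k: "smooth_on S (\<lambda>x. k x u v)" for u v
    unfolding k_def
    by (rule compose[OF sub]) (use cy d in \<open>simp add: calabi_yau4_def kaehler_metric_def riemannian_metric_def\<close>)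
  have "smooth_on S (\<lambda>x. comp4 \<B> \<rho> d (y x) u1 u2 u3 u4)" for u1 u2 u3 u4
    by (rule compose[OF sub]) (use cy d in \<open>simp add: calabi_yau4_def holomorphic_volume_form_def\<close>)
  then have \<Phi>: "smooth_on S (\<lambda>x. \<Phi> x u1 u2 u3 u4)" for u1 u2 u3 u4
    unfolding \<Phi>_def wedge22_def
    by (intro smooth_on_add smooth_on_mult smooth_on_diff smooth_on_const S k
        smooth_on_linear[OF S bounded_linear_Re])
  have \<tau>: "smooth_on S \<tau>"
    using \<sigma> c d by (simp add: smooth_bivec_section_def S_def \<tau>_def[abs_def] T_def q_def Let_def)
  have TR: "T x ** R x = mat 1" and Tv: "T x *v v = to_chart \<B> d (q x) v"
    and Rv: "R x *v v = from_chart \<B> d (q x) v" if "x \<in> S" for x v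
  proof -
    note comps = chart_components[OF \<B> d qd(1)[OF that]]
    show Tv: "T x *v v = to_chart \<B> d (q x) v" and Rv: "R x *v v = from_chart \<B> d (q x) v" for v
      using comps(1,2) by (simp_all add: T_def R_def matrix_works)
    show "T x ** R x = mat 1"
      by (simp add: matrix_eq Tv Rv comps(4) flip: matrix_vector_mul_assoc)
  qed
  have kx: "k x u v = g (q x) (from_chart \<B> d (q x) u) (from_chart \<B> d (q x) v)" if "x \<in> S" for x u v
    by (simp add: k_def comp2_def Let_def qd(3)[OF that])
  have \<Phi>x: "\<Phi> x u1 u2 u3 u4 = calabi_yau_space.cayley (g (q x)) (\<rho> (q x)) (from_chart \<B> d (q x) u1)
      (from_chart \<B> d (q x) u2) (from_chart \<B> d (q x) u3) (from_chart \<B> d (q x) u4)"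
    if "x \<in> S" for x u1 u2 u3 u4
    unfolding \<Phi>_def calabi_yau_space.cayley_def[OF calabi_yau_space[OF cy]] wedge22_def
      kx[OF that] from_chart_cJ[OF cy d qd(1)[OF that]]
    by (simp add: comp4_def Let_def qd(3)[OF that])
  have k_inner: "inner_product_form (k x)" if "x \<in> S" for x
  proof -
    note comps = chart_components[OF \<B> d qd(1)[OF that]]
    note h = calabi_yau_space.h[OF calabi_yau_space[OF cy, of "q x"]]
    have "bilinear (k x)"
      using inner_product_formD(1)[OF h] comps(1)
      unfolding bilinear_def linear_iff kx[OF that] by simp
    moreover have "k x u u > 0" if "u \<noteq> 0" for u
    proof -
      have "from_chart \<B> d (q x) u \<noteq> 0"
        using comps(4)[of u] linear_0[OF comps(2)] that by force
      then show ?thesis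
        using h by (simp add: kx[OF \<open>x \<in> S\<close>] inner_product_form_def)
    qed
    ultimately show ?thesis
      using inner_product_formD(2)[OF h] by (simp add: inner_product_form_def kx[OF that])
  qed
  have smooth: "smooth_on S (\<lambda>x. form4_sharp (k x) (\<Phi> x) (\<tau> x) - (1/2) *\<^sub>R \<tau> x)"
    by (intro smooth_on_diff S smooth_on_form4_sharp k_inner k \<Phi> \<tau>
        smooth_on_linear[OF S bounded_linear_scaleR_right \<tau>])
  show "smooth_on (snd c ` (W \<inter> fst c \<inter> f -` fst d)) (\<lambda>x. let p = chart_inv c x;
      T = matrix (to_chart \<B> d (f p)) in
      T ** calabi_yau_space.bivec_map (g (f p)) (\<rho> (f p)) (\<sigma> p) ** transpose T)"
    unfolding S_def[symmetric]
  proof (rule smooth_on_cong[OF S _ smooth])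
    fix x
    assume x: "x \<in> S"
    interpret calabi_yau_space "g (q x)" "\<rho> (q x)"
      by (rule calabi_yau_space[OF cy])
    note comps = chart_components[OF \<B> d qd(1)[OF x]]
    have "\<Phi> x = (\<lambda>u1 u2 u3 u4. cayley (from_chart \<B> d (q x) u1) (from_chart \<B> d (q x) u2)
        (from_chart \<B> d (q x) u3) (from_chart \<B> d (q x) u4))"
      by (intro ext) (rule \<Phi>x[OF x])
    then have "alternating4 (\<Phi> x)"
      using alternating4_pullback[OF alternating_cayley comps(1)] by simp
    then have "form4_sharp (k x) (\<Phi> x) (\<tau> x)
        = T x ** form4_sharp (g (q x)) cayley (\<sigma> (chart_inv c x)) ** transpose (T x)"
      unfolding \<tau>_def
      by (intro form4_sharp_congruence[OF h k_inner[OF x] alternating_cayley _ TR[OF x]])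
        (simp_all add: kx[OF x] \<Phi>x[OF x] Tv[OF x] comps(3))
    moreover have "T x ** bivec_map A ** transpose (T x)
        = T x ** form4_sharp (g (q x)) cayley A ** transpose (T x)
          - (1/2) *\<^sub>R (T x ** A ** transpose (T x))" for A
      unfolding bivec_map_def linear_diff[OF linear_congruence[of "T x"]]
        linear_scale[OF linear_congruence[of "T x"]] ..
    ultimately show "form4_sharp (k x) (\<Phi> x) (\<tau> x) - (1/2) *\<^sub>R \<tau> x
      = (let p = chart_inv c x; T = matrix (to_chart \<B> d (f p)) in
        T ** calabi_yau_space.bivec_map (g (f p)) (\<rho> (f p)) (\<sigma> p) ** transpose T)"
      by (simp add: \<tau>_def T_def q_def Let_def)
  qed
qed

lemma cayley_point:
  assumes cy: "calabi_yau4 \<B> g \<rho>" and imm: "cayley_immersion \<A> \<B> g \<rho> f"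
  shows "tangent_dob \<A> \<B> g f p \<noteq> {}"
    and "(e1, e2, e3, e4) \<in> tangent_dob \<A> \<B> g f p \<Longrightarrow> \<exists>n1 n2 n3 n4.
      calabi_yau_space.cayley_frame (g (f p)) (\<rho> (f p)) e1 e2 e3 e4 n1 n2 n3 n4
      \<and> (n1, n2, n3, n4) \<in> normal_dob \<A> \<B> g f p
      \<and> sd_tangent \<A> \<B> g f p = calabi_yau_space.sd_span e1 e2 e3 e4
      \<and> sd_normal \<A> \<B> g f p = calabi_yau_space.sd_span n1 n2 n3 n4"
proof -
  interpret calabi_yau_space "g (f p)" "\<rho> (f p)"
    by (rule calabi_yau_space[OF cy])
  let ?d = "differential \<A> \<B> f p" and ?D = "tangent_dob \<A> \<B> g f p"
  have "smooth_atlas \<A>" "smooth_atlas \<B>" "immersion \<A> \<B> f"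
    using cy imm by (auto simp: calabi_yau4_def complex_atlas_def cayley_immersion_def oriented_atlas4_def)
  then have d: "linear ?d" "inj ?d"
    by (simp_all add: differential_linear immersion_def)
  have calibrated: "cayley e1 e2 e3 e4 = 1" if e: "(e1, e2, e3, e4) \<in> ?D" for e1 e2 e3 e4
  proof -
    have "\<forall>(e1, e2, e3, e4) \<in> ?D. cayley_form g \<rho> (f p) e1 e2 e3 e4 = 1"
      using imm by (simp add: cayley_immersion_def)
    from bspec[OF this e] show ?thesis
      by (simp add: cayley_form_eq[OF cy])
  qed
  have D: "?D \<noteq> {}" "?D = oriented_bases (g (f p)) (range ?d) cayley"
    unfolding tangent_dob_def
    by (rule cayley_tangent_frames[OF d calibrated[unfolded tangent_dob_def]], assumption)+
  show "?D \<noteq> {}"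
    by (rule D(1))
  have V: "subspace (range ?d)" "dim (range ?d) \<le> 4"
    using linear_subspace_image[OF d(1) subspace_UNIV] dim_image_le[OF d(1), of UNIV] by simp_all
  assume e: "(e1, e2, e3, e4) \<in> ?D"
  then have on: "orthonormal (g (f p)) [e1, e2, e3, e4]"
    by (simp add: tangent_dob_def)
  obtain n1 n2 n3 n4 where n: "cayley_frame e1 e2 e3 e4 n1 n2 n3 n4"
    "det (vector [e1, e2, e3, e4, n1, n2, n3, n4] :: real^8^8) > 0"
    by (rule cayley_normal_frame[OF on calibrated[OF e]])
  have fibre: "normal_fibre \<A> \<B> g f p = {n. \<forall>v\<in>range ?d. g (f p) n v = 0}"
    by (simp add: normal_fibre_def tangent_space_def)
  note N = cayley_normal_frames[OF n e D(2) V calibrated, folded fibre]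
  have normal_dob: "normal_dob \<A> \<B> g f p
      = oriented_bases (g (f p)) (normal_fibre \<A> \<B> g f p) cayley"
    unfolding normal_dob_def by (rule N(4))
  have "orthonormal (g (f p)) [n1, n2, n3, n4]"
    using N(3) by (simp add: oriented_bases_def)
  from self_dual_bivectors_eq_span[OF h this alternating_cayley N(2,3)]
  have "sd_normal \<A> \<B> g f p = sd_span n1 n2 n3 n4"
    unfolding sd_normal_def sd_span_def normal_dob .
  moreover from self_dual_bivectors_eq_span[OF h on alternating_cayley N(1) e[unfolded D(2)]]
  have "sd_tangent \<A> \<B> g f p = sd_span e1 e2 e3 e4"
    unfolding sd_tangent_def sd_span_def D(2) tangent_space_def .
  moreover have "(n1, n2, n3, n4) \<in> normal_dob \<A> \<B> g f p"
    using N(3) by (simp only: normal_dob)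
  ultimately show "\<exists>n1 n2 n3 n4. cayley_frame e1 e2 e3 e4 n1 n2 n3 n4
      \<and> (n1, n2, n3, n4) \<in> normal_dob \<A> \<B> g f p
      \<and> sd_tangent \<A> \<B> g f p = sd_span e1 e2 e3 e4 \<and> sd_normal \<A> \<B> g f p = sd_span n1 n2 n3 n4"
    using n(1) by blast
qed

text \<open>Replaces the definite description by an operator that is linear on all 2-tensors and
  refers to no frame, which is the form in which smoothness is available.\<close>

lemma cayley_bivec_map_eq:
  assumes cy: "calabi_yau4 \<B> g \<rho>" and imm: "cayley_immersion \<A> \<B> g \<rho> f"
    and A: "A \<in> sd_tangent \<A> \<B> g f p"
  shows "cayley_bivec_map \<A> \<B> g \<rho> f p A = calabi_yau_space.bivec_map (g (f p)) (\<rho> (f p)) A"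
proof -
  interpret calabi_yau_space "g (f p)" "\<rho> (f p)"
    by (rule calabi_yau_space[OF cy])
  obtain e1 e2 e3 e4 where "(e1, e2, e3, e4) \<in> tangent_dob \<A> \<B> g f p"
    using cayley_point(1)[OF cy imm] by (metis ex_in_conv prod_cases4)
  from cayley_point(2)[OF cy imm this] obtain n1 n2 n3 n4 where
    frame: "cayley_frame e1 e2 e3 e4 n1 n2 n3 n4"
    and sd: "sd_tangent \<A> \<B> g f p = sd_span e1 e2 e3 e4" "sd_normal \<A> \<B> g f p = sd_span n1 n2 n3 n4"
    by blast
  note A = A[unfolded sd]
  show ?thesis
    unfolding cayley_bivec_map_def sd cayley_form_eq[OF cy]
  proof (rule the_equality)
    show "bivec_map A \<in> sd_span n1 n2 n3 n4 \<and> (\<forall>B'\<in>sd_span n1 n2 n3 n4.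
        tensor_inner (g (f p)) (bivec_map A) B' = form4_bivec cayley A B')"
      using bivec_map_sd_span(1)[OF frame A] tensor_inner_bivec_map[OF frame A] by blast
    show "B = bivec_map A" if "B \<in> sd_span n1 n2 n3 n4 \<and> (\<forall>B'\<in>sd_span n1 n2 n3 n4.
        tensor_inner (g (f p)) B B' = form4_bivec cayley A B')" for B
      by (rule bivec_map_unique[OF frame A]) (use that in blast)+
  qed
qed

theorem proposition3p2:
  fixes \<B> :: "('n::{t2_space, second_countable_topology}, real^8) chart set"
    and g :: "'n \<Rightarrow> real^8 \<Rightarrow> real^8 \<Rightarrow> real"
    and \<rho> :: "'n \<Rightarrow> real^8 \<Rightarrow> real^8 \<Rightarrow> real^8 \<Rightarrow> real^8 \<Rightarrow> complex"
    and \<A> :: "('m::{t2_space, second_countable_topology}, real^4) chart set"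
    and f :: "'m \<Rightarrow> 'n"
  assumes "calabi_yau4 \<B> g \<rho>"
    and "cayley_immersion \<A> \<B> g \<rho> f"
  shows "let L = cayley_bivec_map \<A> \<B> g \<rho> f in
    (\<forall>p. \<forall>X\<in>tangent_space \<A> \<B> f p. \<forall>Y\<in>tangent_space \<A> \<B> f p.
            \<forall>U\<in>normal_fibre \<A> \<B> g f p. \<forall>V\<in>normal_fibre \<A> \<B> g f p.
              form4_bivec (cayley_form g \<rho> (f p)) (wedge X Y) (wedge U V)
              = cayley_form g \<rho> (f p) X Y U V)
    \<and> (\<forall>p. \<forall>A\<in>sd_tangent \<A> \<B> g f p. \<forall>B\<in>sd_normal \<A> \<B> g f p.
          tensor_inner (g (f p)) (L p A) B = form4_bivec (cayley_form g \<rho> (f p)) A B)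
    \<and> bivec_bundle_isomorphism \<A> \<B> f (sd_tangent \<A> \<B> g f) (sd_normal \<A> \<B> g f) L
    \<and> (\<forall>p. \<forall>A\<in>sd_tangent \<A> \<B> g f p. \<forall>B\<in>sd_tangent \<A> \<B> g f p.
          bivec_inner (g (f p)) (L p A) (L p B) = bivec_inner (g (f p)) A B)
    \<and> (\<forall>p A. sd_direct_basis (tangent_dob \<A> \<B> g f p) A \<longrightarrow>
          sd_opposite_basis (normal_dob \<A> \<B> g f p) (\<chi> i. L p (A$i)))"
proof -
  define L where "L = cayley_bivec_map \<A> \<B> g \<rho> f"
  define K where "K p = calabi_yau_space.bivec_map (g (f p)) (\<rho> (f p))" for p
  let ?E = "sd_tangent \<A> \<B> g f" and ?F = "sd_normal \<A> \<B> g f"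
  note cy = assms(1) and imm = assms(2)
  have atlas: "smooth_atlas \<A>" "smooth_atlas \<B>" and f: "immersion \<A> \<B> f" "continuous_on UNIV f"
    using cy imm by (auto simp: calabi_yau4_def complex_atlas_def cayley_immersion_def
        oriented_atlas4_def immersion_def)
  have LK: "L p A = K p A" if "A \<in> ?E p" for p A
    unfolding L_def K_def by (rule cayley_bivec_map_eq[OF cy imm that])
  have point: "\<exists>e1 e2 e3 e4 n1 n2 n3 n4.
      calabi_yau_space.cayley_frame (g (f p)) (\<rho> (f p)) e1 e2 e3 e4 n1 n2 n3 n4
      \<and> ?E p = calabi_yau_space.sd_span e1 e2 e3 e4 \<and> ?F p = calabi_yau_space.sd_span n1 n2 n3 n4" for p
  proof -
    obtain e1 e2 e3 e4 where "(e1, e2, e3, e4) \<in> tangent_dob \<A> \<B> g f p"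
      using cayley_point(1)[OF cy imm] by (metis ex_in_conv prod_cases4)
    from cayley_point(2)[OF cy imm this] show ?thesis
      by blast
  qed
  have linear: "linear (K p)" for p
    unfolding K_def by (rule calabi_yau_space.linear_bivec_map[OF calabi_yau_space[OF cy]])
  have fibre: "bij_betw (K p) (?E p) (?F p)" "A \<in> ?E p \<Longrightarrow> K p (K p A) = A"
    "A \<in> ?E p \<Longrightarrow> B \<in> ?E p \<Longrightarrow> bivec_inner (g (f p)) (K p A) (K p B) = bivec_inner (g (f p)) A B"
    "A \<in> ?E p \<Longrightarrow> C \<in> ?F p \<Longrightarrow>
      tensor_inner (g (f p)) (K p A) C = form4_bivec (cayley_form g \<rho> (f p)) A C"
    "subspace (?E p)" for p A B C
  proof -
    interpret calabi_yau_space "g (f p)" "\<rho> (f p)"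
      by (rule calabi_yau_space[OF cy])
    obtain e1 e2 e3 e4 n1 n2 n3 n4 where frame: "cayley_frame e1 e2 e3 e4 n1 n2 n3 n4"
      and sd: "?E p = sd_span e1 e2 e3 e4" "?F p = sd_span n1 n2 n3 n4"
      using point[of p] by blast
    show "bij_betw (K p) (?E p) (?F p)"
      unfolding K_def sd by (rule bivec_map_bij_betw[OF frame])
    show "A \<in> ?E p \<Longrightarrow> K p (K p A) = A"
      unfolding K_def sd by (rule bivec_map_sd_span(2)[OF frame])
    show "A \<in> ?E p \<Longrightarrow> B \<in> ?E p \<Longrightarrow> bivec_inner (g (f p)) (K p A) (K p B) = bivec_inner (g (f p)) A B"
      unfolding K_def sd by (rule bivec_map_sd_span(3)[OF frame])
    show "A \<in> ?E p \<Longrightarrow> C \<in> ?F p \<Longrightarrow>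
      tensor_inner (g (f p)) (K p A) C = form4_bivec (cayley_form g \<rho> (f p)) A C"
      unfolding K_def sd cayley_form_eq[OF cy] by (rule tensor_inner_bivec_map[OF frame])
    show "subspace (?E p)"
      unfolding sd sd_span_def by (rule subspace_span)
  qed
  have "bivec_bundle_isomorphism \<A> \<B> f ?E ?F L"
    unfolding bivec_bundle_isomorphism_def
  proof (intro conjI allI ballI impI)
    fix p
    show "bij_betw (L p) (?E p) (?F p)"
      by (rule iffD2[OF bij_betw_cong[OF LK] fibre(1)])
    fix A B a b
    assume AB: "A \<in> ?E p" "B \<in> ?E p"
    then have "a *\<^sub>R A + b *\<^sub>R B \<in> ?E p"
      by (intro subspace_add subspace_scale fibre(5))
    then show "L p (a *\<^sub>R A + b *\<^sub>R B) = a *\<^sub>R L p A + b *\<^sub>R L p B"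
      using linear[of p] AB by (simp add: LK linear_add linear_scale)
  next
    fix W \<sigma>
    assume W: "open W" and \<sigma>: "\<forall>p\<in>W. \<sigma> p \<in> ?E p"
    note K_smooth = smooth_bivec_section_bivec_map[OF cy atlas(1) f(1) W, folded K_def]
    note cong = smooth_bivec_section_cong[OF atlas(1) _ W atlas(2) f(2)]
    show "smooth_bivec_section \<A> \<B> f W \<sigma> \<longleftrightarrow> smooth_bivec_section \<A> \<B> f W (\<lambda>p. L p (\<sigma> p))"
    proof
      assume "smooth_bivec_section \<A> \<B> f W \<sigma>"
      then have "smooth_bivec_section \<A> \<B> f W (\<lambda>p. K p (\<sigma> p))"
        by (rule K_smooth)
      then show "smooth_bivec_section \<A> \<B> f W (\<lambda>p. L p (\<sigma> p))"
        by (rule cong[rotated]) (simp add: LK \<sigma>)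
    next
      assume "smooth_bivec_section \<A> \<B> f W (\<lambda>p. L p (\<sigma> p))"
      \<comment> \<open>\<open>K\<close> undoes itself on self-dual tangent bivectors, so the
        smoothness result for \<open>K\<close> also yields the converse direction.\<close>
      then have "smooth_bivec_section \<A> \<B> f W (\<lambda>p. K p (L p (\<sigma> p)))"
        by (rule K_smooth)
      then show "smooth_bivec_section \<A> \<B> f W \<sigma>"
        by (rule cong[rotated]) (simp add: LK \<sigma> fibre(2))
    qed
  qed
  moreover have "sd_opposite_basis (normal_dob \<A> \<B> g f p) (\<chi> i. L p (A$i))"
    if basis: "sd_direct_basis (tangent_dob \<A> \<B> g f p) A" for p A
  proof -
    interpret calabi_yau_space "g (f p)" "\<rho> (f p)"
      by (rule calabi_yau_space[OF cy])
    obtain e and C :: "real^3^3" where "e \<in> tangent_dob \<A> \<B> g f p"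
      and "det C > 0 \<and> (\<forall>i. A$i = (\<Sum>j\<in>UNIV. C$i$j *\<^sub>R sd_frame e $ j))"
      using basis unfolding sd_direct_basis_def by (elim bexE exE)
    moreover obtain e1 e2 e3 e4 where "e = (e1, e2, e3, e4)"
      by (cases e)
    ultimately have e: "(e1, e2, e3, e4) \<in> tangent_dob \<A> \<B> g f p"
      and C: "det C > 0" "\<And>i. A$i = (\<Sum>j\<in>UNIV. C$i$j *\<^sub>R sd_frame (e1, e2, e3, e4) $ j)"
      by simp_all
    obtain n1 n2 n3 n4 where frame: "cayley_frame e1 e2 e3 e4 n1 n2 n3 n4"
      and n: "(n1, n2, n3, n4) \<in> normal_dob \<A> \<B> g f p" and sd: "?E p = sd_span e1 e2 e3 e4"
      using cayley_point(2)[OF cy imm e] by blast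
    \<comment> \<open>Negating the third column accounts for the sign on the third basis bivector
      and reverses the sign of the determinant.\<close>
    define C' :: "real^3^3" where "C' = (\<chi> i j. if j = 3 then - C$i$j else C$i$j)"
    have A: "A$i = C$i$1 *\<^sub>R (wedge e1 e2 + wedge e3 e4) + C$i$2 *\<^sub>R (wedge e1 e3 - wedge e2 e4)
        + C$i$3 *\<^sub>R (wedge e1 e4 + wedge e2 e3)" for i
      by (simp add: C(2) sum_3 sd_frame_def)
    have "L p (A$i) = (\<Sum>j\<in>UNIV. C'$i$j *\<^sub>R sd_frame (n1, n2, n3, n4) $ j)" for i
    proof -
      have "A$i \<in> ?E p"
        unfolding sd sd_span_def A by (intro span_add span_scale span_base) auto
      then have "L p (A$i) = bivec_map (A$i)"
        by (simp add: LK K_def)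
      then show ?thesis
        unfolding A bivec_map_combination[OF frame] by (simp add: sum_3 sd_frame_def C'_def)
    qed
    moreover have "det C' < 0"
      using C(1) by (simp add: C'_def det_3)
    ultimately show ?thesis
      unfolding sd_opposite_basis_def by (intro bexI[OF _ n] exI[of _ C'] conjI allI) simp_all
  qed
  moreover have "form4_bivec (cayley_form g \<rho> (f p)) (wedge X Y) (wedge U V)
      = cayley_form g \<rho> (f p) X Y U V" for p X Y U V
    unfolding cayley_form_eq[OF cy]
    by (rule form4_bivec_wedge[OF calabi_yau_space.alternating_cayley[OF calabi_yau_space[OF cy]]])
  ultimately show ?thesis
    unfolding Let_def L_def[symmetric]
    by (intro conjI allI ballI impI) (simp_all add: LK fibre(3,4))
qed

end
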